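(* Let $T$ be a convex tiling of a convex polygon $R$ whose associated bipartite graph $\mathcal{G}$ has all bounded faces of degree $4$. Let $(A_w)_{w\in W}$ be positive real numbers whose sum equals the area of $R$. Then there is a unique homology tiling of $R$ combinatorially equivalent to $T$ in which, for every $w\in W$, the homology tile $w$ has area $A_w$ and the same tile orientation as the tile $w$ of $T$.
   Context: A tiling of a polygon $R\subset\mathbb{R}^2$ is a covering of $R$ by finitely many convex polygons (tiles) with pairwise disjoint interiors (not necessarily edge-to-edge), with "T"-junctions at every tile vertex other than the convex corners of $R$. The associated bipartite planar graph $\mathcal{G}$ has a white vertex for each tile (the set $W$), a black vertex for each maximal line segment in the union of tile boundaries, and an edge $wb$ when tile $w$ has an edge contained in segment $b$; black vertices from segments on $\partial R$ are boundary vertices (each corresponding to an edge of $R$), the remaining ones form $B_{int}$. The intercept $i_b$ of segment $b$ is the signed distance from the origin to the line $L_b$ containing it. Tilings combinatorially equivalent to $T$ (same graph, boundary vertices fixed, same edge directions) are parametrized by the intercepts $(i_b)_{b\in B_{int}}$, with the lines of the boundary vertices fixed to be the lines of the edges of $R$. A homology tiling combinatorially equivalent to $T$ is given by an arbitrary vector $(i_b)_{b\in B_{int}}\in\mathbb{R}^{B_{int}}$: for each $w\in W$, with adjacent black vertices $b_1,\dots,b_n$ in the cyclic order of the edges of tile $w$ in $T$, the homology tile $w$ is the closed polygonal path through the successive points $L_{b_j}\cap L_{b_{j+1}}$ (indices mod $n$), where $L_b$ is the line in the direction of segment $b$ with intercept $i_b$. For a convex tile $t$ with counterclockwise edge vectors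 $z_1,\dots,z_n$, let $V_t$ be the real vector space of closed polygonal paths (up to translation) with edge vectors $a_1z_1,\dots,a_nz_n$, $a_i\in\mathbb{R}$, $\sum a_iz_i=0$, and let $q_t$ be the signed area $\oint x\,dy$ on $V_t$. The set $\{q_t>0\}$ has two connected components $V_t^+,V_t^-$, where $V_t^+$ contains the polygons with all $a_i>0$ and $V_t^-$ those with all $a_i<0$. The area of a homology tile is $q_t$ of it, and its tile orientation is $+$ or $-$ according to whether it lies in $V_t^+$ or $V_t^-$; for the tiles of $T$ itself the orientation is $+$.
   Formalization: The tiling is also required to have no interior segment ending at a corner of R; without this the claim fails (a unit square cut by its diagonal has homology areas (1/√2 ± d)², of total 1 only for d = 0). *)

theory Defs
  imports "HOL-Analysis.Analysis" "HOL-Combinatorics.Orbits"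
begin

type_synonym point = "real^2"

definition cross2 :: "point \<Rightarrow> point \<Rightarrow> real" where
  "cross2 u v = u $ 1 * v $ 2 - u $ 2 * v $ 1"

definition convex_polygon :: "point set \<Rightarrow> bool" where
  "convex_polygon S \<longleftrightarrow> polytope S \<and> interior S \<noteq> {}"

text \<open>The sides of a convex polygon \<open>t\<close>, directed counterclockwise (with \<open>t\<close> on the left).
  The side that follows \<open>(p, q)\<close> in the cyclic order is the one of the form \<open>(q, r)\<close>.\<close>

definition ccw_sides :: "point set \<Rightarrow> (point \<times> point) set" where
  "ccw_sides t = {(p, q). closed_segment p q edge_of t \<and> (\<forall>x\<in>t. 0 \<le> cross2 (q - p) (x - p))}"


section \<open>Tilings\<close>

definition is_segment :: "point set \<Rightarrow> bool" where
  "is_segment b \<longleftrightarrow> (\<exists>x y. x \<noteq> y \<and> b = closed_segment x y)"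

definition skeleton :: "point set set \<Rightarrow> point set" where
  "skeleton T = (\<Union>w\<in>T. frontier w)"

definition segments :: "point set set \<Rightarrow> point set set" where
  "segments T = {b. is_segment b \<and> b \<subseteq> skeleton T \<and>
     (\<forall>b'. is_segment b' \<and> b \<subseteq> b' \<and> b' \<subseteq> skeleton T \<longrightarrow> b' = b)}"

definition boundary_segments :: "point set \<Rightarrow> point set set \<Rightarrow> point set set" where
  "boundary_segments R T = {b \<in> segments T. b \<subseteq> frontier R}"

definition interior_segments :: "point set \<Rightarrow> point set set \<Rightarrow> point set set" where
  "interior_segments R T = segments T - boundary_segments R T"

text \<open>At a T-junction exactly one segment passes through; all other segments containing the
  point end there. Several segments may end at the same point; it is the condition on
  the faces of the graph that excludes several of them ending on the same side.\<close>

definition T_junction :: "point set set \<Rightarrow> point \<Rightarrow> bool" where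
  "T_junction T v \<longleftrightarrow> (\<exists>!b. b \<in> segments T \<and> v \<in> rel_interior b)"

text \<open>The last condition says that there is no junction at a corner of \<open>R\<close>. Without it the
  lines of the interior segments could not be moved independently, since a segment ending at a
  corner would have to pass through that fixed point.\<close>

definition convex_tiling :: "point set \<Rightarrow> point set set \<Rightarrow> bool" where
  "convex_tiling R T \<longleftrightarrow>
     finite T \<and> (\<forall>w\<in>T. convex_polygon w) \<and> \<Union>T = R \<and>
     pairwise (\<lambda>w w'. interior w \<inter> interior w' = {}) T \<and>
     (\<forall>w\<in>T. \<forall>v. v extreme_point_of w \<and> \<not> v extreme_point_of R \<longrightarrow> T_junction T v) \<and>
     (\<forall>v b. v extreme_point_of R \<and> b \<in> interior_segments R T \<longrightarrow> v \<notin> b)"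


section \<open>The bipartite planar graph\<close>

definition adjacent :: "point set set \<Rightarrow> point set \<Rightarrow> point set \<Rightarrow> bool" where
  "adjacent T w b \<longleftrightarrow> w \<in> T \<and> b \<in> segments T \<and> (\<exists>e. e edge_of w \<and> e \<subseteq> b)"

definition side :: "point set \<Rightarrow> point set \<Rightarrow> point \<times> point" where
  "side w b = (THE s. s \<in> ccw_sides w \<and> closed_segment (fst s) (snd s) \<subseteq> b)"

text \<open>The planar embedding is given by the cyclic order of the edges at each vertex. At a white
  vertex this is the order of the sides of the tile.
  At a black vertex \<open>b\<close>, the tiles are met in the following order when walking
  clockwise around \<open>b\<close>: in the order in which they lie along one side of \<open>b\<close> up to the end
  point of \<open>b\<close>, then back along the other side (the counterclockwise sides of the tiles are then
  all traversed forwards). If \<open>b\<close> is on the boundary of \<open>R\<close>, there are tiles on one side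
  only and the last one is followed by the first one.
  \<open>follows_around R T b w w'\<close> says that \<open>w'\<close> comes directly after \<open>w\<close>.\<close>

definition follows_around ::
  "point set \<Rightarrow> point set set \<Rightarrow> point set \<Rightarrow> point set \<Rightarrow> point set \<Rightarrow> bool" where
  "follows_around R T b w w' \<longleftrightarrow> adjacent T w b \<and> adjacent T w' b \<and>
     (let (p, q) = side w b; (p', q') = side w' b in
        if q extreme_point_of b
        then (if b \<in> boundary_segments R T then p' extreme_point_of b else p' = q)
        else p' = q \<and> (q - p) \<bullet> (q' - p') > 0)"

text \<open>A dart is an edge \<open>wb\<close> of the graph, directed from \<open>w\<close> to \<open>b\<close> or from \<open>b\<close> to \<open>w\<close>.\<close>

datatype dart = From_white "point set" "point set" | From_black "point set" "point set"

definition darts :: "point set set \<Rightarrow> dart set" where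
  "darts T = {From_white w b | w b. adjacent T w b} \<union> {From_black b w | w b. adjacent T w b}"

text \<open>Face tracing: arriving at a vertex along an edge, leave it along the
  edge that is next in the counterclockwise order. The faces are the orbits,
  and the degree of a face is the length of its orbit.\<close>

fun face_step :: "point set \<Rightarrow> point set set \<Rightarrow> dart \<Rightarrow> dart" where
  "face_step R T (From_white w b) = From_black b (THE w'. follows_around R T b w' w)"
| "face_step R T (From_black b w) =
     From_white w (THE b'. adjacent T w b' \<and> fst (side w b') = snd (side w b))"

definition faces :: "point set \<Rightarrow> point set set \<Rightarrow> dart set set" where
  "faces R T = orbit (face_step R T) ` darts T"

text \<open>The unbounded face is the one entered when passing from the first to the last tile
  along an edge of \<open>R\<close>.\<close>

definition outer_dart :: "point set \<Rightarrow> point set set \<Rightarrow> dart \<Rightarrow> bool" where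
  "outer_dart R T d \<longleftrightarrow> (\<exists>w b. d = From_white w b \<and> adjacent T w b \<and>
     b \<in> boundary_segments R T \<and> fst (side w b) extreme_point_of b)"

definition bounded_faces :: "point set \<Rightarrow> point set set \<Rightarrow> dart set set" where
  "bounded_faces R T = {f \<in> faces R T. \<not> (\<exists>d\<in>f. outer_dart R T d)}"


section \<open>Closed polygonal paths parallel to a tile\<close>

text \<open>A closed polygonal path with as many vertices as \<open>t\<close> is a map \<open>P\<close> assigning to each
  vertex of \<open>t\<close> the corresponding vertex of the path. Its signed area is the integral of
  \<open>x dy\<close> along the path.\<close>

definition signed_area :: "point set \<Rightarrow> (point \<Rightarrow> point) \<Rightarrow> real" where
  "signed_area t P = (\<Sum>(p, q)\<in>ccw_sides t.
     integral {0..1} (\<lambda>s. linepath (P p) (P q) s $ 1 * (P q - P p) $ 2))"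

text \<open>Paths up to translation with sides parallel to those of \<open>t\<close> are given by the
  coefficients of their edge vectors.\<close>

definition edge_coeffs :: "point set \<Rightarrow> (point \<Rightarrow> point) \<Rightarrow> point \<times> point \<Rightarrow> real" where
  "edge_coeffs t P = (\<lambda>(p, q)\<in>ccw_sides t. THE a. P q - P p = a *\<^sub>R (q - p))"

definition path_space :: "point set \<Rightarrow> (point \<times> point \<Rightarrow> real) set" where
  "path_space t = {a \<in> ccw_sides t \<rightarrow>\<^sub>E UNIV. (\<Sum>(p, q)\<in>ccw_sides t. a (p, q) *\<^sub>R (q - p)) = 0}"

definition area_form :: "point set \<Rightarrow> (point \<times> point \<Rightarrow> real) \<Rightarrow> real" where
  "area_form t a =
     signed_area t (SOME P. \<forall>(p, q)\<in>ccw_sides t. P q - P p = a (p, q) *\<^sub>R (q - p))"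

definition positive_paths :: "point set \<Rightarrow> (point \<times> point \<Rightarrow> real) set" where
  "positive_paths t = {a \<in> path_space t. area_form t a > 0}"

definition V_plus :: "point set \<Rightarrow> (point \<times> point \<Rightarrow> real) set" where
  "V_plus t = {a. \<exists>a0. (\<forall>s\<in>ccw_sides t. a0 s > 0) \<and> connected_component (positive_paths t) a0 a}"

definition V_minus :: "point set \<Rightarrow> (point \<times> point \<Rightarrow> real) set" where
  "V_minus t = {a. \<exists>a0. (\<forall>s\<in>ccw_sides t. a0 s < 0) \<and> connected_component (positive_paths t) a0 a}"

definition tile_orientation :: "point set \<Rightarrow> (point \<Rightarrow> point) \<Rightarrow> int" where
  "tile_orientation t P =
     (if edge_coeffs t P \<in> V_plus t then 1 else if edge_coeffs t P \<in> V_minus t then -1 else 0)"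


section \<open>Homology tilings\<close>

text \<open>A choice of unit normals fixes the signs of the intercepts.\<close>

definition unit_normals :: "point set set \<Rightarrow> (point set \<Rightarrow> point) \<Rightarrow> bool" where
  "unit_normals T \<nu> \<longleftrightarrow> (\<forall>b\<in>segments T. norm (\<nu> b) = 1 \<and> (\<forall>x\<in>b. \<forall>y\<in>b. \<nu> b \<bullet> (x - y) = 0))"

definition intercept :: "(point set \<Rightarrow> point) \<Rightarrow> point set \<Rightarrow> real" where
  "intercept \<nu> b = (THE c. \<forall>x\<in>b. \<nu> b \<bullet> x = c)"

definition homology_line ::
  "point set \<Rightarrow> point set set \<Rightarrow> (point set \<Rightarrow> point) \<Rightarrow> (point set \<Rightarrow> real) \<Rightarrow> point set \<Rightarrow> point set"
  where
  "homology_line R T \<nu> i b =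
     {x. \<nu> b \<bullet> x = (if b \<in> interior_segments R T then i b else intercept \<nu> b)}"

definition incoming_segment :: "point set set \<Rightarrow> point set \<Rightarrow> point \<Rightarrow> point set" where
  "incoming_segment T w v = (THE b. adjacent T w b \<and> snd (side w b) = v)"

definition outgoing_segment :: "point set set \<Rightarrow> point set \<Rightarrow> point \<Rightarrow> point set" where
  "outgoing_segment T w v = (THE b. adjacent T w b \<and> fst (side w b) = v)"

definition homology_tile ::
  "point set \<Rightarrow> point set set \<Rightarrow> (point set \<Rightarrow> point) \<Rightarrow> (point set \<Rightarrow> real) \<Rightarrow>
   point set \<Rightarrow> point \<Rightarrow> point" where
  "homology_tile R T \<nu> i w v =
     (THE x. homology_line R T \<nu> i (incoming_segment T w v) \<inter>
             homology_line R T \<nu> i (outgoing_segment T w v) = {x})"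

end

theory Submission
  imports Defs
begin

text \<open>Fix a sheared coordinate \<open>f\<close> for which no side is vertical. For a closed path \<open>P\<close> parallel
  to a convex tile, summation by parts turns the signed area into
  \<open>\<Sum> c\<^sub>v f(P v)\<^sup>2 / 2\<close> over the vertices, where \<open>c\<^sub>v\<close> is the slope of the incoming minus that of the
  outgoing side; it is negative except at the leftmost and the rightmost vertex. Hence the area form
  is Lorentzian, with the tile itself in its positive cone, and satisfies the reverse Cauchy--Schwarz
  inequality there.

  When all bounded faces have degree 4, at each junction that is not a corner of \<open>R\<close> the corners of
  tiles come in pairs with the same two segments in opposite roles, so their contributions to the
  sum of all areas cancel and the total area does not depend on the intercepts. Uniqueness follows
  by applying the reverse Cauchy--Schwarz inequality to two solutions. For existence, maximize
  \<open>\<Prod> q\<^sub>w powr A\<^sub>w\<close> over the compact set of intercepts whose tiles lie in the closed positive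
  cones. A direction along which no area changes to first order is trivial (all second order terms
  are \<open>\<le> 0\<close> with sum \<open>0\<close>), and there are at least \<open>card T - 1\<close> interior segments, since each tile but one
  has at its leftmost vertex a segment that ends there. So at the maximum all the multipliers
  \<open>A\<^sub>w / q\<^sub>w\<close> are equal, hence equal to 1.\<close>

section \<open>Lorentzian families of quadratic forms\<close>

text \<open>The prescribed areas are quadratic conditions on the intercepts, so solvability is not a
  matter of linear algebra. What helps is that all areas are Lorentzian forms on one common space.
  Where such a form is positive there are two opposite cones, and the linear functional given by
  pairing with the original tile tells them apart, since it cannot vanish there. Tile orientation
  thus becomes one linear inequality per tile. These functionals are bounded below on the admissible
  region and have constant sum, which bounds the region.

  The areas enter as exponents because the critical equation of the logarithm then has multipliers
  \<open>A w / q w\<close>; and the product vanishes as soon as one \<open>q w\<close> does, so the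
  maximum is interior. Constancy of the total already gives one linear relation among the gradients,
  with all coefficients equal. The dimension count shows that every other relation is a multiple of
  it.

  A single form is degenerate, because translating a tile does not change its area. Only all tiles
  together, held by the fixed lines of \<open>R\<close>, exclude a nonzero null direction; hence
  equality cases are always settled by a joint rigidity statement.\<close>

lemma homogeneous_system_nontrivial:
  fixes a :: "'i \<Rightarrow> 'b \<Rightarrow> real"
  assumes "finite I" "finite B" "card I < card B"
  shows "\<exists>u. u \<noteq> (\<lambda>b. 0) \<and> (\<forall>b. b \<notin> B \<longrightarrow> u b = 0) \<and> (\<forall>i\<in>I. (\<Sum>b\<in>B. a i b * u b) = 0)"
  using assms
proof (induction I arbitrary: B a rule: finite_induct)
  case empty
  then obtain b0 where "b0 \<in> B" by fastforce
  then have "(\<lambda>b. if b = b0 then 1 else 0 :: real) \<noteq> (\<lambda>b. 0)"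
      "\<forall>b. b \<notin> B \<longrightarrow> (if b = b0 then 1 else 0 :: real) = 0"
    by (auto simp: fun_eq_iff)
  then show ?case by blast
next
  case (insert i I)
  show ?case
  proof (cases "\<exists>b\<in>B. a i b \<noteq> 0")
    case False
    obtain u where "u \<noteq> (\<lambda>b. 0)" "\<forall>b. b \<notin> B \<longrightarrow> u b = 0" "\<forall>k\<in>I. (\<Sum>b\<in>B. a k b * u b) = 0"
      using insert.IH[of B a] insert.prems insert.hyps by auto
    then show ?thesis using False by (intro exI[of _ u]) auto
  next
    case True
    then obtain c where c: "c \<in> B" "a i c \<noteq> 0" by blast
    let ?B = "B - {c}"
    define a' where "a' k b = a k b - a k c / a i c * a i b" for k b
    have "card I < card ?B" using insert.prems insert.hyps c by (simp add: card_Diff_singleton)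
    then obtain u where u: "u \<noteq> (\<lambda>b. 0)" "\<And>b. b \<notin> ?B \<Longrightarrow> u b = 0"
      "\<And>k. k \<in> I \<Longrightarrow> (\<Sum>b\<in>?B. a' k b * u b) = 0"
      using insert.IH[of ?B a'] insert.prems by auto
    define s where "s = - (\<Sum>b\<in>?B. a i b * u b) / a i c"
    let ?u = "u(c := s)"
    have sumB: "(\<Sum>b\<in>B. a k b * ?u b) = a k c * s + (\<Sum>b\<in>?B. a k b * u b)" for k
      using insert.prems c by (subst sum.remove[of B c]) auto
    have "(\<Sum>b\<in>B. a i b * ?u b) = 0"
      unfolding sumB unfolding s_def using c by simp
    moreover have "(\<Sum>b\<in>B. a k b * ?u b) = 0" if "k \<in> I" for k
    proof -
      have "0 = (\<Sum>b\<in>?B. a k b * u b) - a k c / a i c * (\<Sum>b\<in>?B. a i b * u b)"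
        using u(3)[OF that] by (simp add: a'_def algebra_simps sum_subtractf sum_distrib_left)
      then show ?thesis unfolding sumB unfolding s_def by simp
    qed
    moreover have "?u \<noteq> (\<lambda>b. 0)"
    proof -
      obtain b where "u b \<noteq> 0" using u(1) by auto
      moreover have "b \<noteq> c" using calculation u(2)[of c] by auto
      ultimately show ?thesis by (metis fun_upd_other)
    qed
    moreover have "\<forall>b. b \<notin> B \<longrightarrow> ?u b = 0" using u(2) c by auto
    ultimately show ?thesis by blast
  qed
qed

text \<open>The index type may be infinite, so this is Tychonoff's theorem for the product topology,
  with the one-point factor \<open>{0}\<close> at each index outside \<open>B\<close>.\<close>

lemma compact_box_fun:
  fixes M :: real
  shows "compact {u :: 'b \<Rightarrow> real. \<forall>b. u b \<in> (if b \<in> B then {-M..M} else {0})}"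
proof -
  have "{u :: 'b \<Rightarrow> real. \<forall>b. u b \<in> (if b \<in> B then {-M..M} else {0})} =
      PiE UNIV (\<lambda>b. if b \<in> B then {-M..M} else {0})"
    unfolding PiE_UNIV_domain Pi_def by simp
  moreover have "compactin euclidean (PiE UNIV (\<lambda>b::'b. if b \<in> B then {-M..M} else {0::real}))"
    unfolding euclidean_product_topology[symmetric] by (subst compactin_PiE) auto
  ultimately show ?thesis by simp
qed

lemma continuous_on_eval: "continuous_on S (\<lambda>u :: 'b \<Rightarrow> real. u b)"
  by (rule continuous_on_subset[OF continuous_on_product_coordinates subset_UNIV])

text \<open>The part of the argument that is free of geometry. \<open>x0\<close> stands for the
  intercepts of the given tiling and need not vanish outside \<open>B\<close>: it carries the fixed
  lines, and only displacements \<open>u\<close> are supported in \<open>B\<close>. The signature is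
  required at \<open>x0\<close> alone, and \<open>rigid\<close> is the joint substitute for
  nondegeneracy of the single forms.\<close>

locale lorentz_family =
  fixes W :: "'w set" and B :: "'b set"
    and bil :: "'w \<Rightarrow> ('b \<Rightarrow> real) \<Rightarrow> ('b \<Rightarrow> real) \<Rightarrow> real" and x0 :: "'b \<Rightarrow> real"
  assumes finW: "finite W" and finB: "finite B"
    and bil_sym: "w \<in> W \<Longrightarrow> bil w u v = bil w v u"
    and bil_lin: "w \<in> W \<Longrightarrow> bil w (\<lambda>b. r * u b + s * v b) y = r * bil w u y + s * bil w v y"
    and bil_cont: "w \<in> W \<Longrightarrow> continuous_on UNIV (\<lambda>u. bil w u u)"
    and pos0: "w \<in> W \<Longrightarrow> bil w x0 x0 > 0"
    and lorentz0: "w \<in> W \<Longrightarrow> bil w x0 u = 0 \<Longrightarrow> bil w u u \<le> 0"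
    and rigid: "(\<And>b. b \<notin> B \<Longrightarrow> u b = 0) \<Longrightarrow>
        (\<And>w. w \<in> W \<Longrightarrow> bil w x0 u = 0 \<and> bil w u u = 0) \<Longrightarrow> u = (\<lambda>b. 0)"
    and total: "(\<And>b. b \<notin> B \<Longrightarrow> u b = 0) \<Longrightarrow>
        (\<Sum>w\<in>W. bil w (\<lambda>b. x0 b + u b) (\<lambda>b. x0 b + u b)) = (\<Sum>w\<in>W. bil w x0 x0)"
    and card_le: "card W \<le> card B + 1"
begin

section \<open>Signature at other points, and uniqueness\<close>

definition supp :: "('b \<Rightarrow> real) \<Rightarrow> bool" where
  "supp u \<longleftrightarrow> (\<forall>b. b \<notin> B \<longrightarrow> u b = 0)"

lemma bil_lin_right:
  assumes w: "w \<in> W"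
  shows "bil w y (\<lambda>b. r * u b + s * v b) = r * bil w y u + s * bil w y v"
  unfolding bil_sym[OF w, of y "\<lambda>b. r * u b + s * v b"] bil_lin[OF w]
    bil_sym[OF w, of u y] bil_sym[OF w, of v y] ..

lemma bil_add: "w \<in> W \<Longrightarrow> bil w (\<lambda>b. u b + v b) y = bil w u y + bil w v y"
  using bil_lin[of w 1 u 1 v y] by simp

lemma bil_add_right: "w \<in> W \<Longrightarrow> bil w y (\<lambda>b. u b + v b) = bil w y u + bil w y v"
  using bil_lin_right[of w y 1 u 1 v] by simp

lemma bil_quad:
  assumes "w \<in> W"
  shows "bil w (\<lambda>b. r * u b + s * v b) (\<lambda>b. r * u b + s * v b) =
    r\<^sup>2 * bil w u u + 2 * r * s * bil w u v + s\<^sup>2 * bil w v v"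
  using bil_sym[OF assms, of v u]
  by (simp add: bil_lin[OF assms] bil_lin_right[OF assms] power2_eq_square algebra_simps)

lemma bil_zero: "w \<in> W \<Longrightarrow> bil w (\<lambda>b. 0) y = 0"
  using bil_lin[of w 0 y 0 y y] by simp

text \<open>The combination of \<open>d\<close> and \<open>x\<close> orthogonal to \<open>x0\<close>
  has value \<open>s\<^sup>2 * bil w d d + t\<^sup>2 * bil w x x\<close>, without a cross term
  because \<open>d\<close> is orthogonal to \<open>x\<close>; so the sign condition passes from
  \<open>x0\<close> to \<open>x\<close>. In the equality case the same bound forces
  \<open>t = 0\<close>, which brings the conclusion back to \<open>x0\<close>, where
  \<open>rigid\<close> applies.\<close>

lemma lorentz:
  assumes w: "w \<in> W" and x: "bil w x x > 0" and d: "bil w x d = 0"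
  shows "bil w d d \<le> 0" and "bil w d d = 0 \<Longrightarrow> bil w x0 d = 0"
proof -
  define s where "s = bil w x0 x"
  define t where "t = bil w x0 d"
  have s: "s \<noteq> 0" using lorentz0[OF w, of x] x by (auto simp: s_def)
  have "bil w x0 (\<lambda>b. s * d b + (- t) * x b) = 0"
    unfolding bil_lin_right[OF w] by (simp add: s_def t_def)
  from lorentz0[OF w this] have "s\<^sup>2 * bil w d d + t\<^sup>2 * bil w x x \<le> 0"
    unfolding bil_quad[OF w] using d bil_sym[OF w, of x d] by simp
  moreover have "t\<^sup>2 * bil w x x \<ge> 0" using x by simp
  ultimately have le: "s\<^sup>2 * bil w d d \<le> 0" by linarith
  then show "bil w d d \<le> 0" using s by (simp add: mult_le_0_iff)
  assume "bil w d d = 0"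
  then have "t\<^sup>2 * bil w x x \<le> 0"
    using \<open>s\<^sup>2 * bil w d d + t\<^sup>2 * bil w x x \<le> 0\<close> by simp
  then show "bil w x0 d = 0" using x by (simp add: t_def mult_le_0_iff)
qed

text \<open>The combination of \<open>x\<close> and \<open>y\<close> orthogonal to \<open>x0\<close>
  yields the sign of \<open>bil w x y\<close>, the one orthogonal to \<open>x\<close> the
  inequality. The sign is needed to take square roots in the inequality later.\<close>

lemma reverse_Cauchy_Schwarz:
  assumes w: "w \<in> W" and x: "bil w x x > 0" "bil w x0 x > 0" and y: "bil w y y > 0" "bil w x0 y > 0"
  shows "bil w x y > 0" "bil w x x * bil w y y \<le> (bil w x y)\<^sup>2"
proof -
  let ?s = "bil w x0 x" and ?t = "bil w x0 y"
  have "bil w x0 (\<lambda>b. ?t * x b + (- ?s) * y b) = 0" unfolding bil_lin_right[OF w] by simp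
  from lorentz0[OF w this] have "?t\<^sup>2 * bil w x x + ?s\<^sup>2 * bil w y y \<le> 2 * ?t * ?s * bil w x y"
    unfolding bil_quad[OF w] by simp
  moreover have "?t\<^sup>2 * bil w x x + ?s\<^sup>2 * bil w y y > 0" using x y by (simp add: add_pos_pos)
  ultimately have "2 * ?t * ?s * bil w x y > 0" by linarith
  moreover have "2 * ?t * ?s > 0" using x y by simp
  ultimately show "bil w x y > 0" using zero_less_mult_pos by blast
  let ?p = "bil w x y" and ?q = "bil w x x"
  have "bil w x (\<lambda>b. ?q * y b + (- ?p) * x b) = 0"
    unfolding bil_lin_right[OF w] using bil_sym[OF w] by simp
  from lorentz(1)[OF w x(1) this] have "?q * (?q * bil w y y - ?p\<^sup>2) \<le> 0"
    unfolding bil_quad[OF w] using bil_sym[OF w, of y x] by (simp add: power2_eq_square algebra_simps)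
  then show "?q * bil w y y \<le> ?p\<^sup>2" using x by (simp add: mult_le_0_iff)
qed

text \<open>By \<open>total\<close> a quadratic polynomial in \<open>r\<close> is constant; its
  values at 1 and -1 separate the linear from the quadratic coefficient.\<close>

lemma sum_bil_zero:
  assumes u: "supp u"
  shows "(\<Sum>w\<in>W. bil w x0 u) = 0" "(\<Sum>w\<in>W. bil w u u) = 0"
proof -
  have ex: "(\<Sum>w\<in>W. bil w (\<lambda>b. x0 b + r * u b) (\<lambda>b. x0 b + r * u b)) =
     (\<Sum>w\<in>W. bil w x0 x0) + 2 * r * (\<Sum>w\<in>W. bil w x0 u) + r\<^sup>2 * (\<Sum>w\<in>W. bil w u u)" for r
    unfolding sum_distrib_left sum.distrib[symmetric]
  proof (rule sum.cong[OF refl])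
    fix w assume "w \<in> W"
    from bil_quad[OF this, of 1 x0 r u]
    show "bil w (\<lambda>b. x0 b + r * u b) (\<lambda>b. x0 b + r * u b) =
        bil w x0 x0 + 2 * r * bil w x0 u + r\<^sup>2 * bil w u u" by simp
  qed
  have e1: "(\<Sum>w\<in>W. bil w (\<lambda>b. x0 b + r * u b) (\<lambda>b. x0 b + r * u b)) = (\<Sum>w\<in>W. bil w x0 x0)" for r
    by (rule total) (use u in \<open>auto simp: supp_def\<close>)
  show "(\<Sum>w\<in>W. bil w x0 u) = 0" "(\<Sum>w\<in>W. bil w u u) = 0"
    using ex[of 1] ex[of "-1"] e1[of 1] e1[of "-1"] by simp_all
qed

text \<open>By polarization, the total area has zero derivative at every displaced point, not only
  at \<open>x0\<close>.\<close>

lemma sum_bil_polar: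
  assumes u: "supp u" and v: "supp v"
  shows "(\<Sum>w\<in>W. bil w (\<lambda>b. x0 b + u b) v) = 0"
proof -
  have s: "supp (\<lambda>b. 1 * u b + 1 * v b)" using u v by (simp add: supp_def)
  have "(\<Sum>w\<in>W. bil w (\<lambda>b. 1 * u b + 1 * v b) (\<lambda>b. 1 * u b + 1 * v b)) =
      (\<Sum>w\<in>W. bil w u u) + 2 * (\<Sum>w\<in>W. bil w u v) + (\<Sum>w\<in>W. bil w v v)"
    unfolding sum_distrib_left sum.distrib[symmetric]
  proof (rule sum.cong[OF refl])
    fix w assume "w \<in> W"
    from bil_quad[OF this, of 1 u 1 v]
    show "bil w (\<lambda>b. 1 * u b + 1 * v b) (\<lambda>b. 1 * u b + 1 * v b) =
        bil w u u + 2 * bil w u v + bil w v v" by simp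
  qed
  then have "(\<Sum>w\<in>W. bil w u v) = 0"
    using sum_bil_zero(2)[OF s] sum_bil_zero(2)[OF u] sum_bil_zero(2)[OF v] by simp
  then show ?thesis
    using sum_bil_zero(1)[OF v] by (simp add: bil_add sum.distrib)
qed

text \<open>For two solutions \<open>x\<close> and \<open>y\<close>, reverse Cauchy-Schwarz gives
  \<open>bil w x y >= A w\<close> for each \<open>w\<close>, while \<open>sum_bil_polar\<close>
  gives equality of the sums. So equality holds for each \<open>w\<close>, and the difference
  \<open>d\<close> is null and orthogonal to \<open>x\<close> for every form; \<open>lorentz\<close>
  moves this to \<open>x0\<close> and \<open>rigid\<close> ends the proof.\<close>

lemma solution_unique:
  assumes u: "supp u" "\<And>w. w \<in> W \<Longrightarrow> bil w (\<lambda>b. x0 b + u b) (\<lambda>b. x0 b + u b) = A w"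
      "\<And>w. w \<in> W \<Longrightarrow> bil w x0 (\<lambda>b. x0 b + u b) > 0"
    and v: "supp v" "\<And>w. w \<in> W \<Longrightarrow> bil w (\<lambda>b. x0 b + v b) (\<lambda>b. x0 b + v b) = A w"
      "\<And>w. w \<in> W \<Longrightarrow> bil w x0 (\<lambda>b. x0 b + v b) > 0"
    and A: "\<And>w. w \<in> W \<Longrightarrow> A w > 0"
  shows "u = v"
proof -
  define x where "x = (\<lambda>b. x0 b + u b)"
  define y where "y = (\<lambda>b. x0 b + v b)"
  define d where "d = (\<lambda>b. 1 * v b + (-1) * u b)"
  have d: "supp d" using u(1) v(1) by (simp add: supp_def d_def)
  have yx: "y = (\<lambda>b. 1 * x b + 1 * d b)" by (rule ext) (simp add: x_def y_def d_def)
  have xx: "bil w x x = A w" if "w \<in> W" for w using u(2)[OF that] unfolding x_def .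
  have yy: "bil w y y = A w" if "w \<in> W" for w using v(2)[OF that] unfolding y_def .
  have ge: "bil w x y \<ge> A w" if "w \<in> W" for w
  proof -
    have "(A w)\<^sup>2 \<le> (bil w x y)\<^sup>2" "bil w x y > 0"
      using reverse_Cauchy_Schwarz[of w x y] that u(3)[OF that] v(3)[OF that] A[OF that]
      unfolding xx[OF that] yy[OF that] x_def[symmetric] y_def[symmetric]
      by (simp_all add: power2_eq_square)
    then show ?thesis using power2_le_imp_le less_imp_le by blast
  qed
  have xy: "bil w x y = A w + bil w x d" if "w \<in> W" for w
    unfolding yx bil_lin_right[OF that] xx[OF that] by simp
  have "(\<Sum>w\<in>W. bil w x y) = (\<Sum>w\<in>W. A w + bil w x d)"
    by (rule sum.cong[OF refl xy])
  also have "\<dots> = (\<Sum>w\<in>W. A w)"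
    using sum_bil_polar[OF u(1) d] by (simp add: sum.distrib x_def)
  finally have "\<forall>w\<in>W. bil w x y - A w = 0"
    using ge by (subst sum_nonneg_eq_0_iff[OF finW, symmetric]) (auto simp: sum_subtractf)
  then have eq: "bil w x y = A w" if "w \<in> W" for w using that by simp
  have xd: "bil w x d = 0" if "w \<in> W" for w
    using eq[OF that] xy[OF that] by simp
  have dd: "bil w d d = 0" if "w \<in> W" for w
    using bil_quad[OF that, of 1 x 1 d] xd[OF that] xx[OF that] yy[OF that]
    unfolding yx[symmetric] by simp
  have "bil w x0 d = 0 \<and> bil w d d = 0" if "w \<in> W" for w
    using lorentz(2)[OF that _ xd[OF that] dd[OF that]] dd[OF that] xx[OF that] A[OF that]
    by simp
  then have "d = (\<lambda>b. 0)" using rigid[of d] d by (auto simp: supp_def)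
  then show ?thesis by (auto simp: d_def fun_eq_iff)
qed

section \<open>Existence by compactness\<close>

lemma continuous_on_bil_shift:
  assumes w: "w \<in> W"
  shows "continuous_on S (\<lambda>u. bil w (\<lambda>b. x0 b + u b) (\<lambda>b. x0 b + u b))"
proof -
  have "continuous_on S (\<lambda>u. \<lambda>b. x0 b + u b)"
  proof (rule continuous_on_coordinatewise_then_product)
    fix b
    show "continuous_on S (\<lambda>u. x0 b + u b)"
      using continuous_on_add[of S "\<lambda>u. x0 b" "\<lambda>u. u b"] continuous_on_eval[of S b] by simp
  qed
  then show ?thesis by (rule continuous_on_compose2[OF bil_cont[OF w] _ subset_UNIV])
qed

text \<open>Continuity is assumed on the diagonal only; polarization carries it to the linear
  functional.\<close>

lemma continuous_on_bil_x0:
  assumes w: "w \<in> W"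
  shows "continuous_on S (\<lambda>u. bil w x0 u)"
proof -
  have eq: "bil w x0 u = (bil w (\<lambda>b. x0 b + u b) (\<lambda>b. x0 b + u b) - bil w x0 x0 - bil w u u) / 2" (is "_ = ?f u") for u
    using bil_quad[OF w, of 1 x0 1 u] by simp
  have c: "continuous_on S
     (\<lambda>u. (bil w (\<lambda>b. x0 b + u b) (\<lambda>b. x0 b + u b) - bil w x0 x0 - bil w u u) / 2)"
    by (rule continuous_on_divide[OF continuous_on_diff[OF continuous_on_diff[OF
          continuous_on_bil_shift[OF w] continuous_on_const]
          continuous_on_subset[OF bil_cont[OF w] subset_UNIV]] continuous_on_const]) simp
  have "bil w x0 = ?f" by (rule ext) (rule eq)
  then show ?thesis by (rule ssubst[where P = "continuous_on S"]) (rule c)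
qed

text \<open>On directions with \<open>\<Sum> bil w u u = 0\<close> the Lorentzian forms add up to a positive definite
  form in terms of the numbers \<open>bil w x0 u\<close>, which bounds the admissible set.\<close>

lemma admissible_bounded:
  "\<exists>M. \<forall>u. supp u \<longrightarrow> (\<forall>w\<in>W. bil w x0 (\<lambda>b. x0 b + u b) \<ge> 0) \<longrightarrow> (\<forall>b. \<bar>u b\<bar> \<le> M)"
proof (cases "B = {}")
  case True
  then show ?thesis unfolding supp_def by (intro exI[of _ 0]) simp
next
  case False
  \<comment> \<open>With \<open>p = bil w x0 u\<close> and \<open>q = bil w x0 x0\<close>, the
    Lorentz property says \<open>bil w u u <= p^2 / q\<close>. The factor 2 leaves a further
    \<open>p^2 / q\<close> to spare, so a zero of \<Psi> has both \<open>p\<close> and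
    \<open>bil w u u\<close> equal to 0 for all \<open>w\<close>, which is the situation of
    \<open>rigid\<close>.\<close>
  define \<Psi> where "\<Psi> u = (\<Sum>w\<in>W. 2 * (bil w x0 u)\<^sup>2 / bil w x0 x0 - bil w u u)" for u
  \<comment> \<open>The unit sphere of the maximum norm on displacements supported in
    \<open>B\<close>.\<close>
  define S where "S = {u :: 'b \<Rightarrow> real. (\<forall>b. u b \<in> (if b \<in> B then {-1..1} else {0}))} \<inter>
    (\<Union>b\<in>B. {u. \<bar>u b\<bar> = 1})"
  have compS: "compact S"
    unfolding S_def
    by (intro compact_Int_closed compact_box_fun closed_UN finB ballI
      closed_Collect_eq[OF continuous_on_rabs[OF continuous_on_eval] continuous_on_const])
  have term_ge: "2 * (bil w x0 u)\<^sup>2 / bil w x0 x0 - bil w u u \<ge> (bil w x0 u)\<^sup>2 / bil w x0 x0" if w: "w \<in> W" for w u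
  proof -
    let ?q = "bil w x0 x0" and ?p = "bil w x0 u"
    have "bil w x0 (\<lambda>b. 1 * u b + (- ?p / ?q) * x0 b) = 0"
      unfolding bil_lin_right[OF w] using pos0[OF w] by simp
    from lorentz0[OF w this] have "bil w u u \<le> ?p\<^sup>2 / ?q"
      unfolding bil_quad[OF w] using bil_sym[OF w, of u x0] pos0[OF w]
      by (simp add: power2_eq_square)
    then show ?thesis by (simp add: field_simps)
  qed
  have pos: "\<Psi> u > 0" if u: "supp u" "u \<noteq> (\<lambda>b. 0)" for u
  proof (rule ccontr)
    assume "\<not> \<Psi> u > 0"
    have nn: "0 \<le> 2 * (bil w x0 u)\<^sup>2 / bil w x0 x0 - bil w u u" if "w \<in> W" for w
      by (rule order_trans[OF _ term_ge[OF that]]) (use pos0[OF that] in simp)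
    then have "\<Psi> u = 0" using \<open>\<not> \<Psi> u > 0\<close> unfolding \<Psi>_def by (meson linorder_not_less order_antisym sum_nonneg)
    then have z: "2 * (bil w x0 u)\<^sup>2 / bil w x0 x0 - bil w u u = 0" if "w \<in> W" for w
      using nn that unfolding \<Psi>_def by (subst (asm) sum_nonneg_eq_0_iff[OF finW]) auto
    have "bil w x0 u = 0 \<and> bil w u u = 0" if "w \<in> W" for w
    proof -
      have "(bil w x0 u)\<^sup>2 / bil w x0 x0 \<le> 0" using term_ge[OF that, of u] z[OF that] by simp
      then have "bil w x0 u = 0" using pos0[OF that] by (simp add: divide_le_0_iff)
      then show ?thesis using z[OF that] by simp
    qed
    then show False using rigid[of u] u by (auto simp: supp_def)
  qed
  have hom: "\<Psi> (\<lambda>b. r * u b) = r\<^sup>2 * \<Psi> u" for r u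
  proof -
    have "bil w x0 (\<lambda>b. r * u b) = r * bil w x0 u" "bil w (\<lambda>b. r * u b) (\<lambda>b. r * u b) = r\<^sup>2 * bil w u u"
      if "w \<in> W" for w
      using bil_lin_right[OF that, of x0 r u 0 u] bil_quad[OF that, of r u 0 u] by simp_all
    then show ?thesis
      unfolding \<Psi>_def sum_distrib_left by (intro sum.cong) (auto simp: algebra_simps power_mult_distrib)
  qed
  have contPsi: "continuous_on S \<Psi>"
    unfolding \<Psi>_def[abs_def]
    by (intro continuous_on_sum continuous_on_diff continuous_on_divide continuous_on_mult
          continuous_on_power continuous_on_const continuous_on_bil_x0
          continuous_on_subset[OF bil_cont subset_UNIV] ballI) (use pos0 less_irrefl in metis)+
  have Sne: "S \<noteq> {}"
  proof -
    obtain b0 where "b0 \<in> B" using False by blast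
    then have "(\<lambda>b. if b = b0 then 1 else 0) \<in> S" by (auto simp: S_def)
    then show ?thesis by blast
  qed
  obtain u0 where u0: "u0 \<in> S" "\<And>u. u \<in> S \<Longrightarrow> \<Psi> u0 \<le> \<Psi> u"
    using continuous_attains_inf[OF compS Sne contPsi] by auto
  define m where "m = \<Psi> u0"
  have "supp u0" "u0 \<noteq> (\<lambda>b. 0)" using u0(1) by (auto simp: S_def supp_def split: if_splits)
  then have m: "m > 0" using pos by (simp add: m_def)
  \<comment> \<open>\<open>Q\<close> will bound every \<open>bil w x0 u\<close>, so \<open>C\<close>
    bounds \<Psi> at admissible displacements, where the terms \<open>bil w u u\<close> add up to 0.
    Homogeneity gives \<open>m * R^2 <= C\<close> for the maximum norm \<open>R\<close>, hence the
    choice of \<open>M\<close>.\<close>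
  define Q where "Q = (\<Sum>w\<in>W. bil w x0 x0)"
  define C where "C = (\<Sum>w\<in>W. 2 * Q\<^sup>2 / bil w x0 x0)"
  define M where "M = sqrt (C / m)"
  have "\<bar>u b\<bar> \<le> M" if u: "supp u" and adm: "\<forall>w\<in>W. bil w x0 (\<lambda>b. x0 b + u b) \<ge> 0" for u b
  proof -
    define R where "R = Max ((\<lambda>b. \<bar>u b\<bar>) ` B)"
    have le: "\<bar>u b\<bar> \<le> R" if "b \<in> B" for b using that finB by (simp add: R_def)
    have "R \<in> (\<lambda>b. \<bar>u b\<bar>) ` B" unfolding R_def using finB False by (intro Max_in) auto
    then obtain c where c: "c \<in> B" "R = \<bar>u c\<bar>" by auto
    have ub: "\<bar>u b\<bar> \<le> R" using le[of b] u c by (cases "b \<in> B") (auto simp: supp_def)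
    have lo: "bil w x0 u \<ge> - bil w x0 x0" if "w \<in> W" for w
      using adm that by (force simp: bil_add_right)
    \<comment> \<open>Terms that are bounded below and sum to zero are bounded above as
      well.\<close>
    have "\<bar>bil w x0 u\<bar> \<le> Q" if w: "w \<in> W" for w
    proof -
      have "bil w x0 u = - (\<Sum>k\<in>W-{w}. bil k x0 u)"
        using sum_bil_zero(1)[OF u] sum.remove[OF finW w, of "\<lambda>k. bil k x0 u"] by simp
      also have "\<dots> \<le> (\<Sum>k\<in>W-{w}. bil k x0 x0)"
        unfolding sum_negf[symmetric] by (intro sum_mono) (use lo in force)
      also have "\<dots> \<le> Q" unfolding Q_def by (rule sum_mono2) (use finW pos0 in \<open>auto intro: less_imp_le\<close>)
      finally have 1: "bil w x0 u \<le> Q" .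
      have "bil w x0 x0 \<le> Q" unfolding Q_def
        by (rule member_le_sum[OF w _ finW]) (use pos0 in \<open>auto intro: less_imp_le\<close>)
      then show ?thesis using 1 lo[OF w] by linarith
    qed
    then have "(bil w x0 u)\<^sup>2 \<le> Q\<^sup>2" if "w \<in> W" for w
      using that by (metis abs_le_square_iff abs_ge_self order_trans)
    then have "(\<Sum>w\<in>W. 2 * (bil w x0 u)\<^sup>2 / bil w x0 x0) \<le> C"
      unfolding C_def by (intro sum_mono divide_right_mono) (use pos0 in \<open>auto intro: less_imp_le\<close>)
    then have PsiC: "\<Psi> u \<le> C" unfolding \<Psi>_def sum_subtractf using sum_bil_zero(2)[OF u] by simp
    have "m * R\<^sup>2 \<le> C"
    proof (cases "R = 0")
      case True
      then show ?thesis unfolding C_def using pos0 by (auto intro!: sum_nonneg divide_nonneg_nonneg intro: less_imp_le)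
    next
      case R0: False
      then have R: "R > 0" using c by auto
      have "(\<lambda>b. (1/R) * u b) \<in> S"
        unfolding S_def using le u c R by (auto simp: supp_def field_simps abs_le_iff minus_le_iff)
      from u0(2)[OF this] have "m \<le> (1/R)\<^sup>2 * \<Psi> u" unfolding m_def hom .
      then have "m * R\<^sup>2 \<le> \<Psi> u" using R by (simp add: field_simps)
      then show ?thesis using PsiC by linarith
    qed
    then have "R\<^sup>2 \<le> C / m" using m by (simp add: field_simps)
    then have "R \<le> M" unfolding M_def by (rule real_le_rsqrt)
    then show ?thesis using ub by linarith
  qed
  then show ?thesis by blast
qed

text \<open>By the dimension count, two different multipliers would allow a direction along which no area changes to first order.\<close>

lemma critical_multipliers_const:
  assumes x: "supp u" "\<And>w. w \<in> W \<Longrightarrow> bil w (\<lambda>b. x0 b + u b) (\<lambda>b. x0 b + u b) > 0"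
    and crit: "\<And>v. supp v \<Longrightarrow> (\<Sum>w\<in>W. h w * bil w (\<lambda>b. x0 b + u b) v) = 0"
    and w: "w1 \<in> W" "w2 \<in> W"
  shows "h w1 = (h w2 :: real)"
proof (rule ccontr)
  assume ne: "h w1 \<noteq> h w2"
  then have w12: "w1 \<noteq> w2" by auto
  define x where "x = (\<lambda>b. x0 b + u b)"
  let ?I = "W - {w1, w2}"
  define \<delta> where "\<delta> c = (\<lambda>b :: 'b. if b = c then 1 else (0::real))" for c
  have "card ?I = card W - 2" using w w12 finW by (simp add: card_Diff_subset)
  moreover have "card W \<ge> 2" using card_mono[OF finW, of "{w1,w2}"] w w12 by simp
  \<comment> \<open>Leaving out two tiles is what makes the unknowns, at least
    \<open>card W - 1\<close> of them, outnumber the equations.\<close>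
  ultimately have "card ?I < card B" using card_le by linarith
  then obtain v where v: "v \<noteq> (\<lambda>b. 0)" "\<forall>b. b \<notin> B \<longrightarrow> v b = 0"
      "\<forall>w\<in>?I. (\<Sum>b\<in>B. bil w x (\<delta> b) * v b) = 0"
    using homogeneous_system_nontrivial[of ?I B "\<lambda>w b. bil w x (\<delta> b)"] finW finB by auto
  have expand: "bil w x (\<lambda>b. \<Sum>c\<in>F. v c * \<delta> c b) = (\<Sum>c\<in>F. bil w x (\<delta> c) * v c)"
    if "finite F" "w \<in> W" for F w
    using that
  proof (induction F rule: finite_induct)
    case empty
    then show ?case using bil_zero[of w x] bil_sym[of w] by simp
  next
    case (insert c F)
    then show ?case using bil_lin_right[of w x "v c" "\<delta> c" 1 "\<lambda>b. \<Sum>c\<in>F. v c * \<delta> c b"] by simp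
  qed
  have "(\<lambda>b. \<Sum>c\<in>B. v c * \<delta> c b) = v"
    using v(2) finB by (auto simp: \<delta>_def fun_eq_iff if_distrib cong: if_cong)
  then have ex: "bil w x v = (\<Sum>c\<in>B. bil w x (\<delta> c) * v c)" if "w \<in> W" for w
    using expand[OF finB that] by simp
  have I0: "bil w x v = 0" if "w \<in> ?I" for w
    using ex v(3) that by auto
  have sv: "supp v" using v(2) by (simp add: supp_def)
  have two: "(\<Sum>w\<in>W. k w * bil w x v) = k w1 * bil w1 x v + k w2 * bil w2 x v" for k
  proof -
    have "(\<Sum>w\<in>W. k w * bil w x v) = (\<Sum>w\<in>{w1,w2}. k w * bil w x v)"
      by (rule sum.mono_neutral_right[OF finW]) (use w I0 in auto)
    then show ?thesis using w12 by simp
  qed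
  \<comment> \<open>Only two areas can still change to first order. Constancy of the total makes
    their rates opposite, and criticality with different multipliers then makes both zero.\<close>
  have a: "h w1 * bil w1 x v + h w2 * bil w2 x v = 0"
    using crit[OF sv] two[of h] by (simp add: x_def)
  have b: "bil w1 x v + bil w2 x v = 0"
    using sum_bil_polar[OF x(1) sv] two[of "\<lambda>_. 1"] by (simp add: x_def)
  then have "bil w2 x v = - bil w1 x v" by simp
  then have "(h w1 - h w2) * bil w1 x v = 0" using a by (simp add: algebra_simps)
  then have "bil w1 x v = 0" using ne by simp
  then have all0: "bil w x v = 0" if "w \<in> W" for w using b I0 that by (cases "w \<in> ?I") auto
  have le: "bil w v v \<le> 0" if "w \<in> W" for w
    using lorentz(1)[OF that _ all0[OF that]] x(2)[OF that] by (simp add: x_def)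
  then have "\<forall>w\<in>W. - bil w v v = 0"
    using sum_bil_zero(2)[OF sv] by (subst sum_nonneg_eq_0_iff[OF finW, symmetric]) (auto simp: sum_negf)
  then have "bil w x0 v = 0 \<and> bil w v v = 0" if "w \<in> W" for w
    using lorentz(2)[OF that _ all0[OF that]] x(2)[OF that] that by (simp add: x_def)
  then show False using rigid[of v] v by auto
qed

text \<open>The critical equation of \<open>ln G\<close> has the multipliers
  \<open>A w / q w u\<close>. By \<open>critical_multipliers_const\<close> they share one value
  \<open>c\<close>, so the areas are proportional to the targets, and equality of the totals makes
  \<open>c = 1\<close>.\<close>

lemma solution_exists:
  assumes A: "\<And>w. w \<in> W \<Longrightarrow> A w > 0" and sumA: "(\<Sum>w\<in>W. A w) = (\<Sum>w\<in>W. bil w x0 x0)"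
  shows "\<exists>u. supp u \<and> (\<forall>w\<in>W. bil w (\<lambda>b. x0 b + u b) (\<lambda>b. x0 b + u b) = A w \<and>
     bil w x0 (\<lambda>b. x0 b + u b) > 0)"
proof -
  define q where "q w u = bil w (\<lambda>b. x0 b + u b) (\<lambda>b. x0 b + u b)" for w u
  define l where "l w u = bil w x0 (\<lambda>b. x0 b + u b)" for w u
  obtain M where M: "\<And>u b. supp u \<Longrightarrow> \<forall>w\<in>W. l w u \<ge> 0 \<Longrightarrow> \<bar>u b\<bar> \<le> M"
    using admissible_bounded unfolding l_def by blast
  have l_eq: "l w u = bil w x0 x0 + bil w x0 u" if "w \<in> W" for w u
    using that by (simp add: l_def bil_add_right)
  have cq: "continuous_on S (q w)" if "w \<in> W" for w S
    unfolding q_def[abs_def] by (rule continuous_on_bil_shift[OF that])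
  have cl: "continuous_on S (l w)" if "w \<in> W" for w S
  proof -
    have "continuous_on S (\<lambda>u. bil w x0 x0 + bil w x0 u)"
      by (rule continuous_on_add[OF continuous_on_const continuous_on_bil_x0[OF that]])
    then show ?thesis using l_eq[OF that] by (simp cong: continuous_on_cong)
  qed
  \<comment> \<open>The box supplies compactness; by the choice of \<open>M\<close> it cuts off no
    admissible displacement, as \<open>K_iff\<close> records.\<close>
  define K where "K = {u :: 'b \<Rightarrow> real. \<forall>b. u b \<in> (if b \<in> B then {-M..M} else {0})} \<inter>
    (\<Inter>w\<in>W. {u. 0 \<le> q w u} \<inter> {u. 0 \<le> l w u})"
  have K_iff: "u \<in> K \<longleftrightarrow> supp u \<and> (\<forall>w\<in>W. 0 \<le> q w u \<and> 0 \<le> l w u)" for u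
    using M[of u] by (auto simp: K_def supp_def abs_le_iff minus_le_iff split: if_splits)
  have compK: "compact K" unfolding K_def
    by (intro compact_Int_closed compact_box_fun closed_INT closed_Int ballI
      closed_Collect_le[OF continuous_on_const cq] closed_Collect_le[OF continuous_on_const cl])
  have q0: "q w (\<lambda>b. 0) = bil w x0 x0" "l w (\<lambda>b. 0) = bil w x0 x0" for w
    by (simp_all add: q_def l_def)
  have zK: "(\<lambda>b. 0) \<in> K" unfolding K_iff using pos0 q0 by (auto simp: supp_def intro: less_imp_le)
  define G where "G u = (\<Prod>w\<in>W. q w u powr A w)" for u
  have contG: "continuous_on K G"
    unfolding G_def[abs_def]
    by (intro continuous_on_prod continuous_on_powr' cq continuous_on_const)
       (use A K_iff in auto)
  obtain u where u: "u \<in> K" "\<And>v. v \<in> K \<Longrightarrow> G v \<le> G u"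
    using continuous_attains_sup[OF compK _ contG] zK by blast
  have "0 < G (\<lambda>b. 0)" unfolding G_def by (rule prod_pos) (use q0 pos0 in force)
  then have "0 < G u" using u(2)[OF zK] by linarith
  then have qne: "q w u \<noteq> 0" if "w \<in> W" for w
    using that finW unfolding G_def by (metis powr_0 prod_zero_iff less_irrefl powr_eq_0_iff)
  then have qpos: "q w u > 0" if "w \<in> W" for w
    using u(1) K_iff that by (metis order_le_less)
  have su: "supp u" using u(1) K_iff by blast
  \<comment> \<open>By \<open>lorentz0\<close> the functional cannot vanish where the form is
    positive. With both inequalities strict, small perturbations of \<open>u\<close> stay in
    \<open>K\<close>, so the maximum is a critical point.\<close>
  have lpos: "l w u > 0" if "w \<in> W" for w
    using u(1) K_iff[of u] that qpos[OF that] lorentz0[OF that, of "\<lambda>b. x0 b + u b"]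
    unfolding q_def l_def by (metis linorder_not_less order_le_less)
  define x where "x = (\<lambda>b. x0 b + u b)"
  have crit: "(\<Sum>w\<in>W. (A w / q w u) * bil w x v) = 0" if v: "supp v" for v
  proof -
    define p where "p t = (\<lambda>b. u b + t * v b)" for t
    have qp: "q w (p t) = q w u + 2 * t * bil w x v + t\<^sup>2 * bil w v v" if "w \<in> W" for w t
      using bil_quad[OF that, of 1 x t v] by (simp add: q_def p_def x_def add.assoc)
    have lp: "l w (p t) = l w u + t * bil w x0 v" if "w \<in> W" for w t
      using bil_lin_right[OF that, of x0 1 u t v] by (simp add: l_eq[OF that] p_def)
    have sp: "supp (p t)" for t using su v by (simp add: supp_def p_def)
    have "\<forall>\<^sub>F t in at 0. q w (p t) > 0 \<and> l w (p t) > 0" if w: "w \<in> W" for w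
    proof -
      have "((\<lambda>t. q w (p t)) \<longlongrightarrow> q w u + 2 * 0 * bil w x v + 0\<^sup>2 * bil w v v) (at 0)"
        unfolding qp[OF w] by (intro tendsto_intros)
      then have 1: "\<forall>\<^sub>F t in at 0. q w (p t) > 0"
        using qpos[OF w] by (intro order_tendstoD(1)) auto
      have "((\<lambda>t. l w (p t)) \<longlongrightarrow> l w u + 0 * bil w x0 v) (at 0)"
        unfolding lp[OF w] by (intro tendsto_intros)
      then have 2: "\<forall>\<^sub>F t in at 0. l w (p t) > 0"
        using lpos[OF w] by (intro order_tendstoD(1)) auto
      show ?thesis using 1 2 by eventually_elim auto
    qed
    then have "\<forall>\<^sub>F t in at 0. \<forall>w\<in>W. q w (p t) > 0 \<and> l w (p t) > 0"
      using finW by (simp add: eventually_ball_finite)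
    then obtain e where e: "e > 0" "\<And>t w. t \<noteq> 0 \<Longrightarrow> \<bar>t\<bar> < e \<Longrightarrow> w \<in> W \<Longrightarrow> q w (p t) > 0 \<and> l w (p t) > 0"
      unfolding eventually_at by (auto simp: dist_real_def)
    have e': "q w (p t) > 0 \<and> l w (p t) > 0" if "\<bar>t\<bar> < e" "w \<in> W" for t w
      using e(2)[of t w] that qp[of w 0] lp[of w 0] qpos[of w] lpos[of w] by (cases "t = 0") auto
    define H where "H t = (\<Sum>w\<in>W. A w * ln (q w (p t)))" for t
    have lnG: "H t = ln (G (p t))" if "\<bar>t\<bar> < e" for t
    proof -
      have "ln (G (p t)) = (\<Sum>w\<in>W. ln (q w (p t) powr A w))"
        unfolding G_def by (rule ln_prod) (use e'[OF that] finW in force)+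
      also have "\<dots> = H t" unfolding H_def
        by (intro sum.cong refl ln_powr)
      finally show ?thesis by simp
    qed
    have "G (p t) \<le> G (p 0)" if "\<bar>t\<bar> < e" for t
    proof -
      have "p t \<in> K" unfolding K_iff using sp e'[OF that] by (auto intro: less_imp_le)
      then show ?thesis using u(2) by (simp add: p_def)
    qed
    moreover have "G (p t) > 0" if "\<bar>t\<bar> < e" for t
      unfolding G_def by (rule prod_pos) (use e'[OF that] in force)
    ultimately have Hle: "H t \<le> H 0" if "\<bar>t - 0\<bar> < e" for t
      using that e(1) by (simp add: lnG)
    have der: "DERIV H 0 :> (\<Sum>w\<in>W. A w * (2 * bil w x v / q w u))"
    proof -
      have "DERIV (\<lambda>t. A w * ln (q w (p t))) 0 :> A w * (2 * bil w x v / q w u)" if w: "w \<in> W" for w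
        unfolding qp[OF w] using qpos[OF w]
        by (auto intro!: derivative_eq_intros simp: field_simps)
      then show ?thesis unfolding H_def[abs_def] by (intro DERIV_sum) auto
    qed
    have "(\<Sum>w\<in>W. A w * (2 * bil w x v / q w u)) = 0"
      by (rule DERIV_local_max[OF der e(1)]) (use Hle in \<open>auto simp: abs_minus_commute\<close>)
    then have "2 * (\<Sum>w\<in>W. (A w / q w u) * bil w x v) = 0"
      by (simp add: sum_distrib_left algebra_simps)
    then show ?thesis by simp
  qed
  have const: "A w / q w u = A w' / q w' u" if "w \<in> W" "w' \<in> W" for w w'
    by (rule critical_multipliers_const[OF su _ _ that, of "\<lambda>w. A w / q w u"])
       (use qpos crit in \<open>auto simp: q_def x_def\<close>)
  have sumq: "(\<Sum>w\<in>W. q w u) = (\<Sum>w\<in>W. A w)"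
    unfolding q_def sumA by (rule total) (use su in \<open>auto simp: supp_def\<close>)
  have "q w u = A w" if w: "w \<in> W" for w
  proof -
    define c where "c = A w / q w u"
    have "A k = c * q k u" if "k \<in> W" for k
      using const[OF that w] qpos[OF that] by (simp add: c_def field_simps)
    then have "(\<Sum>k\<in>W. A k) = c * (\<Sum>k\<in>W. q k u)" by (simp add: sum_distrib_left)
    moreover have "(\<Sum>k\<in>W. A k) > 0" using A w finW by (intro sum_pos) auto
    ultimately have "c = 1" using sumq by simp
    then show ?thesis using qpos[OF w] by (simp add: c_def field_simps)
  qed
  then show ?thesis using su lpos unfolding q_def l_def by blast
qed

end

section \<open>Convex polygons\<close>

lemma point_eq_iff: "(u :: point) = v \<longleftrightarrow> u $ 1 = v $ 1 \<and> u $ 2 = v $ 2"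
  by (simp add: vec_eq_iff forall_2)

lemma cross2_add_left: "cross2 (u + v) x = cross2 u x + cross2 v x"
  and cross2_add_right: "cross2 x (u + v) = cross2 x u + cross2 x v"
  and cross2_diff_left: "cross2 (u - v) x = cross2 u x - cross2 v x"
  and cross2_diff_right: "cross2 x (u - v) = cross2 x u - cross2 x v"
  and cross2_scaleR_left: "cross2 (r *\<^sub>R u) x = r * cross2 u x"
  and cross2_scaleR_right: "cross2 x (r *\<^sub>R u) = r * cross2 x u"
  and cross2_minus_left: "cross2 (- u) x = - cross2 u x"
  and cross2_minus_right: "cross2 x (- u) = - cross2 x u"
  and cross2_self: "cross2 u u = 0"
  and cross2_0_left: "cross2 0 x = 0"
  and cross2_0_right: "cross2 x 0 = 0"
  by (simp_all add: cross2_def algebra_simps)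

lemmas cross2_linear = cross2_add_left cross2_add_right cross2_diff_left cross2_diff_right
  cross2_scaleR_left cross2_scaleR_right cross2_minus_left cross2_minus_right cross2_self
  cross2_0_left cross2_0_right

lemma cross2_swap: "cross2 u v = - cross2 v u"
  by (simp add: cross2_def)

text \<open>Cramer's rule with the determinant cleared, hence also true for parallel
  \<open>d\<close> and \<open>e\<close>.\<close>

lemma cross2_expand: "cross2 d e *\<^sub>R x = cross2 x e *\<^sub>R d + cross2 d x *\<^sub>R e"
  by (simp add: point_eq_iff cross2_def algebra_simps)

lemma cross2_parallel:
  assumes "u \<noteq> 0" "cross2 u v = 0"
  obtains k where "v = k *\<^sub>R u"
proof (cases "u $ 1 = 0")
  case True
  then have "u $ 2 \<noteq> 0" using assms by (simp add: point_eq_iff)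
  then have "v = (v $ 2 / u $ 2) *\<^sub>R u" using assms True by (auto simp: point_eq_iff cross2_def)
  then show ?thesis by (rule that)
next
  case False
  then have "v = (v $ 1 / u $ 1) *\<^sub>R u" using assms by (auto simp: point_eq_iff cross2_def field_simps)
  then show ?thesis by (rule that)
qed

text \<open>The quarter turn rewrites cross products as inner products, the form in which
  half-planes and supporting hyperplanes are treated, and turns normals of lines into their
  directions.\<close>

definition perp :: "point \<Rightarrow> point" where "perp u = vector [- (u $ 2), u $ 1]"

lemma inner_perp: "perp u \<bullet> v = cross2 u v"
  by (simp add: perp_def inner_vec_def sum_2 cross2_def)

lemma cross2_perp_pos:
  assumes "e \<noteq> 0" shows "cross2 e (perp e) > 0"
proof -
  have "cross2 e (perp e) = (e $ 1)\<^sup>2 + (e $ 2)\<^sup>2"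
    by (simp add: perp_def cross2_def power2_eq_square)
  moreover have "e $ 1 \<noteq> 0 \<or> e $ 2 \<noteq> 0" using assms by (auto simp: point_eq_iff)
  ultimately show ?thesis by (metis add_nonneg_pos add_pos_nonneg zero_le_power2 zero_less_power2)
qed

lemma cross2_perp_left: "cross2 (perp n) d = - (n \<bullet> d)"
  by (simp add: cross2_def perp_def inner_vec_def sum_2)

lemma cross2_perp_perp: "cross2 (perp u) (perp v) = cross2 u v"
  by (simp add: cross2_def perp_def)

lemma cross2_segment:
  assumes "z \<in> closed_segment p q" shows "cross2 (q - p) (z - p) = 0"
proof -
  obtain u where "z = (1 - u) *\<^sub>R p + u *\<^sub>R q" using assms by (auto simp: in_segment)
  then have "z - p = u *\<^sub>R (q - p)" by (simp add: algebra_simps)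
  then show ?thesis by (simp add: cross2_linear)
qed

section \<open>Vertices and sides of a convex polygon\<close>

definition verts :: "point set \<Rightarrow> point set" where "verts t = {v. v extreme_point_of t}"

lemma aff_dim_closed_segment: "aff_dim (closed_segment p q) = (if p = q then 0 else 1)"
  by (simp add: segment_convex_hull aff_dim_convex_hull aff_dim_2)

locale polygon =
  fixes t :: "point set"
  assumes convex_polygon: "convex_polygon t"
begin

lemma polytope: "polytope t" and interior_nonempty: "interior t \<noteq> {}"
  using convex_polygon by (auto simp: convex_polygon_def)

lemma convex: "convex t" and compact: "compact t" and closed: "closed t"
  using polytope by (auto intro: polytope_imp_convex polytope_imp_compact polytope_imp_closed)

lemma aff_dim: "aff_dim t = 2"
  using aff_dim_nonempty_interior[OF interior_nonempty] by simp

lemma closure_interior: "closure (interior t) = t"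
  using convex_closure_interior[OF convex interior_nonempty] closed by simp

lemma finite_verts: "finite (verts t)"
proof -
  obtain V where "finite V" "t = convex hull V" using polytope by (auto simp: polytope_def)
  then show ?thesis
    unfolding verts_def using extreme_points_of_convex_hull[of V] finite_subset by metis
qed

lemma hull_verts: "convex hull (verts t) = t"
  using Krein_Milman_Minkowski[OF compact convex] by (simp add: verts_def)

lemma verts_subset: "verts t \<subseteq> t" by (auto simp: verts_def extreme_point_of_def)

lemma side_face: "(p, q) \<in> ccw_sides t \<Longrightarrow> closed_segment p q face_of t"
  by (simp add: ccw_sides_def edge_of_def)

lemma side_neq: "(p, q) \<in> ccw_sides t \<Longrightarrow> p \<noteq> q"
  by (auto simp: ccw_sides_def edge_of_def aff_dim_closed_segment)

lemma side_verts:
  assumes "(p, q) \<in> ccw_sides t" shows "p \<in> verts t" "q \<in> verts t"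
  using extreme_point_of_face[OF side_face[OF assms]] by (auto simp: verts_def extreme_point_of_segment)

lemma side_ge: "(p, q) \<in> ccw_sides t \<Longrightarrow> x \<in> t \<Longrightarrow> 0 \<le> cross2 (q - p) (x - p)"
  by (simp add: ccw_sides_def)

lemma side_subset: "(p, q) \<in> ccw_sides t \<Longrightarrow> closed_segment p q \<subseteq> t"
  by (rule face_of_imp_subset[OF side_face])

lemma side_line:
  assumes s: "(p, q) \<in> ccw_sides t" and x: "x \<in> t" "cross2 (q - p) (x - p) = 0"
  shows "x \<in> closed_segment p q"
proof -
  obtain k where "x - p = k *\<^sub>R (q - p)"
    using cross2_parallel[OF _ x(2)] side_neq[OF s] by auto
  then have "x = p + k *\<^sub>R (q - p)" by (simp add: algebra_simps)
  then have "x \<in> affine hull {p, q}" unfolding affine_hull_2_alt by auto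
  then have "x \<in> affine hull (closed_segment p q)" by (simp add: segment_convex_hull affine_hull_convex_hull)
  then show ?thesis using face_of_imp_eq_affine_Int[OF convex side_face[OF s]] x by auto
qed

lemma side_vertex:
  assumes s: "(p, q) \<in> ccw_sides t" and x: "x \<in> verts t" "cross2 (q - p) (x - p) = 0"
  shows "x = p \<or> x = q"
proof -
  have "x \<in> closed_segment p q" using side_line[OF s] x verts_subset by blast
  then show ?thesis
    using extreme_point_of_face[OF side_face[OF s], of x] x(1)
    by (auto simp: verts_def extreme_point_of_segment)
qed

lemma side_interior:
  assumes s: "(p, q) \<in> ccw_sides t" and x: "x \<in> interior t"
  shows "0 < cross2 (q - p) (x - p)"
proof -
  have xt: "x \<in> t" using x interior_subset by blast
  have "closed_segment p q \<noteq> t"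
    using aff_dim aff_dim_closed_segment[of p q] by (auto split: if_splits)
  then have "x \<notin> closed_segment p q"
    using face_of_disjoint_interior[OF side_face[OF s]] x by auto
  then show ?thesis using side_line[OF s xt] side_ge[OF s xt] by force
qed

text \<open>Seen from \<open>v\<close>, the other vertices lie in an open half-plane and can be
  compared by angle. The line through \<open>v\<close> and the clockwise-most of them supports
  \<open>t\<close>, and the face it cuts out is a segment with end point \<open>v\<close>.\<close>

lemma exists_out:
  assumes v: "v \<in> verts t"
  shows "\<exists>u. (v, u) \<in> ccw_sides t"
proof -
  define V where "V = verts t - {v}"
  have vt: "v \<in> t" and cv: "convex (t - {v})"
    using v extreme_point_of_stillconvex[OF convex] by (auto simp: verts_def)
  have hV: "convex hull V \<subseteq> t - {v}"
    by (rule hull_minimal, use verts_subset in \<open>force simp: V_def\<close>, rule cv)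
  have Vne: "V \<noteq> {}"
  proof
    assume "V = {}"
    then have "verts t \<subseteq> {v}" by (auto simp: V_def)
    then have "t \<subseteq> {v}" using hull_mono[of "verts t" "{v}" convex] hull_verts by simp
    then have "interior t \<subseteq> interior {v}" by (rule interior_mono)
    then show False using interior_nonempty by simp
  qed
  have finV: "finite V" using finite_verts by (simp add: V_def)
  have "closed (convex hull V)" using finite_imp_compact_convex_hull[OF finV] compact_imp_closed by blast
  then obtain a b where ab: "a \<bullet> v < b" "\<And>x. x \<in> convex hull V \<Longrightarrow> a \<bullet> x > b"
    using separating_hyperplane_closed_point[of "convex hull V" v] hV convex_convex_hull by blast
  have pos: "a \<bullet> (x - v) > 0" if "x \<in> V" for x
    using ab(1) ab(2)[of x] hull_inc[OF that] by (simp add: inner_diff_right)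
  then have a0: "a \<noteq> 0" using Vne by auto
  \<comment> \<open>The tangent of the angle from \<open>a\<close> to \<open>x - v\<close>, monotone
    in the angle because the denominator is positive.\<close>
  define h where "h x = cross2 a (x - v) / (a \<bullet> (x - v))" for x
  obtain u where u: "u \<in> V" "\<And>x. x \<in> V \<Longrightarrow> h u \<le> h x"
    using arg_min_if_finite[OF finV Vne, of h] by (metis linorder_not_less)
  have ge: "0 \<le> cross2 (u - v) (x - v)" if x: "x \<in> V" for x
  proof -
    have "cross2 a (u - v) * (a \<bullet> (x - v)) \<le> cross2 a (x - v) * (a \<bullet> (u - v))"
      using u(2)[OF x] pos[OF x] pos[OF u(1)] by (simp add: h_def field_simps)
    moreover have "(a \<bullet> a) * cross2 (u - v) (x - v) =
       (a \<bullet> (u - v)) * cross2 a (x - v) - cross2 a (u - v) * (a \<bullet> (x - v))"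
      by (simp add: cross2_def inner_vec_def sum_2 algebra_simps)
    ultimately have "0 \<le> (a \<bullet> a) * cross2 (u - v) (x - v)" by (simp add: mult.commute)
    moreover have "a \<bullet> a > 0" using a0 by simp
    ultimately show ?thesis by (simp add: zero_le_mult_iff)
  qed
  define F where "F = t \<inter> {x. perp (u - v) \<bullet> x = perp (u - v) \<bullet> v}"
  have allge: "perp (u - v) \<bullet> v \<le> perp (u - v) \<bullet> x" if "x \<in> t" for x
  proof -
    have "verts t \<subseteq> {x. perp (u - v) \<bullet> v \<le> perp (u - v) \<bullet> x}"
    proof
      fix x assume "x \<in> verts t"
      then have "0 \<le> cross2 (u - v) (x - v)" using ge[of x] by (cases "x = v") (auto simp: V_def cross2_linear)
      then show "x \<in> {x. perp (u - v) \<bullet> v \<le> perp (u - v) \<bullet> x}" by (simp add: inner_perp cross2_linear)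
    qed
    then have "convex hull (verts t) \<subseteq> {x. perp (u - v) \<bullet> v \<le> perp (u - v) \<bullet> x}"
      by (rule hull_minimal) (simp add: convex_halfspace_ge)
    then show ?thesis using that hull_verts by auto
  qed
  have face: "F face_of t"
    unfolding F_def by (rule face_of_Int_supporting_hyperplane_ge[OF convex allge])
  have uv: "u \<noteq> v" using u by (auto simp: V_def)
  have Fv: "v \<in> F" "u \<in> F" using vt u(1) verts_subset
    by (auto simp: F_def V_def inner_perp cross2_def algebra_simps)
  have "F \<subseteq> affine hull {v, u}"
  proof
    fix x assume "x \<in> F"
    then have "cross2 (u - v) (x - v) = 0" by (simp add: F_def inner_perp cross2_linear)
    then obtain k where "x - v = k *\<^sub>R (u - v)" using cross2_parallel uv by (metis eq_iff_diff_eq_0)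
    then have "x = v + k *\<^sub>R (u - v)" by (simp add: algebra_simps)
    then show "x \<in> affine hull {v, u}" unfolding affine_hull_2_alt by auto
  qed
  then have "collinear F" by (meson collinear_2 collinear_affine_hull_collinear collinear_subset)
  moreover have "compact F" "convex F"
    using face face_of_imp_compact face_of_imp_convex compact convex by blast+
  ultimately obtain p q where pq: "F = closed_segment p q"
    using compact_convex_collinear_segment[of F] Fv by blast
  have "v extreme_point_of F" using extreme_point_of_face[OF face] v Fv by (simp add: verts_def)
  then have "v = p \<or> v = q" by (simp add: pq extreme_point_of_segment)
  then obtain w where w: "F = closed_segment v w" using pq closed_segment_commute by metis
  then have vw: "v \<noteq> w" using Fv uv by auto
  obtain k where k: "u = (1 - k) *\<^sub>R v + k *\<^sub>R w" "0 \<le> k" "k \<le> 1"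
    using Fv(2) unfolding w closed_segment_def by auto
  have uk: "u - v = k *\<^sub>R (w - v)" using k(1) by (simp add: algebra_simps)
  then have "k > 0" using uv k(2) by (metis order_le_less scaleR_zero_left eq_iff_diff_eq_0)
  have "0 \<le> cross2 (w - v) (x - v)" if "x \<in> t" for x
  proof -
    have "0 \<le> cross2 (u - v) (x - v)" using allge[OF that] by (simp add: inner_perp cross2_linear)
    then show ?thesis unfolding uk cross2_scaleR_left using \<open>k > 0\<close> by (simp add: zero_le_mult_iff)
  qed
  then have "(v, w) \<in> ccw_sides t"
    using face vw unfolding w by (auto simp: ccw_sides_def edge_of_def aff_dim_closed_segment)
  then show ?thesis by blast
qed

lemma out_unique:
  assumes "(v, u) \<in> ccw_sides t" "(v, u') \<in> ccw_sides t" shows "u = u'"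
proof -
  have "cross2 (u - v) (u' - v) \<ge> 0" "cross2 (u' - v) (u - v) \<ge> 0"
    using side_ge assms side_verts verts_subset by blast+
  then have "cross2 (u - v) (u' - v) = 0" using cross2_swap[of "u - v"] by simp
  then show ?thesis using side_vertex[OF assms(1) side_verts(2)[OF assms(2)]] side_neq[OF assms(2)] by auto
qed

lemma in_unique:
  assumes "(u, v) \<in> ccw_sides t" "(u', v) \<in> ccw_sides t" shows "u = u'"
proof -
  have "cross2 (v - u) (u' - u) \<ge> 0" "cross2 (v - u') (u - u') \<ge> 0"
    using side_ge assms side_verts verts_subset by blast+
  then have "cross2 (v - u) (u' - u) = 0" by (simp add: cross2_def algebra_simps)
  then show ?thesis using side_vertex[OF assms(1) side_verts(1)[OF assms(2)]] side_neq[OF assms(2)] by auto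
qed

lemma sides_subset: "ccw_sides t \<subseteq> verts t \<times> verts t"
  using side_verts by auto

lemma finite_sides: "finite (ccw_sides t)"
  using finite_subset[OF sides_subset] finite_verts by blast

lemma bij_fst: "bij_betw fst (ccw_sides t) (verts t)"
  unfolding bij_betw_def
proof
  show "inj_on fst (ccw_sides t)" using out_unique by (auto simp: inj_on_def)
  show "fst ` ccw_sides t = verts t" using exists_out sides_subset by force
qed

text \<open>Incoming sides exist by counting: by \<open>bij_fst\<close> there are as many sides as
  vertices, and no two sides end at the same vertex. This takes the place of a mirror image of
  \<open>exists_out\<close>.\<close>

lemma bij_snd: "bij_betw snd (ccw_sides t) (verts t)"
proof -
  have inj: "inj_on snd (ccw_sides t)" using in_unique by (auto simp: inj_on_def)
  have "snd ` ccw_sides t = verts t"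
  proof (rule card_subset_eq[OF finite_verts])
    show "snd ` ccw_sides t \<subseteq> verts t" using sides_subset by auto
    show "card (snd ` ccw_sides t) = card (verts t)"
      using card_image[OF inj] bij_betw_same_card[OF bij_fst] by simp
  qed
  then show ?thesis using inj by (simp add: bij_betw_def)
qed

lemma exists_in: "v \<in> verts t \<Longrightarrow> \<exists>u. (u, v) \<in> ccw_sides t"
  using bij_snd by (force simp: bij_betw_def)

text \<open>If the turn were not strict, the second side would run back along the first, and an
  interior point would lie strictly to the left of both.\<close>

lemma side_turn:
  assumes s: "(p, q) \<in> ccw_sides t" and s': "(q, r) \<in> ccw_sides t"
  shows "cross2 (q - p) (r - q) > 0"
proof (rule ccontr)
  assume "\<not> ?thesis"
  moreover have "cross2 (q - p) (r - p) \<ge> 0" using side_ge[OF s] side_verts(2)[OF s'] verts_subset by blast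
  ultimately have 0: "cross2 (q - p) (r - p) = 0" by (simp add: cross2_def algebra_simps)
  then have rp: "r = p" using side_vertex[OF s side_verts(2)[OF s']] side_neq[OF s'] by auto
  obtain x where x: "x \<in> interior t" using interior_nonempty by blast
  show False using side_interior[OF s x] side_interior[OF s' x] unfolding rp
    by (simp add: cross2_def algebra_simps)
qed

text \<open>The functional that exposes the edge is a multiple of \<open>perp (q - p)\<close>; the
  sign of the factor decides which order of the end points is counterclockwise.\<close>

lemma edge_is_side:
  assumes e: "e edge_of t"
  shows "\<exists>p q. (p, q) \<in> ccw_sides t \<and> e = closed_segment p q"
proof -
  have face: "e face_of t" and dim: "aff_dim e = 1" using e by (auto simp: edge_of_def)
  have "collinear e" using dim by (simp add: collinear_aff_dim)
  moreover have "compact e" "convex e"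
    using face face_of_imp_compact face_of_imp_convex compact convex by blast+
  moreover have "e \<noteq> {}" using dim by auto
  ultimately obtain p q where pq: "e = closed_segment p q"
    using compact_convex_collinear_segment by blast
  have ne: "p \<noteq> q" using dim by (auto simp: pq)
  have "e exposed_face_of t"
    using exposed_face_of_polyhedron polytope_imp_polyhedron[OF polytope] face by blast
  then obtain a b where ab: "t \<subseteq> {x. a \<bullet> x \<le> b}" "e = t \<inter> {x. a \<bullet> x = b}"
    by (auto simp: exposed_face_of_def)
  have pqe: "p \<in> e" "q \<in> e" by (auto simp: pq)
  have "a \<noteq> 0" using ab pqe aff_dim dim by auto
  have "a \<bullet> (q - p) = 0" using pqe ab(2) by (simp add: inner_diff_right)
  then have "cross2 (perp (q - p)) a = 0"
    by (simp add: perp_def cross2_def inner_vec_def sum_2 algebra_simps)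
  moreover have "perp (q - p) \<noteq> 0" using ne by (auto simp: perp_def point_eq_iff)
  ultimately obtain k where k: "a = k *\<^sub>R perp (q - p)" using cross2_parallel by metis
  then have k0: "k \<noteq> 0" using \<open>a \<noteq> 0\<close> by auto
  have le: "k * cross2 (q - p) (x - p) \<le> 0" if "x \<in> t" for x
  proof -
    have "a \<bullet> (x - p) \<le> 0" using ab that pqe by (auto simp: inner_diff_right)
    then show ?thesis by (simp add: k inner_perp)
  qed
  show ?thesis
  proof (cases "k < 0")
    case True
    then have "(p, q) \<in> ccw_sides t" using le e by (auto simp: ccw_sides_def pq mult_le_0_iff)
    then show ?thesis using pq by blast
  next
    case False
    have "(q, p) \<in> ccw_sides t"
    proof -
      have "0 \<le> cross2 (p - q) (x - q)" if "x \<in> t" for x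
      proof -
        have "cross2 (p - q) (x - q) = - cross2 (q - p) (x - p)" by (simp add: cross2_def algebra_simps)
        then show ?thesis using le[OF that] False k0 by (auto simp: mult_le_0_iff)
      qed
      then show ?thesis using e by (simp add: ccw_sides_def pq closed_segment_commute)
    qed
    then show ?thesis using pq closed_segment_commute by blast
  qed
qed

lemma frontier_sides: "frontier t = (\<Union>(p, q)\<in>ccw_sides t. closed_segment p q)"
proof -
  have "frontier t = rel_frontier t"
    using rel_frontier_nonempty_interior[OF interior_nonempty] by simp
  also have "\<dots> = \<Union>{F. F facet_of t}"
    by (rule rel_frontier_of_polyhedron[OF polytope_imp_polyhedron[OF polytope]])
  also have "{F. F facet_of t} = {F. F edge_of t}"
    by (auto simp: facet_of_def edge_of_def aff_dim)
  also have "\<Union>{F. F edge_of t} = (\<Union>(p, q)\<in>ccw_sides t. closed_segment p q)"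
    using edge_is_side by (fastforce simp: ccw_sides_def)
  finally show ?thesis .
qed

lemma frontier_side:
  assumes "x \<in> frontier t"
  obtains p q where "(p, q) \<in> ccw_sides t" "x \<in> closed_segment p q"
  using assms by (auto simp: frontier_sides)

lemma segment_in_side:
  assumes m: "m \<in> frontier t" "m \<in> open_segment x y" and xy: "x \<in> t" "y \<in> t"
  obtains p q where "(p, q) \<in> ccw_sides t" "closed_segment x y \<subseteq> closed_segment p q"
proof -
  obtain p q where s: "(p, q) \<in> ccw_sides t" "m \<in> closed_segment p q"
    using frontier_side[OF m(1)] by blast
  then have "x \<in> closed_segment p q" "y \<in> closed_segment p q"
    using side_face[OF s(1)] m(2) xy unfolding face_of_def by blast+
  then show ?thesis using that[OF s(1)] by (meson closed_segment_subset convex_closed_segment)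
qed

lemma side_eqI:
  assumes s: "(p, q) \<in> ccw_sides t" and s': "(p', q') \<in> ccw_sides t"
    and x: "x \<in> closed_segment p q" "x \<in> closed_segment p' q'"
    and y: "y \<in> closed_segment p q" "y \<in> closed_segment p' q'" and ne: "x \<noteq> y"
  shows "(p, q) = (p', q')"
proof -
  obtain m where m: "m \<in> open_segment x y" using ne open_segment_eq_empty by blast
  have in_pq: "m \<in> closed_segment p q" and in_pq': "m \<in> closed_segment p' q'"
    using m x y by (meson closed_segment_subset convex_closed_segment in_mono open_closed_segment)+
  have "m \<noteq> p'" "m \<noteq> q'"
    using m x y extreme_point_of_segment[of m p' q'] by (auto simp: extreme_point_of_def)
  then have "m \<in> open_segment p' q'" using in_pq' by (simp add: open_segment_def)
  then have "p' \<in> closed_segment p q" "q' \<in> closed_segment p q"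
    using side_face[OF s] in_pq side_verts[OF s'] verts_subset unfolding face_of_def by blast+
  then have "p' extreme_point_of closed_segment p q" "q' extreme_point_of closed_segment p q"
    using extreme_point_of_face[OF side_face[OF s]] side_verts[OF s'] by (auto simp: verts_def)
  then have "p' = p \<or> p' = q" "q' = p \<or> q' = q"
    by (simp_all add: extreme_point_of_segment)
  moreover have "(q, p) \<notin> ccw_sides t"
  proof
    assume sw: "(q, p) \<in> ccw_sides t"
    obtain z where z: "z \<in> interior t" using interior_nonempty by blast
    show False using side_interior[OF s z] side_interior[OF sw z] by (simp add: cross2_def algebra_simps)
  qed
  ultimately show ?thesis using s' side_neq[OF s'] by auto
qed

end

context polygon
begin

text \<open>A ray from an interior point to a point outside leaves \<open>t\<close> through a side.
  The functional of that side is positive at the start and zero at the exit, hence negative beyond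
  it.\<close>

lemma halfplanes: "x \<in> t \<longleftrightarrow> (\<forall>(p, q)\<in>ccw_sides t. 0 \<le> cross2 (q - p) (x - p))"
proof
  assume "x \<in> t"
  then show "\<forall>(p, q)\<in>ccw_sides t. 0 \<le> cross2 (q - p) (x - p)" using side_ge by blast
next
  assume ge: "\<forall>(p, q)\<in>ccw_sides t. 0 \<le> cross2 (q - p) (x - p)"
  obtain c where c: "c \<in> interior t" using interior_nonempty by blast
  show "x \<in> t"
  proof (rule ccontr)
    assume x: "x \<notin> t"
    then have "x \<noteq> c" using c interior_subset by blast
    obtain d where d: "0 < d" "c + d *\<^sub>R (x - c) \<in> frontier t"
      by (rule ray_to_frontier[of t c "x - c"]) (use compact compact_imp_bounded c \<open>x \<noteq> c\<close> in auto)
    define y where "y = c + d *\<^sub>R (x - c)"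
    have yt: "y \<in> t" using d closed by (auto simp: y_def frontier_def)
    have "d < 1"
    proof (rule ccontr)
      assume "\<not> d < 1"
      have "(1 / d) *\<^sub>R (y - c) = x - c" using d by (simp add: y_def)
      then have "x = (1 - 1 / d) *\<^sub>R c + (1 / d) *\<^sub>R y" by (simp add: algebra_simps)
      then have "x \<in> closed_segment c y" unfolding in_segment using \<open>\<not> d < 1\<close>
        by (intro exI[of _ "1 / d"]) auto
      then show False using x yt c interior_subset convex by (meson closed_segment_subset in_mono)
    qed
    obtain p q where s: "(p, q) \<in> ccw_sides t" "y \<in> closed_segment p q"
      using frontier_side[of y] d unfolding y_def by blast
    have "cross2 (q - p) (y - p) = 0"
      by (rule cross2_segment[OF s(2)])
    moreover have "cross2 (q - p) (y - p) = (1 - d) * cross2 (q - p) (c - p) + d * cross2 (q - p) (x - p)"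
      by (simp add: y_def cross2_def algebra_simps)
    moreover have "(1 - d) * cross2 (q - p) (c - p) > 0" using side_interior[OF s(1) c] \<open>d < 1\<close> by simp
    moreover have "d * cross2 (q - p) (x - p) \<ge> 0" using ge s d by auto
    ultimately show False by linarith
  qed
qed

lemma interior_halfplanes:
  assumes "\<And>p q. (p, q) \<in> ccw_sides t \<Longrightarrow> 0 < cross2 (q - p) (x - p)"
  shows "x \<in> interior t"
proof (rule interiorI)
  have "{y. \<forall>s\<in>ccw_sides t. 0 < cross2 (snd s - fst s) (y - fst s)} =
     (\<Inter>s\<in>ccw_sides t. {y. 0 < perp (snd s - fst s) \<bullet> (y - fst s)})"
    by (auto simp: inner_perp)
  moreover have "open \<dots>"
    by (intro open_INT finite_sides ballI open_Collect_less continuous_intros)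
  ultimately show "open {y. \<forall>s\<in>ccw_sides t. 0 < cross2 (snd s - fst s) (y - fst s)}" by simp
  show "x \<in> {y. \<forall>s\<in>ccw_sides t. 0 < cross2 (snd s - fst s) (y - fst s)}" using assms by auto
  show "{y. \<forall>s\<in>ccw_sides t. 0 < cross2 (snd s - fst s) (y - fst s)} \<subseteq> t"
  proof
    fix y assume y: "y \<in> {y. \<forall>s\<in>ccw_sides t. 0 < cross2 (snd s - fst s) (y - fst s)}"
    then have "\<forall>(p, q)\<in>ccw_sides t. 0 \<le> cross2 (q - p) (y - p)" by (force intro: less_imp_le)
    then show "y \<in> t" by (simp add: halfplanes)
  qed
qed

text \<open>Near an inner point of a side only the constraint of that side is active. Used in
  \<open>tile_overlap\<close> to find a common interior point of two tiles.\<close>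

lemma side_near:
  assumes s: "(p, q) \<in> ccw_sides t" and m: "m \<in> open_segment p q" and n: "cross2 (q - p) n > 0"
  shows "\<forall>\<^sub>F r in at_right 0. m + r *\<^sub>R n \<in> interior t"
proof -
  have mt: "m \<in> t" using m side_subset[OF s] by (auto simp: open_segment_def)
  have "\<forall>\<^sub>F r in at_right 0. 0 < cross2 (snd z - fst z) (m + r *\<^sub>R n - fst z)" if z: "z \<in> ccw_sides t" for z
  proof (cases "z = (p, q)")
    case True
    have "cross2 (q - p) (m - p) = 0" using m open_closed_segment by (blast intro: cross2_segment)
    then have "cross2 (q - p) (m + r *\<^sub>R n - p) = r * cross2 (q - p) n" for r
      by (simp add: cross2_linear)
    then show ?thesis using True n by (auto simp: eventually_at_right_less intro: eventually_mono[OF eventually_at_right_less[of 0]])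
  next
    case False
    obtain p' q' where z': "z = (p', q')" by (cases z)
    have "cross2 (q' - p') (m - p') \<noteq> 0"
    proof
      assume "cross2 (q' - p') (m - p') = 0"
      then have "m \<in> closed_segment p' q'" using side_line mt z z' by blast
      then have "p \<in> closed_segment p' q'" "q \<in> closed_segment p' q'"
        using side_face[of p' q'] z z' m side_verts[OF s] verts_subset unfolding face_of_def by blast+
      then show False using side_eqI[OF s, of p' q' p q] side_neq[OF s] z z' False by auto
    qed
    then have pos: "cross2 (q' - p') (m - p') > 0" using side_ge[of p' q' m] mt z z' by force
    have "((\<lambda>r. cross2 (q' - p') (m - p') + r * cross2 (q' - p') n) \<longlongrightarrow> cross2 (q' - p') (m - p') + 0 * cross2 (q' - p') n) (at_right 0)"
      by (intro tendsto_intros)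
    then have "\<forall>\<^sub>F r in at_right 0. 0 < cross2 (q' - p') (m - p') + r * cross2 (q' - p') n"
      by (rule order_tendstoD(1)) (use pos in simp)
    then show ?thesis by (rule eventually_mono) (simp add: z' cross2_linear algebra_simps)
  qed
  then have "\<forall>\<^sub>F r in at_right 0. \<forall>z\<in>ccw_sides t. 0 < cross2 (snd z - fst z) (m + r *\<^sub>R n - fst z)"
    using finite_sides by (simp add: eventually_ball_finite)
  then show ?thesis by (rule eventually_mono) (force intro: interior_halfplanes)
qed

end

section \<open>The area form of a convex polygon\<close>

text \<open>The shear preserves \<open>cross2\<close> (see \<open>cross2_fx\<close>), hence signed
  areas, and all but finitely many \<open>e\<close> make every side non-vertical.\<close>

definition fx :: "real \<Rightarrow> point \<Rightarrow> real" where "fx e u = u $ 1 + e * u $ 2"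

definition slope :: "real \<Rightarrow> point \<Rightarrow> real" where "slope e u = u $ 2 / fx e u"

lemma fx_add: "fx e (u + v) = fx e u + fx e v"
  and fx_diff: "fx e (u - v) = fx e u - fx e v"
  and fx_scaleR: "fx e (r *\<^sub>R u) = r * fx e u"
  and fx_minus: "fx e (- u) = - fx e u"
  and fx_0: "fx e 0 = 0"
  by (simp_all add: fx_def algebra_simps)

lemmas fx_linear = fx_add fx_diff fx_scaleR fx_minus fx_0

lemma cross2_fx: "cross2 u v = fx e u * v $ 2 - fx e v * u $ 2"
  by (simp add: cross2_def fx_def algebra_simps)

lemma slope_scaleR: "k \<noteq> 0 \<Longrightarrow> slope e (k *\<^sub>R u) = slope e u"
  by (simp add: slope_def fx_scaleR)

lemma integral_linepath_coord:
  "integral {0..1} (\<lambda>s. linepath a b s $ 1 * c) = (a $ 1 + b $ 1) / 2 * c" for a b :: point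
proof -
  have "((\<lambda>s. linepath a b s $ 1 * c) has_integral
      ((a $ 1 * 1 + (b $ 1 - a $ 1) * 1\<^sup>2 / 2) * c - (a $ 1 * 0 + (b $ 1 - a $ 1) * 0\<^sup>2 / 2) * c)) {0..1}"
    by (rule fundamental_theorem_of_calculus)
       (auto intro!: derivative_eq_intros
          simp: has_real_derivative_iff_has_vector_derivative[symmetric] linepath_def field_simps)
  then show ?thesis by (auto dest!: integral_unique simp: field_simps)
qed

definition parallel :: "point set \<Rightarrow> (point \<Rightarrow> point) \<Rightarrow> bool" where
  "parallel t P \<longleftrightarrow> (\<forall>(p, q)\<in>ccw_sides t. \<exists>a. P q - P p = a *\<^sub>R (q - p))"

context polygon
begin

definition nxt :: "point \<Rightarrow> point" where "nxt v = (THE u. (v, u) \<in> ccw_sides t)"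
definition prv :: "point \<Rightarrow> point" where "prv v = (THE u. (u, v) \<in> ccw_sides t)"

lemma nxt_eq: "(p, q) \<in> ccw_sides t \<Longrightarrow> nxt p = q"
  unfolding nxt_def by (rule the_equality) (auto dest: out_unique)

lemma prv_eq: "(p, q) \<in> ccw_sides t \<Longrightarrow> prv q = p"
  unfolding prv_def by (rule the_equality) (auto dest: in_unique)

lemma nxt_side: "v \<in> verts t \<Longrightarrow> (v, nxt v) \<in> ccw_sides t"
  using exists_out nxt_eq by blast

lemma prv_side: "v \<in> verts t \<Longrightarrow> (prv v, v) \<in> ccw_sides t"
  using exists_in prv_eq by blast

lemma sum_sides_out: "(\<Sum>(p, q)\<in>ccw_sides t. G p q) = (\<Sum>v\<in>verts t. G v (nxt v))"
  unfolding sum.reindex_bij_betw[OF bij_fst, of "\<lambda>v. G v (nxt v)", symmetric]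
  by (rule sum.cong[OF refl]) (auto simp: nxt_eq)

lemma sum_sides_in: "(\<Sum>(p, q)\<in>ccw_sides t. G p q) = (\<Sum>v\<in>verts t. G (prv v) v)"
  unfolding sum.reindex_bij_betw[OF bij_snd, of "\<lambda>v. G (prv v) v", symmetric]
  by (rule sum.cong[OF refl]) (auto simp: prv_eq)

lemma sum_sides_by_parts:
  fixes G :: "point \<Rightarrow> point \<Rightarrow> point \<Rightarrow> real"
  shows "(\<Sum>(p, q)\<in>ccw_sides t. G p q q - G p q p) = (\<Sum>v\<in>verts t. G (prv v) v v - G v (nxt v) v)"
proof -
  have "(\<Sum>(p, q)\<in>ccw_sides t. G p q q - G p q p) =
      (\<Sum>(p, q)\<in>ccw_sides t. G p q q) - (\<Sum>(p, q)\<in>ccw_sides t. G p q p)"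
    by (simp add: sum_subtractf split_def)
  then show ?thesis
    by (simp add: sum_sides_in[of "\<lambda>p q. G p q q"] sum_sides_out[of "\<lambda>p q. G p q p"] sum_subtractf)
qed

lemma sum_sides_telescope:
  fixes G :: "point \<Rightarrow> real"
  shows "(\<Sum>(p, q)\<in>ccw_sides t. G q - G p) = 0"
  using sum_sides_by_parts[of "\<lambda>p q v. G v"] by simp

lemma parallel_id: "parallel t (\<lambda>v. v)"
  unfolding parallel_def by (auto intro: exI[of _ 1])

lemma parallel_lincomb:
  assumes "parallel t P" "parallel t Q"
  shows "parallel t (\<lambda>v. r *\<^sub>R P v + s *\<^sub>R Q v + c)"
  unfolding parallel_def
proof safe
  fix p q assume "(p, q) \<in> ccw_sides t"
  then obtain a b where "P q - P p = a *\<^sub>R (q - p)" "Q q - Q p = b *\<^sub>R (q - p)"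
    using assms unfolding parallel_def by blast
  then have "r *\<^sub>R P q + s *\<^sub>R Q q + c - (r *\<^sub>R P p + s *\<^sub>R Q p + c) = (r * a + s * b) *\<^sub>R (q - p)"
    by (metis (no_types, opaque_lifting) add_diff_add add_diff_cancel_right scaleR_left.add scaleR_right_diff_distrib scaleR_scaleR)
  then show "\<exists>a. r *\<^sub>R P q + s *\<^sub>R Q q + c - (r *\<^sub>R P p + s *\<^sub>R Q p + c) = a *\<^sub>R (q - p)" by blast
qed

end

section \<open>The diagonal form of the signed area and its signature\<close>

locale generic_polygon = polygon +
  fixes e :: real
  assumes generic: "(p, q) \<in> ccw_sides t \<Longrightarrow> fx e (q - p) \<noteq> 0"
begin

definition coef :: "point \<Rightarrow> real" where
  "coef v = slope e (v - prv v) - slope e (nxt v - v)"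

text \<open>The polarized area, with ordinates eliminated through the slopes of the sides. As a
  formula in arbitrary maps it is bilinear and symmetric by inspection; \<open>parallel\<close>
  enters where it is compared with areas.\<close>

definition mform :: "(point \<Rightarrow> point) \<Rightarrow> (point \<Rightarrow> point) \<Rightarrow> real" where
  "mform P Q = (\<Sum>v\<in>verts t. coef v * fx e (P v) * fx e (Q v)) / 2"

lemma mform_sym: "mform P Q = mform Q P"
  by (simp add: mform_def mult_ac)

lemma mform_lincomb:
  "mform (\<lambda>v. r *\<^sub>R P v + s *\<^sub>R P' v) Q = r * mform P Q + s * mform P' Q"
  unfolding mform_def fx_linear
  by (simp add: algebra_simps sum.distrib sum_distrib_left add_divide_distrib)

lemma parallel_slope:
  assumes P: "parallel t P" and s: "(p, q) \<in> ccw_sides t"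
  shows "(P q - P p) $ 2 = slope e (q - p) * fx e (P q - P p)"
proof -
  obtain a where "P q - P p = a *\<^sub>R (q - p)" using assms unfolding parallel_def by blast
  then show ?thesis using generic[OF s] by (simp add: slope_def fx_scaleR)
qed

lemma signed_area_eq:
  assumes P: "parallel t P"
  shows "signed_area t P = mform P P"
proof -
  have tele: "(\<Sum>(p, q)\<in>ccw_sides t. (P q $ 2)\<^sup>2 - (P p $ 2)\<^sup>2) = 0"
    by (rule sum_sides_telescope)
  have "signed_area t P = (\<Sum>(p, q)\<in>ccw_sides t. (P p $ 1 + P q $ 1) / 2 * (P q - P p) $ 2)"
    unfolding signed_area_def integral_linepath_coord by simp
  \<comment> \<open>Passing from the abscissa to the sheared coordinate adds \<open>e / 2\<close>
    times differences of squared ordinates, which telescope around the polygon.\<close>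
  also have "\<dots> = (\<Sum>(p, q)\<in>ccw_sides t. (P p $ 1 + P q $ 1) / 2 * (P q - P p) $ 2) +
      e / 2 * (\<Sum>(p, q)\<in>ccw_sides t. (P q $ 2)\<^sup>2 - (P p $ 2)\<^sup>2)"
    unfolding tele by simp
  also have "\<dots> = (\<Sum>(p, q)\<in>ccw_sides t. slope e (q - p) * (fx e (P q))\<^sup>2 / 2 - slope e (q - p) * (fx e (P p))\<^sup>2 / 2)"
    unfolding sum_distrib_left sum.distrib[symmetric]
  proof (rule sum.cong[OF refl], clarify)
    fix p q assume s: "(p, q) \<in> ccw_sides t"
    have "(P p $ 1 + P q $ 1) / 2 * (P q - P p) $ 2 + e / 2 * ((P q $ 2)\<^sup>2 - (P p $ 2)\<^sup>2) =
        (fx e (P p) + fx e (P q)) / 2 * (P q - P p) $ 2"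
      by (simp add: fx_def power2_eq_square field_simps)
    also have "\<dots> = slope e (q - p) * (fx e (P q))\<^sup>2 / 2 - slope e (q - p) * (fx e (P p))\<^sup>2 / 2"
      unfolding parallel_slope[OF P s] fx_diff by (simp add: power2_eq_square field_simps)
    finally show "(P p $ 1 + P q $ 1) / 2 * (P q - P p) $ 2 + e / 2 * ((P q $ 2)\<^sup>2 - (P p $ 2)\<^sup>2) =
      slope e (q - p) * (fx e (P q))\<^sup>2 / 2 - slope e (q - p) * (fx e (P p))\<^sup>2 / 2" .
  qed
  also have "\<dots> = (\<Sum>v\<in>verts t. slope e (v - prv v) * (fx e (P v))\<^sup>2 / 2 - slope e (nxt v - v) * (fx e (P v))\<^sup>2 / 2)"
    by (rule sum_sides_by_parts[of "\<lambda>p q v. slope e (q - p) * (fx e (P v))\<^sup>2 / 2"])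
  also have "\<dots> = mform P P"
    unfolding mform_def sum_divide_distrib
    by (rule sum.cong[OF refl]) (simp add: coef_def power2_eq_square field_simps)
  finally show ?thesis .
qed

text \<open>The bracket is minus the ordinate intercept of the line carrying the side of
  \<open>P\<close>, so it has the same value at both ends of the side. The result is the mixed area
  in the form "support number times edge", which sees \<open>Q\<close> only through its edge
  vectors; translation invariance follows.\<close>

lemma mform_mixed:
  assumes P: "parallel t P"
  shows "mform P Q = (\<Sum>(p, q)\<in>ccw_sides t. (slope e (q - p) * fx e (P p) - P p $ 2) * fx e (Q q - Q p)) / 2"
proof -
  have "(\<Sum>(p, q)\<in>ccw_sides t. (slope e (q - p) * fx e (P p) - P p $ 2) * fx e (Q q - Q p)) =
    (\<Sum>(p, q)\<in>ccw_sides t. (slope e (q - p) * fx e (P q) - P q $ 2) * fx e (Q q) -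
       (slope e (q - p) * fx e (P p) - P p $ 2) * fx e (Q p))"
  proof (rule sum.cong[OF refl], clarify)
    fix p q assume s: "(p, q) \<in> ccw_sides t"
    have eq: "slope e (q - p) * fx e (P q) - P q $ 2 = slope e (q - p) * fx e (P p) - P p $ 2"
      using parallel_slope[OF P s] by (simp add: fx_diff algebra_simps)
    show "(slope e (q - p) * fx e (P p) - P p $ 2) * fx e (Q q - Q p) =
      (slope e (q - p) * fx e (P q) - P q $ 2) * fx e (Q q) -
       (slope e (q - p) * fx e (P p) - P p $ 2) * fx e (Q p)"
      unfolding eq by (simp add: fx_diff right_diff_distrib)
  qed
  also have "\<dots> = (\<Sum>v\<in>verts t. (slope e (v - prv v) * fx e (P v) - P v $ 2) * fx e (Q v) -
       (slope e (nxt v - v) * fx e (P v) - P v $ 2) * fx e (Q v))"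
    by (rule sum_sides_by_parts[of "\<lambda>p q v. (slope e (q - p) * fx e (P v) - P v $ 2) * fx e (Q v)"])
  also have "\<dots> = 2 * mform P Q"
    unfolding mform_def by (simp add: coef_def algebra_simps)
  finally show ?thesis by simp
qed

text \<open>The contribution of the base point \<open>c\<close> telescopes, so \<open>c\<close> is
  free. An interior point of the tile makes every term positive in
  \<open>mform_id_pos\<close>.\<close>

lemma mform_cross:
  assumes P: "parallel t P" and Q: "parallel t Q"
  shows "mform P Q = (\<Sum>(p, q)\<in>ccw_sides t. cross2 (P p - c) (Q q - Q p)) / 2"
proof -
  have "(\<Sum>(p, q)\<in>ccw_sides t. cross2 (P p - c) (Q q - Q p)) =
    (\<Sum>(p, q)\<in>ccw_sides t. (slope e (q - p) * fx e (P p) - P p $ 2) * fx e (Q q - Q p)) -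
    (\<Sum>(p, q)\<in>ccw_sides t. cross2 c (Q q) - cross2 c (Q p))"
    unfolding sum_subtractf[symmetric]
  proof (rule sum.cong[OF refl], clarify)
    fix p q assume s: "(p, q) \<in> ccw_sides t"
    have "cross2 (P p) (Q q - Q p) = (slope e (q - p) * fx e (P p) - P p $ 2) * fx e (Q q - Q p)"
      unfolding cross2_fx[of _ _ e] parallel_slope[OF Q s] by (simp add: algebra_simps)
    then show "cross2 (P p - c) (Q q - Q p) =
      (slope e (q - p) * fx e (P p) - P p $ 2) * fx e (Q q - Q p) - (cross2 c (Q q) - cross2 c (Q p))"
      by (simp add: cross2_linear)
  qed
  then show ?thesis using sum_sides_telescope[of "\<lambda>v. cross2 c (Q v)"] mform_mixed[OF P, of Q] by simp
qed

lemma mform_translate: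
  assumes P: "parallel t P"
  shows "mform P (\<lambda>v. Q v + c) = mform P Q"
  unfolding mform_mixed[OF P] by simp

lemma mform_id_pos:
  assumes P: "parallel t P" and a: "\<And>p q. (p, q) \<in> ccw_sides t \<Longrightarrow> \<exists>a>0. P q - P p = a *\<^sub>R (q - p)"
  shows "mform (\<lambda>v. v) P > 0"
proof -
  obtain c where c: "c \<in> interior t" using interior_nonempty by blast
  have "(\<Sum>(p, q)\<in>ccw_sides t. cross2 (p - c) (P q - P p)) > 0"
  proof (rule sum_pos[OF finite_sides])
    obtain v where "v \<in> verts t" using c interior_subset hull_verts by fastforce
    then show "ccw_sides t \<noteq> {}" using exists_out by blast
    fix s assume "s \<in> ccw_sides t"
    then obtain p q where s: "s = (p, q)" "(p, q) \<in> ccw_sides t" by (cases s) auto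
    obtain k where k: "k > 0" "P q - P p = k *\<^sub>R (q - p)" using a[OF s(2)] by blast
    have "cross2 (p - c) (P q - P p) = k * cross2 (q - p) (c - p)"
      unfolding k by (simp add: cross2_def algebra_simps)
    then show "0 < (case s of (p, q) \<Rightarrow> cross2 (p - c) (P q - P p))"
      using k side_interior[OF s(2) c] s(1) by simp
  qed
  then show ?thesis using mform_cross[OF parallel_id P, of c] by simp
qed

lemma mform_id_id_pos: "mform (\<lambda>v. v) (\<lambda>v. v) > 0"
  by (rule mform_id_pos[OF parallel_id]) (auto intro: exI[of _ 1])

text \<open>\<open>t\<close> lies in the cone at \<open>v\<close> spanned by its two sides there, so
  what holds for both sides holds for all of \<open>t\<close>. The factor \<sigma> treats minima and
  maxima together.\<close>

lemma local_extremum: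
  assumes v: "v \<in> verts t" and \<sigma>: "\<sigma> * fx e (prv v - v) > 0" "\<sigma> * fx e (nxt v - v) > 0"
    and x: "x \<in> t" "x \<noteq> v"
  shows "\<sigma> * fx e (x - v) > 0"
proof -
  define a where "a = v - prv v"
  define b where "b = nxt v - v"
  have D: "cross2 a b > 0" unfolding a_def b_def by (rule side_turn[OF prv_side[OF v] nxt_side[OF v]])
  have 1: "cross2 a (x - v) \<ge> 0" using side_ge[OF prv_side[OF v] x(1)]
    by (simp add: a_def cross2_def algebra_simps)
  have 2: "cross2 b (x - v) \<ge> 0" using side_ge[OF nxt_side[OF v] x(1)] by (simp add: b_def)
  have ex: "cross2 a b *\<^sub>R (x - v) = cross2 (x - v) b *\<^sub>R a + cross2 a (x - v) *\<^sub>R b"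
    by (rule cross2_expand)
  have "cross2 a b * fx e (x - v) = cross2 (x - v) b * fx e a + cross2 a (x - v) * fx e b"
    using arg_cong[OF ex, of "fx e"] by (simp only: fx_linear)
  then have "cross2 a b * (\<sigma> * fx e (x - v)) = \<sigma> * (cross2 (x - v) b * fx e a + cross2 a (x - v) * fx e b)"
    by (simp only: mult.left_commute)
  also have "\<dots> = cross2 b (x - v) * (\<sigma> * fx e (prv v - v)) + cross2 a (x - v) * (\<sigma> * fx e b)"
    using cross2_swap[of b "x - v"] by (simp add: a_def fx_diff algebra_simps)
  finally have eq: "cross2 a b * (\<sigma> * fx e (x - v)) = \<dots>" .
  have "cross2 b (x - v) \<noteq> 0 \<or> cross2 a (x - v) \<noteq> 0"
  proof (rule ccontr)
    assume "\<not> ?thesis"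
    then have "cross2 a b *\<^sub>R (x - v) = 0" unfolding ex using cross2_swap[of b "x - v"] by simp
    then show False using D x by simp
  qed
  then have "cross2 b (x - v) * (\<sigma> * fx e (prv v - v)) + cross2 a (x - v) * (\<sigma> * fx e b) > 0"
    using 1 2 \<sigma> unfolding b_def
    by (metis add_nonneg_pos add_pos_nonneg mult_nonneg_nonneg mult_pos_pos order_le_less)
  then show ?thesis using D eq zero_less_mult_pos by metis
qed

definition vmin :: point where "vmin = arg_min (fx e) (\<lambda>v. v \<in> verts t)"
definition vmax :: point where "vmax = arg_min (\<lambda>v. - fx e v) (\<lambda>v. v \<in> verts t)"

lemma verts_nonempty: "verts t \<noteq> {}"
  using interior_nonempty interior_subset hull_verts by fastforce

lemma vmin: "vmin \<in> verts t" "v \<in> verts t \<Longrightarrow> fx e vmin \<le> fx e v"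
  using arg_min_if_finite[OF finite_verts verts_nonempty, of "fx e"]
  unfolding vmin_def arg_min_on_def by (auto simp: not_less)

lemma vmax: "vmax \<in> verts t" "v \<in> verts t \<Longrightarrow> fx e v \<le> fx e vmax"
  using arg_min_if_finite[OF finite_verts verts_nonempty, of "\<lambda>v. - fx e v"]
  unfolding vmax_def arg_min_on_def by (auto simp: not_less)

lemma nxt_verts: "v \<in> verts t \<Longrightarrow> nxt v \<in> verts t" and prv_verts: "v \<in> verts t \<Longrightarrow> prv v \<in> verts t"
  using nxt_side prv_side side_verts by blast+

lemma vmin_local: "fx e (prv vmin - vmin) > 0" "fx e (nxt vmin - vmin) > 0"
proof -
  have "fx e (prv vmin - vmin) \<noteq> 0"
    using generic[OF prv_side[OF vmin(1)]] by (simp add: fx_diff)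
  then show "fx e (prv vmin - vmin) > 0" using vmin(2)[OF prv_verts[OF vmin(1)]] by (simp add: fx_diff)
  show "fx e (nxt vmin - vmin) > 0"
    using generic[OF nxt_side[OF vmin(1)]] vmin(2)[OF nxt_verts[OF vmin(1)]] by (simp add: fx_diff)
qed

lemma vmin_unique:
  assumes v: "v \<in> verts t" and "fx e (prv v - v) > 0" "fx e (nxt v - v) > 0"
  shows "v = vmin"
proof (rule ccontr)
  assume "v \<noteq> vmin"
  then have "1 * fx e (vmin - v) > 0"
    using local_extremum[OF v, of 1 vmin] assms vmin verts_subset by force
  then show False using vmin(2)[OF v] by (simp add: fx_diff)
qed

lemma vmin_less_vmax: "fx e vmin < fx e vmax"
  using vmin_local(2) vmax(2)[OF nxt_verts[OF vmin(1)]] by (simp add: fx_diff)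

lemma not_extremal:
  assumes v: "v \<in> verts t" "v \<noteq> vmin" "v \<noteq> vmax"
  shows "fx e (v - prv v) * fx e (nxt v - v) > 0"
proof (rule ccontr)
  assume "\<not> ?thesis"
  moreover have "fx e (v - prv v) \<noteq> 0" "fx e (nxt v - v) \<noteq> 0"
    using generic[OF prv_side[OF v(1)]] generic[OF nxt_side[OF v(1)]] by auto
  ultimately consider "fx e (prv v - v) > 0" "fx e (nxt v - v) > 0"
    | "fx e (prv v - v) < 0" "fx e (nxt v - v) < 0"
    by (fastforce simp: fx_diff zero_less_mult_iff)
  then show False
  proof cases
    case 1
    then show False using vmin_unique[OF v(1)] v by blast
  next
    case 2
    then have "-1 * fx e (vmax - v) > 0"
      using local_extremum[OF v(1), of "-1" vmax] v vmax verts_subset by force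
    then show False using vmax(2)[OF v(1)] by (simp add: fx_diff)
  qed
qed

text \<open>The difference of two slopes is minus the cross product over the product of the runs.
  Left turns make the cross product positive, and away from the extremal vertices the two runs have
  the same sign.\<close>

lemma coef_neg:
  assumes v: "v \<in> verts t" "v \<noteq> vmin" "v \<noteq> vmax"
  shows "coef v < 0"
proof -
  define a where "a = v - prv v"
  define b where "b = nxt v - v"
  have D: "cross2 a b > 0" unfolding a_def b_def by (rule side_turn[OF prv_side[OF v(1)] nxt_side[OF v(1)]])
  have ab: "fx e a * fx e b > 0" using not_extremal[OF v] by (simp add: a_def b_def)
  then have "fx e a \<noteq> 0" "fx e b \<noteq> 0" by auto
  then have "coef v = - cross2 a b / (fx e a * fx e b)"
    by (simp add: coef_def a_def[symmetric] b_def[symmetric] slope_def cross2_fx[of a b e] field_simps)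
  then show ?thesis using D ab by (simp add: divide_neg_pos)
qed

text \<open>Subtracting a multiple of \<open>t\<close> and a translation makes the sheared coordinate vanish at
  both extremal vertices, where alone the diagonal coefficients may be positive.\<close>

lemma lorentzian:
  assumes P: "parallel t P" and orth: "mform (\<lambda>v. v) P = 0"
  shows "mform P P \<le> 0" and "mform P P = 0 \<Longrightarrow> v \<in> verts t \<Longrightarrow> fx e (P v) = fx e (P vmin)"
proof -
  define r where "r = (fx e (P vmax) - fx e (P vmin)) / (fx e vmax - fx e vmin)"
  define c where "c = r *\<^sub>R vmin - P vmin"
  define u0 where "u0 = (\<lambda>v. 1 *\<^sub>R P v + (- r) *\<^sub>R v)"
  define u where "u = (\<lambda>v. u0 v + c)"
  have u0: "parallel t u0" using parallel_lincomb[OF P parallel_id, of 1 "- r" 0] by (simp add: u0_def)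
  have pu: "parallel t u" using parallel_lincomb[OF P parallel_id, of 1 "- r" c] by (simp add: u_def u0_def)
  have z: "fx e (u vmin) = 0" "fx e (u vmax) = 0"
    using vmin_less_vmax by (simp_all add: u_def u0_def c_def fx_linear r_def field_simps)
  have term_le: "coef v * fx e (u v) * fx e (u v) \<le> 0" if "v \<in> verts t" for v
    using coef_neg[OF that] z by (cases "v = vmin \<or> v = vmax") (auto simp: mult_le_0_iff mult.assoc zero_le_mult_iff)
  then have le: "mform u u \<le> 0" unfolding mform_def by (simp add: sum_nonpos)
  have "mform u u = mform u u0" unfolding u_def[of] by (rule mform_translate) (use pu u_def in simp)
  also have "\<dots> = mform u0 u" by (rule mform_sym)
  also have "\<dots> = mform u0 u0" unfolding u_def by (rule mform_translate[OF u0])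
  also have "\<dots> = mform P u0 - r * mform (\<lambda>v. v) u0"
    using mform_lincomb[of 1 P "- r" "\<lambda>v. v" u0] by (simp add: u0_def)
  also have "\<dots> = mform P P - 2 * r * mform (\<lambda>v. v) P + r\<^sup>2 * mform (\<lambda>v. v) (\<lambda>v. v)"
  proof -
    have A: "mform P u0 = mform P P - r * mform (\<lambda>v. v) P"
      using mform_lincomb[of 1 P "- r" "\<lambda>v. v" P] mform_sym[of u0 P] unfolding u0_def by simp
    have B: "mform (\<lambda>v. v) u0 = mform (\<lambda>v. v) P - r * mform (\<lambda>v. v) (\<lambda>v. v)"
      using mform_lincomb[of 1 P "- r" "\<lambda>v. v" "\<lambda>v. v"] mform_sym[of u0 "\<lambda>v. v"] mform_sym[of P "\<lambda>v. v"]
      unfolding u0_def by simp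
    show ?thesis unfolding A B by (simp add: power2_eq_square algebra_simps)
  qed
  finally have eq: "mform u u = mform P P + r\<^sup>2 * mform (\<lambda>v. v) (\<lambda>v. v)" using orth by simp
  have nn: "r\<^sup>2 * mform (\<lambda>v. v) (\<lambda>v. v) \<ge> 0" using mform_id_id_pos by simp
  show "mform P P \<le> 0" using eq le nn by linarith
  assume 0: "mform P P = 0" and v: "v \<in> verts t"
  have "r\<^sup>2 * mform (\<lambda>v. v) (\<lambda>v. v) = 0" using eq le nn 0 by linarith
  \<comment> \<open>Equality removes the multiple of the tile; strict negativity of the remaining
    coefficients then makes \<open>u\<close> vanish in the sheared coordinate at every
    vertex.\<close>
  then have r0: "r = 0" using mform_id_id_pos by simp
  have "mform u u = 0" using eq 0 r0 by simp
  then have "(\<Sum>v\<in>verts t. - (coef v * fx e (u v) * fx e (u v))) = 0"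
    by (simp add: mform_def sum_negf)
  then have "- (coef v * fx e (u v) * fx e (u v)) = 0"
    using term_le v by (subst (asm) sum_nonneg_eq_0_iff[OF finite_verts]) auto
  then have "fx e (u v) = 0"
    using coef_neg[OF v] z by (cases "v = vmin \<or> v = vmax") auto
  then show "fx e (P v) = fx e (P vmin)" by (simp add: u_def u0_def c_def r0 fx_linear)
qed

text \<open>Descent in the sheared coordinate: every vertex other than \<open>vmin\<close> has a
  lower neighbour. This stands in for a cyclic enumeration of the vertices.\<close>

lemma constant_on_verts:
  assumes "\<And>p q. (p, q) \<in> ccw_sides t \<Longrightarrow> \<Phi> p = \<Phi> q" and v: "v \<in> verts t"
  shows "\<Phi> v = \<Phi> vmin"
  using v
proof (induction "card {u \<in> verts t. fx e u < fx e v}" arbitrary: v rule: less_induct)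
  case less
  show ?case
  proof (cases "v = vmin")
    case False
    then have "\<not> (fx e (prv v - v) > 0 \<and> fx e (nxt v - v) > 0)" using vmin_unique less.prems by blast
    then obtain u where u: "u \<in> verts t" "fx e u < fx e v" "\<Phi> u = \<Phi> v"
      using generic[OF prv_side[OF less.prems]] generic[OF nxt_side[OF less.prems]]
        nxt_verts[OF less.prems] prv_verts[OF less.prems]
        assms(1)[OF prv_side[OF less.prems]] assms(1)[OF nxt_side[OF less.prems]]
      by (metis diff_gt_0_iff_gt eq_iff_diff_eq_0 fx_diff linorder_neqE_linordered_idom)
    have "card {w \<in> verts t. fx e w < fx e u} < card {w \<in> verts t. fx e w < fx e v}"
      by (rule psubset_card_mono) (use finite_verts u in auto)
    then show ?thesis using less.hyps[of u] u by simp
  qed simp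
qed

lemma lorentzian_rigid:
  assumes P: "parallel t P" and "mform (\<lambda>v. v) P = 0" "mform P P = 0" and v: "v \<in> verts t"
  shows "P v = P vmin"
proof (rule constant_on_verts[OF _ v])
  fix p q assume s: "(p, q) \<in> ccw_sides t"
  then obtain a where a: "P q - P p = a *\<^sub>R (q - p)" using P unfolding parallel_def by blast
  have "fx e (P q - P p) = 0"
    using lorentzian(2)[OF assms(1,2,3)] side_verts[OF s] by (simp add: fx_diff)
  then have "a = 0" using generic[OF s] by (simp add: a fx_scaleR)
  then show "P p = P q" using a by simp
qed

section \<open>Paths from edge coefficients, and tile orientation\<close>

lemma convex_hull_3I:
  assumes "x = u *\<^sub>R a + v *\<^sub>R b + w *\<^sub>R c" "0 \<le> u" "0 \<le> v" "0 \<le> w" "u + v + w = 1"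
  shows "x \<in> convex hull {a, b, c :: point}"
  unfolding convex_hull_3 using assms by blast

text \<open>The sides on the counterclockwise walk from \<open>vmin\<close> to \<open>v\<close>: as
  seen from \<open>vmin\<close>, the vertices are ordered by angle, and a positive cross product
  means that \<open>p\<close> comes before \<open>v\<close>.\<close>

definition base_sides :: "point \<Rightarrow> (point \<times> point) set" where
  "base_sides v = {(p, q) \<in> ccw_sides t. v \<noteq> vmin \<and> (p = vmin \<or> cross2 (p - vmin) (v - vmin) > 0)}"

lemma side_wedge_vmin:
  assumes s: "(p, q) \<in> ccw_sides t" and "p \<noteq> vmin" "q \<noteq> vmin"
  shows "cross2 (p - vmin) (q - vmin) > 0"
proof -
  have "cross2 (q - p) (vmin - p) \<ge> 0" using side_ge[OF s] vmin verts_subset by blast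
  moreover have "cross2 (q - p) (vmin - p) \<noteq> 0" using side_vertex[OF s vmin(1)] assms by auto
  ultimately show ?thesis by (simp add: cross2_def algebra_simps)
qed

text \<open>A vertex in the open wedge spanned by \<open>p\<close> and \<open>q\<close> at \<open>vmin\<close>, or opposite to it, would make
  one of four vertices a convex combination of the other three.\<close>

lemma base_wedge:
  assumes s: "(p, q) \<in> ccw_sides t" and p: "p \<noteq> vmin" and q: "q \<noteq> vmin" and r: "r \<in> verts t" "r \<noteq> p" "r \<noteq> vmin"
  shows "cross2 (r - vmin) (q - vmin) > 0 \<longleftrightarrow> cross2 (r - vmin) (p - vmin) > 0"
proof (cases "r = q")
  case True
  then show ?thesis using side_wedge_vmin[OF s p q] cross2_swap[of "q - vmin" "p - vmin"] by (simp add: cross2_self)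
next
  case rq: False
  have ext: "x \<notin> convex hull {y, z, w}" if "x \<in> verts t" "{y, z, w} \<subseteq> verts t" "x \<notin> {y, z, w}" for x y z w
  proof
    assume x: "x \<in> convex hull {y, z, w}"
    have "convex hull {y, z, w} \<subseteq> t" by (rule hull_minimal) (use that verts_subset convex in auto)
    then have "x extreme_point_of convex hull {y, z, w}"
      using that(1) x by (auto simp: verts_def extreme_point_of_def)
    then show False using extreme_point_of_convex_hull that(3) by blast
  qed
  define p' where "p' = p - vmin"
  define q' where "q' = q - vmin"
  define r' where "r' = r - vmin"
  have D: "cross2 p' q' > 0" using side_wedge_vmin[OF s p q] by (simp add: p'_def q'_def)
  \<comment> \<open>In the coordinates \<open>l\<close> and \<open>m\<close> of \<open>r\<close>
    with respect to \<open>p\<close> and \<open>q\<close>, with origin \<open>vmin\<close>, the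
    claim reads: \<open>l > 0\<close> if and only if \<open>m < 0\<close>.\<close>
  define l where "l = cross2 r' q' / cross2 p' q'"
  define m where "m = cross2 p' r' / cross2 p' q'"
  have lm: "r' = l *\<^sub>R p' + m *\<^sub>R q'"
  proof -
    have "cross2 p' q' *\<^sub>R r' = cross2 p' q' *\<^sub>R (l *\<^sub>R p' + m *\<^sub>R q')"
      unfolding cross2_expand[of p' q' r'] using D by (simp add: l_def m_def scaleR_add_right)
    then show ?thesis using D by simp
  qed
  have r_eq: "r = vmin + l *\<^sub>R (p - vmin) + m *\<^sub>R (q - vmin)" using lm by (simp add: p'_def q'_def r'_def algebra_simps)
  have "0 \<le> cross2 (q - p) (r - p)" using side_ge[OF s] r verts_subset by blast
  also have "\<dots> = cross2 p' q' * (1 - l - m)"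
    unfolding r_eq p'_def q'_def by (simp add: cross2_def algebra_simps)
  finally have lm1: "l + m \<le> 1" using D by (simp add: zero_le_mult_iff)
  have vs: "p \<in> verts t" "q \<in> verts t" "vmin \<in> verts t" using side_verts[OF s] vmin by auto
  have c1: "cross2 r' q' > 0 \<longleftrightarrow> l > 0" using D by (simp add: l_def zero_less_divide_iff)
  have c2: "cross2 r' p' > 0 \<longleftrightarrow> m < 0" using D cross2_swap[of r' p'] by (simp add: m_def divide_less_0_iff)
  have "\<not> (l \<ge> 0 \<and> m \<ge> 0)"
  proof
    assume "l \<ge> 0 \<and> m \<ge> 0"
    moreover have "r = (1 - l - m) *\<^sub>R vmin + l *\<^sub>R p + m *\<^sub>R q" by (subst r_eq) (simp add: algebra_simps)
    ultimately have "r \<in> convex hull {vmin, p, q}"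
      using lm1 by (intro convex_hull_3I[of r "1 - l - m" _ l _ m]) auto
    then show False using ext[OF r(1), of vmin p q] vs r rq by auto
  qed
  moreover have "\<not> (l \<le> 0 \<and> m \<le> 0)"
  proof
    assume lm0: "l \<le> 0 \<and> m \<le> 0"
    define d where "d = 1 - l - m"
    have d: "d > 0" using lm0 by (simp add: d_def)
    have "d *\<^sub>R vmin = r + (- l) *\<^sub>R p + (- m) *\<^sub>R q" by (subst r_eq) (simp add: d_def algebra_simps)
    then have "(1 / d) *\<^sub>R (d *\<^sub>R vmin) = (1 / d) *\<^sub>R (r + (- l) *\<^sub>R p + (- m) *\<^sub>R q)" by simp
    then have "vmin = (1 / d) *\<^sub>R r + (- l / d) *\<^sub>R p + (- m / d) *\<^sub>R q"
      using d by (simp add: scaleR_add_right scaleR_diff_right)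
    moreover have "1 / d + (- l / d) + (- m / d) = 1"
    proof -
      have "1 / d + (- l / d) + (- m / d) = (1 - l - m) / d" by (simp add: diff_divide_distrib)
      then show ?thesis using d unfolding d_def[symmetric] by simp
    qed
    ultimately have "vmin \<in> convex hull {r, p, q}"
      using lm0 d by (intro convex_hull_3I[of vmin "1 / d" r "- l / d" p "- m / d" q]) (auto simp: divide_nonpos_pos)
    then show False using ext[OF vs(3), of r p q] vs r p q by auto
  qed
  ultimately show ?thesis unfolding p'_def[symmetric] q'_def[symmetric] r'_def[symmetric] c1 c2 by linarith
qed

text \<open>\<open>V_plus\<close> lives in the space of coefficients, while \<open>mform\<close>
  takes vertex maps. Adding up edge vectors from \<open>vmin\<close> gives a right inverse of
  \<open>edge_coeffs\<close> on \<open>path_space\<close>.\<close>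

definition path_of :: "(point \<times> point \<Rightarrow> real) \<Rightarrow> point \<Rightarrow> point" where
  "path_of a v = (\<Sum>(p, q)\<in>base_sides v. a (p, q) *\<^sub>R (q - p))"

lemma finite_base_sides: "finite (base_sides v)"
  by (rule finite_subset[OF _ finite_sides]) (auto simp: base_sides_def)

lemma path_of_side:
  assumes a: "a \<in> path_space t" and s: "(p, q) \<in> ccw_sides t"
  shows "path_of a q - path_of a p = a (p, q) *\<^sub>R (q - p)"
proof -
  have neq: "p \<noteq> q" by (rule side_neq[OF s])
  have b0: "base_sides vmin = {}" by (simp add: base_sides_def)
  show ?thesis
  proof (cases "q = vmin")
    case True
    \<comment> \<open>The walk to \<open>p\<close> omits only the side returning to
      \<open>vmin\<close>, and the closing condition of \<open>path_space\<close> accounts for that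
      one.\<close>
    have "base_sides p = ccw_sides t - {(p, q)}"
    proof -
      have "cross2 (x - vmin) (p - vmin) > 0" if "(x, y) \<in> ccw_sides t" "x \<noteq> vmin" "x \<noteq> p" for x y
      proof -
        have x: "x \<in> verts t" using side_verts that by blast
        have "cross2 (q - p) (x - p) \<ge> 0" using side_ge[OF s] x verts_subset by blast
        moreover have "cross2 (q - p) (x - p) \<noteq> 0" using side_vertex[OF s x] that True by auto
        ultimately show ?thesis by (simp add: True cross2_def algebra_simps)
      qed
      then have "(x, y) \<in> base_sides p \<longleftrightarrow> (x, y) \<in> ccw_sides t \<and> x \<noteq> p" for x y
        using neq True by (cases "x = p"; cases "x = vmin") (auto simp: base_sides_def cross2_self)
      moreover have "(x, y) \<in> ccw_sides t \<and> x \<noteq> p \<longleftrightarrow> (x, y) \<in> ccw_sides t - {(p, q)}" for x y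
        using out_unique s by blast
      ultimately show ?thesis unfolding set_eq_iff split_paired_All by blast
    qed
    then have "path_of a p = (\<Sum>(p, q)\<in>ccw_sides t. a (p, q) *\<^sub>R (q - p)) - a (p, q) *\<^sub>R (q - p)"
      unfolding path_of_def using finite_sides s by (simp add: sum_diff1)
    also have "(\<Sum>(p, q)\<in>ccw_sides t. a (p, q) *\<^sub>R (q - p)) = 0" using a by (simp add: path_space_def)
    finally show ?thesis by (simp add: path_of_def True b0)
  next
    case qb: False
    have "base_sides q = insert (p, q) (base_sides p) \<and> (p, q) \<notin> base_sides p"
    proof (cases "p = vmin")
      case True
      have "\<not> cross2 (x - vmin) (q - vmin) > 0" if "(x, y) \<in> ccw_sides t" for x y
        using side_ge[OF s, of x] side_verts[OF that] verts_subset cross2_swap[of "x - vmin"] True by auto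
      then have "(x, y) \<in> base_sides q \<longleftrightarrow> (x, y) \<in> ccw_sides t \<and> x = p" for x y
        unfolding base_sides_def using qb True by blast
      moreover have "(x, y) \<in> ccw_sides t \<and> x = p \<longleftrightarrow> (x, y) = (p, q)" for x y
        using out_unique s by blast
      ultimately have "base_sides q = {(p, q)}" unfolding set_eq_iff split_paired_All by blast
      then show ?thesis using True b0 by simp
    next
      case False
      have out: "(p, y) \<in> ccw_sides t \<Longrightarrow> y = q" for y using out_unique s by blast
      have notin: "(p, y) \<notin> base_sides p" for y using False by (simp add: base_sides_def cross2_self)
      have "(x, y) \<in> base_sides q \<longleftrightarrow> (x, y) \<in> insert (p, q) (base_sides p)" for x y
      proof (cases "x = p")
        case True
        have "(p, y) \<in> base_sides q \<longleftrightarrow> (p, y) \<in> ccw_sides t"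
          using side_wedge_vmin[OF s False qb] qb by (simp add: base_sides_def)
        also have "\<dots> \<longleftrightarrow> y = q" using out s by blast
        finally show ?thesis unfolding True using notin[of y] by simp
      next
        case xp: False
        show ?thesis
        proof (cases "(x, y) \<in> ccw_sides t \<and> x \<noteq> vmin")
          case True
          then show ?thesis
            using base_wedge[OF s False qb, of x] side_verts(1)[of x y] xp False qb by (simp add: base_sides_def)
        next
          case 2: False
          then show ?thesis using xp False qb by (auto simp: base_sides_def)
        qed
      qed
      then have "base_sides q = insert (p, q) (base_sides p)" unfolding set_eq_iff split_paired_All by blast
      then show ?thesis using notin by simp
    qed
    then show ?thesis unfolding path_of_def using finite_base_sides by simp
  qed
qed

lemma path_of_parallel: "a \<in> path_space t \<Longrightarrow> parallel t (path_of a)"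
  unfolding parallel_def using path_of_side by blast

lemma mform_cong_left:
  assumes "parallel t P" "parallel t P'" "parallel t Q"
    and "\<And>p q. (p, q) \<in> ccw_sides t \<Longrightarrow> P q - P p = P' q - P' p"
  shows "mform P Q = mform P' Q"
proof -
  have "mform Q P = mform Q P'" unfolding mform_mixed[OF assms(3)]
    by (rule arg_cong[of _ _ "\<lambda>x. x / 2"], rule sum.cong[OF refl]) (use assms(4) in auto)
  then show ?thesis by (simp add: mform_sym)
qed

text \<open>\<open>area_form\<close> evaluates an arbitrarily chosen path, but \<open>mform\<close>
  depends only on edge vectors; the two arguments are exchanged one at a time.\<close>

lemma area_form_eq:
  assumes P: "parallel t P" and a: "\<And>p q. (p, q) \<in> ccw_sides t \<Longrightarrow> P q - P p = a (p, q) *\<^sub>R (q - p)"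
  shows "area_form t a = mform P P"
proof -
  define P' where "P' = (SOME P. \<forall>(p, q)\<in>ccw_sides t. P q - P p = a (p, q) *\<^sub>R (q - p))"
  have P': "\<forall>(p, q)\<in>ccw_sides t. P' q - P' p = a (p, q) *\<^sub>R (q - p)"
    unfolding P'_def by (rule someI[of _ P]) (use a in auto)
  then have par: "parallel t P'" unfolding parallel_def by blast
  have "area_form t a = mform P' P'"
    unfolding area_form_def P'_def[symmetric] by (rule signed_area_eq[OF par])
  also have "\<dots> = mform P P'" by (rule mform_cong_left[OF par P par]) (use P' a in force)
  also have "\<dots> = mform P' P" by (rule mform_sym)
  also have "\<dots> = mform P P" by (rule mform_cong_left[OF par P P]) (use P' a in force)
  finally show ?thesis .
qed

lemma edge_coeffs_side:
  assumes P: "parallel t P" and s: "(p, q) \<in> ccw_sides t"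
  shows "P q - P p = edge_coeffs t P (p, q) *\<^sub>R (q - p)"
proof -
  obtain a where a: "P q - P p = a *\<^sub>R (q - p)" using assms unfolding parallel_def by blast
  have "(THE a. P q - P p = a *\<^sub>R (q - p)) = a"
    by (rule the_equality[where P = "\<lambda>a. P q - P p = a *\<^sub>R (q - p)", OF a]) (use a side_neq[OF s] in simp)
  then show ?thesis using s a by (simp add: edge_coeffs_def)
qed

lemma edge_coeffs_path_space:
  assumes P: "parallel t P"
  shows "edge_coeffs t P \<in> path_space t"
proof -
  have "(\<Sum>(p, q)\<in>ccw_sides t. edge_coeffs t P (p, q) *\<^sub>R (q - p)) = (\<Sum>(p, q)\<in>ccw_sides t. P q - P p)"
    by (rule sum.cong[OF refl]) (use edge_coeffs_side[OF P] in force)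
  also have "\<dots> = 0"
  proof -
    have "(\<Sum>(p, q)\<in>ccw_sides t. P q - P p) = (\<Sum>(p, q)\<in>ccw_sides t. P q) - (\<Sum>(p, q)\<in>ccw_sides t. P p)"
      by (simp add: sum_subtractf split_def)
    also have "\<dots> = (\<Sum>v\<in>verts t. P v) - (\<Sum>v\<in>verts t. P v)"
      using sum.reindex_bij_betw[OF bij_fst, of P] sum.reindex_bij_betw[OF bij_snd, of P]
      by (simp add: split_def)
    finally show ?thesis by simp
  qed
  finally show ?thesis by (simp add: path_space_def edge_coeffs_def)
qed

text \<open>Pairing with the tile is a continuous functional \<open>L\<close> of the coefficients.
  By \<open>lorentzian\<close> it has no zero on positive paths, so its sign is constant on
  connected sets. Conversely, if the pairing is positive, the straight segment from the tile (all
  coefficients 1) to \<open>P\<close> consists of positive paths, because all terms in the expansion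
  of the form are nonnegative and not all zero.\<close>

lemma V_plus_iff:
  assumes P: "parallel t P" and pos: "mform P P > 0"
  shows "edge_coeffs t P \<in> V_plus t \<longleftrightarrow> mform (\<lambda>v. v) P > 0"
proof
  define L where "L a = (\<Sum>s\<in>ccw_sides t. a s * cross2 (fst s) (snd s - fst s)) / 2" for a :: "point \<times> point \<Rightarrow> real"
  have L: "L a = mform (\<lambda>v. v) Q"
    if Q: "parallel t Q" "\<And>p q. (p, q) \<in> ccw_sides t \<Longrightarrow> Q q - Q p = a (p, q) *\<^sub>R (q - p)" for a Q
    unfolding L_def mform_cross[OF parallel_id Q(1), of 0]
    by (rule arg_cong[of _ _ "\<lambda>x. x / 2"], rule sum.cong[OF refl]) (use Q(2) in \<open>auto simp: cross2_scaleR_right\<close>)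
  have Lcont: "continuous_on S L" for S
    unfolding L_def[abs_def]
    by (intro continuous_on_divide continuous_on_sum continuous_on_mult continuous_on_eval continuous_on_const) auto
  assume "edge_coeffs t P \<in> V_plus t"
  then obtain a0 T where a0: "\<And>s. s \<in> ccw_sides t \<Longrightarrow> a0 s > 0"
    and T: "connected T" "T \<subseteq> positive_paths t" "a0 \<in> T" "edge_coeffs t P \<in> T"
    unfolding V_plus_def connected_component_def by blast
  have pp: "a \<in> path_space t" "area_form t a > 0" if "a \<in> T" for a
    using T that by (auto simp: positive_paths_def)
  have Lpath: "L a = mform (\<lambda>v. v) (path_of a)" if "a \<in> T" for a
    using L[OF path_of_parallel[OF pp(1)[OF that]] path_of_side[OF pp(1)[OF that]]] .
  have Lne: "L a \<noteq> 0" if "a \<in> T" for a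
  proof
    assume "L a = 0"
    then have "mform (path_of a) (path_of a) \<le> 0"
      using lorentzian(1)[OF path_of_parallel[OF pp(1)[OF that]]] Lpath[OF that] by simp
    then show False
      using pp(2)[OF that] area_form_eq[OF path_of_parallel path_of_side, OF pp(1)[OF that] pp(1)[OF that]] by simp
  qed
  have L0: "L a0 > 0"
    unfolding Lpath[OF T(3)]
    by (rule mform_id_pos[OF path_of_parallel[OF pp(1)[OF T(3)]]])
       (use path_of_side[OF pp(1)[OF T(3)]] a0 in blast)
  have "connected (L ` T)" by (rule connected_continuous_image[OF Lcont T(1)])
  moreover have "L a0 \<in> L ` T" "L (edge_coeffs t P) \<in> L ` T" "0 \<notin> L ` T" using T Lne by force+
  ultimately have "\<not> L (edge_coeffs t P) \<le> 0"
    using L0 connectedD_interval[of "L ` T" "L (edge_coeffs t P)" "L a0" 0] by auto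
  then show "mform (\<lambda>v. v) P > 0" using L[OF P edge_coeffs_side[OF P]] by simp
next
  assume m: "mform (\<lambda>v. v) P > 0"
  define a0 where "a0 = edge_coeffs t (\<lambda>v. v)"
  define a where "a = edge_coeffs t P"
  define c where "c s = (\<lambda>z. (1 - s) * a0 z + s * a z)" for s
  have one: "a0 z = 1" if z: "z \<in> ccw_sides t" for z
  proof -
    obtain p q where pq: "z = (p, q)" by (cases z)
    then have "a0 z *\<^sub>R (q - p) = 1 *\<^sub>R (q - p)"
      using edge_coeffs_side[OF parallel_id, of p q] z by (simp add: a0_def)
    then show ?thesis using side_neq[of p q] z pq unfolding scaleR_cancel_right by auto
  qed
  have c: "c s \<in> positive_paths t" if s: "0 \<le> s" "s \<le> 1" for s
  proof -
    define Q where "Q v = (1 - s) *\<^sub>R v + s *\<^sub>R P v" for v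
    have Q: "parallel t Q" using parallel_lincomb[OF parallel_id P, of "1 - s" s 0] by (simp add: Q_def[abs_def])
    have side: "Q q - Q p = c s (p, q) *\<^sub>R (q - p)" if z: "(p, q) \<in> ccw_sides t" for p q
    proof -
      have "Q q - Q p = (1 - s) *\<^sub>R (q - p) + s *\<^sub>R (P q - P p)" by (simp add: Q_def algebra_simps)
      then show ?thesis using edge_coeffs_side[OF P z] one[OF z]
        by (simp add: c_def a_def algebra_simps)
    qed
    have eq: "c s = edge_coeffs t Q"
    proof
      fix z show "c s z = edge_coeffs t Q z"
      proof (cases "z \<in> ccw_sides t")
        case True
        obtain p q where z: "z = (p, q)" by (cases z)
        have "c s (p, q) *\<^sub>R (q - p) = edge_coeffs t Q (p, q) *\<^sub>R (q - p)"
          using side[of p q] edge_coeffs_side[OF Q, of p q] True z by metis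
        moreover have "q - p \<noteq> 0" using side_neq[of p q] True z by auto
        ultimately show ?thesis unfolding scaleR_cancel_right z by blast
      next
        case False
        then show ?thesis by (simp add: c_def a_def a0_def edge_coeffs_def algebra_simps)
      qed
    qed
    have "area_form t (c s) = mform Q Q" by (rule area_form_eq[OF Q side])
    also have "mform Q Q = (1 - s) * mform (\<lambda>v. v) Q + s * mform P Q"
      using mform_lincomb[of "1 - s" "\<lambda>v. v" s P Q] by (simp add: Q_def[abs_def])
    also have "mform P Q = (1 - s) * mform (\<lambda>v. v) P + s * mform P P"
      using mform_lincomb[of "1 - s" "\<lambda>v. v" s P P] mform_sym[of P Q] by (simp add: Q_def[abs_def])
    also have "mform (\<lambda>v. v) Q = (1 - s) * mform (\<lambda>v. v) (\<lambda>v. v) + s * mform (\<lambda>v. v) P"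
      using mform_lincomb[of "1 - s" "\<lambda>v. v" s P "\<lambda>v. v"] mform_sym[of Q "\<lambda>v. v"] mform_sym[of P "\<lambda>v. v"]
      by (simp add: Q_def[abs_def])
    finally have "area_form t (c s) = (1 - s) * ((1 - s) * mform (\<lambda>v. v) (\<lambda>v. v) + s * mform (\<lambda>v. v) P) +
        s * ((1 - s) * mform (\<lambda>v. v) P + s * mform P P)" .
    also have "\<dots> > 0"
    proof (cases "s = 0")
      case True
      then show ?thesis using mform_id_id_pos by simp
    next
      case False
      then show ?thesis using s m pos mform_id_id_pos by (intro add_nonneg_pos mult_nonneg_nonneg mult_pos_pos add_nonneg_nonneg) auto
    qed
    finally show ?thesis using edge_coeffs_path_space[OF Q] eq by (simp add: positive_paths_def)
  qed
  have "connected (c ` {0..1})"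
  proof (rule connected_continuous_image)
    show "continuous_on {0..1} c" unfolding c_def[abs_def]
      by (rule continuous_on_coordinatewise_then_product)
         (intro continuous_on_add continuous_on_mult continuous_on_diff continuous_on_id continuous_on_const)
  qed simp
  moreover have "c 0 = a0" "c 1 = a" by (auto simp: c_def)
  ultimately have "connected_component (positive_paths t) a0 a"
    unfolding connected_component_def using c by (intro exI[of _ "c ` {0..1}"]) force
  then show "edge_coeffs t P \<in> V_plus t"
    unfolding V_plus_def a_def using one by (intro CollectI exI[of _ a0]) auto
qed

text \<open>The tile itself has orientation 1, so equality means membership in
  \<open>V_plus\<close>; the values -1 and 0 both count as different.\<close>

lemma tile_orientation_eq_iff:
  assumes P: "parallel t P" and pos: "mform P P > 0"
  shows "tile_orientation t P = tile_orientation t (\<lambda>v. v) \<longleftrightarrow> mform (\<lambda>v. v) P > 0"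
  using V_plus_iff[OF P pos] V_plus_iff[OF parallel_id mform_id_id_pos] mform_id_id_pos
  by (simp add: tile_orientation_def)

section \<open>The Lebesgue measure of a tile equals its signed area\<close>

lemma frontier_ray_unique:
  assumes c: "c \<in> interior t" and y: "y \<in> frontier t" "y' \<in> frontier t"
    and eq: "y' - c = k *\<^sub>R (y - c)" and k: "0 \<le> k"
  shows "y' = y"
proof -
  have yt: "y \<in> t" "y' \<in> t" "y \<notin> interior t" "y' \<notin> interior t"
    using y closed by (auto simp: frontier_def)
  have shrink: "z \<in> interior t" if x: "x \<in> t" and z: "z - c = l *\<^sub>R (x - c)" and l: "0 \<le> l" "l < 1" for x z l
  proof -
    have "x - (1 - l) *\<^sub>R (x - c) \<in> interior t"
      by (rule mem_interior_convex_shrink[OF convex c x]) (use l in auto)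
    moreover have "x - (1 - l) *\<^sub>R (x - c) = z" using z by (simp add: algebra_simps)
    ultimately show ?thesis by simp
  qed
  have "\<not> k < 1" using shrink[OF yt(1) eq k] yt(4) by blast
  moreover have "\<not> k > 1"
  proof
    assume "k > 1"
    then have "y - c = (1 / k) *\<^sub>R (y' - c)" unfolding eq by simp
    then show False using shrink[OF yt(2), of y "1 / k"] \<open>k > 1\<close> yt(3) by simp
  qed
  ultimately have "k = 1" by linarith
  then show ?thesis using eq by simp
qed

lemma fan_ray:
  assumes c: "c \<in> interior t" and s: "(p, q) \<in> ccw_sides t"
    and x: "x \<in> convex hull {c, p, q}" "x \<noteq> c"
  obtains y k where "y \<in> closed_segment p q" "0 < k" "x - c = k *\<^sub>R (y - c)"
proof -
  obtain u v w where uvw: "0 \<le> u" "0 \<le> v" "0 \<le> w" "u + v + w = 1" and xe: "x = u *\<^sub>R c + v *\<^sub>R p + w *\<^sub>R q"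
    using x(1) unfolding convex_hull_3 by blast
  define k where "k = v + w"
  have "k \<noteq> 0"
  proof
    assume "k = 0"
    then have "v = 0" "w = 0" using uvw by (auto simp: k_def)
    then show False using x(2) xe uvw by simp
  qed
  then have k: "k > 0" using uvw by (simp add: k_def)
  define y where "y = (v / k) *\<^sub>R p + (w / k) *\<^sub>R q"
  have vw: "v / k = 1 - w / k" using k by (simp add: k_def field_simps)
  have "y \<in> closed_segment p q" unfolding closed_segment_def y_def vw
    using uvw k by (intro CollectI exI[of _ "w / k"]) (auto simp: k_def)
  moreover have "k *\<^sub>R y = v *\<^sub>R p + w *\<^sub>R q" using k by (simp add: y_def scaleR_add_right)
  then have "x - c = k *\<^sub>R (y - c)"
  proof -
    assume ky: "k *\<^sub>R y = v *\<^sub>R p + w *\<^sub>R q"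
    have "u = 1 - k" using uvw by (simp add: k_def)
    then have "u *\<^sub>R c = c - k *\<^sub>R c" by (simp add: scaleR_left_diff_distrib)
    then show ?thesis unfolding xe scaleR_diff_right ky by simp
  qed
  ultimately show ?thesis using that k by blast
qed

text \<open>A ray from \<open>c\<close> meets the frontier once, so apart from \<open>c\<close> the
  two triangles meet only on rays through common points of their bases. Different sides share at
  most one point, which leaves part of a line.\<close>

lemma fan_inter_negligible:
  assumes c: "c \<in> interior t" and s: "(p, q) \<in> ccw_sides t" and s': "(p', q') \<in> ccw_sides t"
    and ne: "(p, q) \<noteq> (p', q')"
  shows "negligible (convex hull {c, p, q} \<inter> convex hull {c, p', q'})"
proof -
  have fr: "closed_segment p q \<subseteq> frontier t" "closed_segment p' q' \<subseteq> frontier t"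
    using s s' unfolding frontier_sides by blast+
  have cn: "c \<notin> frontier t" using c by (simp add: frontier_def)
  have common: "\<exists>y k. y \<in> closed_segment p q \<inter> closed_segment p' q' \<and> x - c = k *\<^sub>R (y - c)"
    if x: "x \<in> convex hull {c, p, q} \<inter> convex hull {c, p', q'}" "x \<noteq> c" for x
  proof -
    obtain y k where y: "y \<in> closed_segment p q" "0 < k" "x - c = k *\<^sub>R (y - c)"
      using fan_ray[OF c s, of x] x by blast
    obtain y' k' where y': "y' \<in> closed_segment p' q'" "0 < k'" "x - c = k' *\<^sub>R (y' - c)"
      using fan_ray[OF c s', of x] x by blast
    have "k' *\<^sub>R (y' - c) = k *\<^sub>R (y - c)" using y y' by simp
    then have "(1 / k') *\<^sub>R (k' *\<^sub>R (y' - c)) = (1 / k') *\<^sub>R (k *\<^sub>R (y - c))" by simp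
    then have "y' - c = (k / k') *\<^sub>R (y - c)" using y'(2) by simp
    then have "y' = y" using frontier_ray_unique[OF c, of y y' "k / k'"] y y' fr by auto
    then show ?thesis using y y' by blast
  qed
  show ?thesis
  proof (cases "closed_segment p q \<inter> closed_segment p' q' = {}")
    case True
    then have "convex hull {c, p, q} \<inter> convex hull {c, p', q'} \<subseteq> {c}" using common by blast
    then show ?thesis using negligible_subset negligible_sing by blast
  next
    case False
    then obtain o' where o': "o' \<in> closed_segment p q" "o' \<in> closed_segment p' q'" by blast
    have uniq: "y = o'" if "y \<in> closed_segment p q \<inter> closed_segment p' q'" for y
      using side_eqI[OF s s' _ _ o'] that ne by auto
    have oc: "o' \<noteq> c" using o' fr cn by blast
    have "convex hull {c, p, q} \<inter> convex hull {c, p', q'} \<subseteq> {x. perp (o' - c) \<bullet> x = perp (o' - c) \<bullet> c}"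
    proof
      fix x assume x: "x \<in> convex hull {c, p, q} \<inter> convex hull {c, p', q'}"
      obtain k where "x - c = k *\<^sub>R (o' - c)"
        using common[OF x] uniq by (metis eq_iff_diff_eq_0 scaleR_zero_left)
      then have "cross2 (o' - c) (x - c) = 0" by (simp add: cross2_linear)
      then show "x \<in> {x. perp (o' - c) \<bullet> x = perp (o' - c) \<bullet> c}" by (simp add: inner_perp cross2_linear)
    qed
    moreover have "perp (o' - c) \<noteq> 0" using oc by (auto simp: perp_def point_eq_iff)
    ultimately show ?thesis using negligible_hyperplane negligible_subset by blast
  qed
qed

lemma fan_Union:
  assumes c: "c \<in> interior t"
  shows "(\<Union>s\<in>ccw_sides t. convex hull {c, fst s, snd s}) = t"
proof
  have "convex hull {c, p, q} \<subseteq> t" if "(p, q) \<in> ccw_sides t" for p q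
    by (rule hull_minimal) (use that side_verts verts_subset c interior_subset convex in blast)+
  then show "(\<Union>s\<in>ccw_sides t. convex hull {c, fst s, snd s}) \<subseteq> t"
    by (intro UN_least) (metis prod.collapse)
  show "t \<subseteq> (\<Union>s\<in>ccw_sides t. convex hull {c, fst s, snd s})"
  proof
    fix x assume x: "x \<in> t"
    have "\<exists>y d. y \<in> frontier t \<and> d \<ge> 1 \<and> y = c + d *\<^sub>R (x - c)" if "x \<noteq> c"
    proof -
      obtain d where d: "0 < d" "c + d *\<^sub>R (x - c) \<in> frontier t"
        by (rule ray_to_frontier[of t c "x - c"]) (use compact compact_imp_bounded c \<open>x \<noteq> c\<close> in auto)
      have "\<not> d < 1"
      proof
        assume "d < 1"
        have "x - (1 - d) *\<^sub>R (x - c) \<in> interior t"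
          by (rule mem_interior_convex_shrink[OF convex c x]) (use d \<open>d < 1\<close> in auto)
        moreover have "x - (1 - d) *\<^sub>R (x - c) = c + d *\<^sub>R (x - c)" by (simp add: algebra_simps)
        ultimately show False using d by (simp add: frontier_def)
      qed
      then show ?thesis using d by (intro exI[of _ "c + d *\<^sub>R (x - c)"] exI[of _ d]) auto
    qed
    moreover have "\<exists>y. y \<in> frontier t" using frontier_sides verts_nonempty exists_out by fastforce
    ultimately obtain y where y: "y \<in> frontier t" "x \<in> closed_segment c y"
    proof (cases "x = c")
      case True
      then show ?thesis using that \<open>\<exists>y. y \<in> frontier t\<close> by auto
    next
      case False
      then obtain y d where yd: "y \<in> frontier t" "d \<ge> 1" "y = c + d *\<^sub>R (x - c)"
        using \<open>x \<noteq> c \<Longrightarrow> \<exists>y d. y \<in> frontier t \<and> d \<ge> 1 \<and> y = c + d *\<^sub>R (x - c)\<close> by blast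
      have "(1 / d) *\<^sub>R (y - c) = x - c" using yd(2,3) by simp
      then have "x = (1 - 1 / d) *\<^sub>R c + (1 / d) *\<^sub>R y" by (simp add: algebra_simps)
      then have "x \<in> closed_segment c y" unfolding closed_segment_def using yd(2)
        by (intro CollectI exI[of _ "1 / d"]) auto
      then show ?thesis using that yd by blast
    qed
    obtain p q where pq: "(p, q) \<in> ccw_sides t" "y \<in> closed_segment p q" using frontier_side[OF y(1)] .
    have "closed_segment p q \<subseteq> convex hull {c, p, q}"
      unfolding segment_convex_hull by (rule hull_mono) auto
    moreover have "c \<in> convex hull {c, p, q}" by (simp add: hull_inc)
    ultimately have "closed_segment c y \<subseteq> convex hull {c, p, q}"
      using pq by (meson closed_segment_subset convex_convex_hull subsetD)
    then show "x \<in> (\<Union>s\<in>ccw_sides t. convex hull {c, fst s, snd s})" using pq y by force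
  qed
qed

text \<open>Fan triangulation from an interior point. It links the normalization of the areas, given
  through the measure of \<open>R\<close>, to the signed areas of the tiles.\<close>

lemma measure_eq: "measure lebesgue t = signed_area t (\<lambda>v. v)"
proof -
  obtain c where c: "c \<in> interior t" using interior_nonempty by blast
  have "measure lebesgue t = measure lebesgue (\<Union>s\<in>ccw_sides t. convex hull {c, fst s, snd s})"
    unfolding fan_Union[OF c] ..
  also have "\<dots> = (\<Sum>s\<in>ccw_sides t. measure lebesgue (convex hull {c, fst s, snd s}))"
  proof (rule measure_negligible_finite_Union_image[OF finite_sides])
    fix s show "convex hull {c, fst s, snd s} \<in> lmeasurable"
      by (intro lmeasurable_compact finite_imp_compact_convex_hull) auto
  next
    show "pairwise (\<lambda>x y. negligible (convex hull {c, fst x, snd x} \<inter> convex hull {c, fst y, snd y})) (ccw_sides t)"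
    proof (rule pairwiseI)
      fix x y assume "x \<in> ccw_sides t" "y \<in> ccw_sides t" "x \<noteq> y"
      then show "negligible (convex hull {c, fst x, snd x} \<inter> convex hull {c, fst y, snd y})"
        using fan_inter_negligible[OF c, of "fst x" "snd x" "fst y" "snd y"] by simp
    qed
  qed
  also have "\<dots> = (\<Sum>(p, q)\<in>ccw_sides t. cross2 (p - c) (q - p) / 2)"
  proof (rule sum.cong[OF refl], clarify)
    fix p q assume s: "(p, q) \<in> ccw_sides t"
    have "measure lebesgue (convex hull {c, p, q}) = measure lborel (convex hull {c, p, q})"
      by (rule measure_completion) (auto intro!: borel_compact finite_imp_compact_convex_hull)
    also have "\<dots> = \<bar>cross2 (q - p) (c - p)\<bar> / 2"
      unfolding content_triangle by (simp add: cross2_def algebra_simps abs_minus_commute)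
    also have "\<dots> = cross2 (q - p) (c - p) / 2" using side_interior[OF s c] by simp
    also have "cross2 (q - p) (c - p) = cross2 (p - c) (q - p)" by (simp add: cross2_def algebra_simps)
    finally show "measure lebesgue (convex hull {c, fst (p, q), snd (p, q)}) = cross2 (p - c) (q - p) / 2" by simp
  qed
  also have "\<dots> = signed_area t (\<lambda>v. v)"
    unfolding signed_area_eq[OF parallel_id] mform_cross[OF parallel_id parallel_id, of c] sum_divide_distrib
    by (simp add: split_def)
  finally show ?thesis .
qed

end

section \<open>Segments and tiles\<close>

lemma line_param:
  fixes x y z :: point
  assumes "x \<in> closed_segment a b" "y \<in> closed_segment a b" "z \<in> closed_segment a b" "x \<noteq> y"
  obtains r where "z = x + r *\<^sub>R (y - x)"
proof -
  obtain \<alpha> where a: "x = (1 - \<alpha>) *\<^sub>R a + \<alpha> *\<^sub>R b" using assms by (auto simp: in_segment)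
  obtain \<beta> where b: "y = (1 - \<beta>) *\<^sub>R a + \<beta> *\<^sub>R b" using assms by (auto simp: in_segment)
  obtain \<gamma> where c: "z = (1 - \<gamma>) *\<^sub>R a + \<gamma> *\<^sub>R b" using assms by (auto simp: in_segment)
  have ne: "\<beta> - \<alpha> \<noteq> 0" using assms(4) a b by auto
  have yx: "y - x = (\<beta> - \<alpha>) *\<^sub>R (b - a)" unfolding a b by (simp add: algebra_simps)
  have zx: "z - x = (\<gamma> - \<alpha>) *\<^sub>R (b - a)" unfolding a c by (simp add: algebra_simps)
  have "z - x = ((\<gamma> - \<alpha>) / (\<beta> - \<alpha>)) *\<^sub>R (y - x)" unfolding zx yx using ne by simp
  then have "z = x + ((\<gamma> - \<alpha>) / (\<beta> - \<alpha>)) *\<^sub>R (y - x)" by (metis add.commute diff_add_cancel)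
  then show ?thesis by (rule that)
qed

lemma segment_affine_hull:
  fixes x y :: point
  assumes "x \<in> closed_segment a b" "y \<in> closed_segment a b" "x \<noteq> y"
  shows "closed_segment a b \<subseteq> affine hull {x, y}"
  unfolding affine_hull_2_alt using line_param[OF assms(1,2) _ assms(3)] by blast

lemma collinear_affine_hull_2: "collinear (affine hull {x, y :: point})"
  using collinear_affine_hull by blast

lemma segment_extreme_direction:
  fixes x y v :: point
  assumes "v extreme_point_of closed_segment a b" "x \<in> closed_segment a b" "y \<in> closed_segment a b" "x \<noteq> v" "y \<noteq> v"
  obtains k where "k > 0" "y - v = k *\<^sub>R (x - v)"
proof -
  obtain z where z: "closed_segment a b = closed_segment v z"
    using assms(1) by (auto simp: extreme_point_of_segment closed_segment_commute)
  obtain r where r: "0 \<le> r" "x = (1 - r) *\<^sub>R v + r *\<^sub>R z" using assms(2) unfolding z in_segment by blast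
  obtain s where s: "0 \<le> s" "y = (1 - s) *\<^sub>R v + s *\<^sub>R z" using assms(3) unfolding z in_segment by blast
  have r0: "r > 0" using r assms(4) by (cases "r = 0") auto
  have s0: "s > 0" using s assms(5) by (cases "s = 0") auto
  have "x - v = r *\<^sub>R (z - v)" "y - v = s *\<^sub>R (z - v)" using r s by (simp_all add: algebra_simps)
  then have "y - v = (s / r) *\<^sub>R (x - v)" using r0 by simp
  then show ?thesis using that[of "s / r"] r0 s0 by simp
qed

lemma segment_extend:
  fixes x v :: point
  assumes "v \<in> closed_segment a b" "\<not> v extreme_point_of closed_segment a b" "x \<in> closed_segment a b" "x \<noteq> v"
  obtains k where "k > 0" "v - k *\<^sub>R (x - v) \<in> closed_segment a b"
proof -
  obtain \<alpha> where a: "0 \<le> \<alpha>" "\<alpha> \<le> 1" "v = (1 - \<alpha>) *\<^sub>R a + \<alpha> *\<^sub>R b" using assms(1) by (auto simp: in_segment)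
  have a01: "0 < \<alpha>" "\<alpha> < 1"
    using assms(2) a by (cases "\<alpha> = 0"; cases "\<alpha> = 1"; simp add: extreme_point_of_segment)+
  obtain \<beta> where b: "x = (1 - \<beta>) *\<^sub>R a + \<beta> *\<^sub>R b" using assms(3) by (auto simp: in_segment)
  have xv: "x - v = (\<beta> - \<alpha>) *\<^sub>R (b - a)" unfolding a(3) b by (simp add: algebra_simps)
  then have ne: "\<beta> \<noteq> \<alpha>" using assms(4) by auto
  show ?thesis
  proof (cases "\<beta> > \<alpha>")
    case True
    have "v - (\<alpha> / (\<beta> - \<alpha>)) *\<^sub>R (x - v) = v - \<alpha> *\<^sub>R (b - a)" unfolding xv using True by simp
    also have "\<dots> = a" unfolding a(3) by (simp add: algebra_simps)
    finally show ?thesis using that[of "\<alpha> / (\<beta> - \<alpha>)"] a01 True by simp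
  next
    case False
    have "(1 - \<alpha>) / (\<alpha> - \<beta>) * (\<beta> - \<alpha>) = - (1 - \<alpha>)" using False ne by (simp add: field_simps)
    then have "((1 - \<alpha>) / (\<alpha> - \<beta>)) *\<^sub>R (x - v) = (- (1 - \<alpha>)) *\<^sub>R (b - a)"
      unfolding xv scaleR_scaleR by simp
    then have "v - ((1 - \<alpha>) / (\<alpha> - \<beta>)) *\<^sub>R (x - v) = v + (1 - \<alpha>) *\<^sub>R (b - a)"
      by (simp only: scaleR_minus_left diff_minus_eq_add)
    also have "\<dots> = b" unfolding a(3) by (simp add: algebra_simps)
    finally show ?thesis using that[of "(1 - \<alpha>) / (\<alpha> - \<beta>)"] a01 False ne by simp
  qed
qed

section \<open>Maximal segments of a tiling and the tiles along them\<close>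

locale tiling =
  fixes R :: "point set" and T :: "point set set"
  assumes R: "convex_polygon R" and T: "convex_tiling R T"

sublocale tiling \<subseteq> R: polygon R
  by unfold_locales (rule R)

context tiling
begin

lemma tile: "w \<in> T \<Longrightarrow> polygon w"
  using T by (simp add: convex_tiling_def polygon_def)

lemma finite_T: "finite T" and Union_T: "\<Union>T = R"
  using T by (simp_all add: convex_tiling_def)

lemma tile_subset: "w \<in> T \<Longrightarrow> w \<subseteq> R"
  using Union_T by blast

lemma interior_disjoint:
  assumes "w \<in> T" "w' \<in> T" "w \<noteq> w'" shows "interior w \<inter> w' = {}"
proof -
  have "interior w \<inter> interior w' = {}" using T assms by (auto simp: convex_tiling_def pairwise_def)
  then have "interior w \<inter> closure (interior w') = {}" using open_Int_closure_eq_empty[of "interior w"] by simp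
  then show ?thesis using polygon.closure_interior[OF tile[OF assms(2)]] by simp
qed

lemma skeleton_interior: "w \<in> T \<Longrightarrow> x \<in> interior w \<Longrightarrow> x \<notin> skeleton T"
proof
  assume w: "w \<in> T" and x: "x \<in> interior w" "x \<in> skeleton T"
  then obtain w' where w': "w' \<in> T" "x \<in> frontier w'" by (auto simp: skeleton_def)
  then have "x \<in> w'" using polygon.closed[OF tile[OF w'(1)]] by (auto simp: frontier_def)
  moreover have "w \<noteq> w'" using x w' by (auto simp: frontier_def)
  ultimately show False using interior_disjoint[OF w w'(1)] x by blast
qed

lemma closed_skeleton: "closed (skeleton T)"
  unfolding skeleton_def using finite_T by (intro closed_UN) auto

lemma skeleton_subset: "skeleton T \<subseteq> R"
  unfolding skeleton_def using tile_subset polygon.closed[OF tile] by (fastforce simp: frontier_def)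

lemma compact_skeleton: "compact (skeleton T)"
  using closed_skeleton skeleton_subset R.compact by (metis compact_Int_closed inf.absorb_iff2)

lemma frontier_R_subset: "frontier R \<subseteq> skeleton T"
proof
  fix x assume x: "x \<in> frontier R"
  then have "x \<in> R" using R.closed by (auto simp: frontier_def)
  then obtain w where w: "w \<in> T" "x \<in> w" using Union_T by blast
  have "x \<notin> interior w" using x interior_mono[OF tile_subset[OF w(1)]] by (auto simp: frontier_def)
  then have "x \<in> frontier w" using w closure_subset by (auto simp: frontier_def)
  then show "x \<in> skeleton T" using w by (auto simp: skeleton_def)
qed

lemma segmentE:
  assumes "b \<in> segments T"
  obtains x y where "x \<noteq> y" "b = closed_segment x y"
  using assms by (auto simp: segments_def is_segment_def)

lemma segment_skeleton: "b \<in> segments T \<Longrightarrow> b \<subseteq> skeleton T"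
  by (simp add: segments_def)

lemma segment_maximal: "b \<in> segments T \<Longrightarrow> is_segment b' \<Longrightarrow> b \<subseteq> b' \<Longrightarrow> b' \<subseteq> skeleton T \<Longrightarrow> b' = b"
  by (simp add: segments_def)

lemma segment_subset_R: "b \<in> segments T \<Longrightarrow> b \<subseteq> R"
  using segment_skeleton skeleton_subset by blast

lemma compact_connected_segment:
  fixes S :: "point set"
  assumes "compact S" "connected S" "S \<subseteq> affine hull {x, y}" "u \<in> S" "v \<in> S" "u \<noteq> v"
  shows "is_segment S"
proof -
  have "collinear S" using assms(3) collinear_affine_hull_2 collinear_subset by blast
  then obtain a b where ab: "S = closed_segment a b"
    using compact_convex_collinear_segment_alt[of S] assms by blast
  then have "a \<noteq> b" using assms by auto
  then show ?thesis using ab by (auto simp: is_segment_def)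
qed

text \<open>Segments with two common points are collinear and overlap, so their union is again a
  segment in the skeleton, and maximality makes both equal to it.\<close>

lemma segment_eqI:
  assumes b: "b \<in> segments T" "b' \<in> segments T" and xy: "x \<in> b" "x \<in> b'" "y \<in> b" "y \<in> b'" "x \<noteq> y"
  shows "b = b'"
proof -
  obtain p q where pq: "b = closed_segment p q" using segmentE[OF b(1)] by blast
  obtain p' q' where pq': "b' = closed_segment p' q'" using segmentE[OF b(2)] by blast
  have line: "b \<subseteq> affine hull {x, y}" "b' \<subseteq> affine hull {x, y}"
    using segment_affine_hull xy unfolding pq pq' by blast+
  have "is_segment (b \<union> b')"
  proof (rule compact_connected_segment)
    show "compact (b \<union> b')" unfolding pq pq' by (intro compact_Un compact_segment)
    show "connected (b \<union> b')" using connected_Un[of b b'] xy unfolding pq pq' by blast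
    show "b \<union> b' \<subseteq> affine hull {x, y}" using line by blast
  qed (use xy in auto)
  then have "b \<union> b' = b" "b \<union> b' = b'" using b segment_maximal segment_skeleton by (meson Un_least Un_upper1 Un_upper2)+
  then show ?thesis by simp
qed

text \<open>The maximal segment is the connected component of the skeleton intersected with the
  line; compactness of the skeleton makes this component a segment.\<close>

lemma segment_exists:
  assumes "x \<noteq> y" "closed_segment x y \<subseteq> skeleton T"
  obtains b where "b \<in> segments T" "closed_segment x y \<subseteq> b"
proof -
  define A where "A = skeleton T \<inter> affine hull {x, y}"
  define S where "S = connected_component_set A x"
  have cA: "compact A" unfolding A_def by (rule compact_Int_closed[OF compact_skeleton closed_affine_hull])
  have xA: "closed_segment x y \<subseteq> A" using assms segment_affine_hull[of x x y y] by (auto simp: A_def)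
  have sub: "closed_segment x y \<subseteq> S"
    unfolding S_def by (rule connected_component_maximal) (use xA in auto)
  have SA: "S \<subseteq> A" unfolding S_def by (rule connected_component_subset)
  have "compact S"
    using closed_connected_component[OF compact_imp_closed[OF cA], of x] cA SA
    by (metis S_def compact_Int_closed inf.absorb_iff2)
  then have seg: "is_segment S"
    by (rule compact_connected_segment[of _ x y x y]) (use sub SA assms in \<open>auto simp: S_def A_def\<close>)
  have "S \<in> segments T"
  proof -
    have "b' = S" if b': "is_segment b'" "S \<subseteq> b'" "b' \<subseteq> skeleton T" for b'
    proof
      obtain u v where uv: "b' = closed_segment u v" using b'(1) by (auto simp: is_segment_def)
      have "b' \<subseteq> affine hull {x, y}" using segment_affine_hull[of x u v y] sub b' assms uv by auto
      then show "b' \<subseteq> S" unfolding S_def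
        by (intro connected_component_maximal) (use b' sub uv in \<open>auto simp: A_def\<close>)
    qed (rule b'(2))
    then show ?thesis using seg SA by (auto simp: segments_def A_def)
  qed
  then show ?thesis using that sub by blast
qed

lemma tile_side_skeleton:
  assumes "w \<in> T" "(p, q) \<in> ccw_sides w"
  shows "closed_segment p q \<subseteq> skeleton T"
  using polygon.frontier_sides[OF tile[OF assms(1)]] assms by (auto simp: skeleton_def)

lemma tile_side_segment:
  assumes w: "w \<in> T" and s: "(p, q) \<in> ccw_sides w"
  obtains b where "b \<in> segments T" "closed_segment p q \<subseteq> b"
  using segment_exists[OF polygon.side_neq[OF tile[OF w] s] tile_side_skeleton[OF w s]] by blast

lemma R_side_segment:
  assumes s: "(P, Q) \<in> ccw_sides R"
  shows "closed_segment P Q \<in> boundary_segments R T"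
proof -
  have fr: "closed_segment P Q \<subseteq> frontier R" using s by (auto simp: R.frontier_sides)
  then obtain b where b: "b \<in> segments T" "closed_segment P Q \<subseteq> b"
    using segment_exists[OF R.side_neq[OF s]] frontier_R_subset by blast
  obtain u v where uv: "b = closed_segment u v" using segmentE[OF b(1)] by blast
  have "b \<subseteq> closed_segment P Q"
  proof
    fix z assume z: "z \<in> b"
    obtain r where "z = P + r *\<^sub>R (Q - P)"
      using line_param[of P u v Q z] b uv z R.side_neq[OF s] by auto
    then have "cross2 (Q - P) (z - P) = 0" by (simp add: cross2_linear)
    then show "z \<in> closed_segment P Q" using R.side_line[OF s] segment_subset_R[OF b(1)] z by blast
  qed
  then show ?thesis using b fr by (auto simp: boundary_segments_def)
qed

lemma boundary_if_meets:
  assumes b: "b \<in> segments T" and m: "m \<in> frontier R" "m \<in> open_segment x y" and xy: "x \<in> b" "y \<in> b"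
  shows "\<exists>(P, Q)\<in>ccw_sides R. b = closed_segment P Q"
proof -
  obtain P Q where s: "(P, Q) \<in> ccw_sides R" "closed_segment x y \<subseteq> closed_segment P Q"
    using R.segment_in_side[OF m] xy segment_subset_R[OF b] by blast
  have "x \<noteq> y" using m by auto
  then have "b = closed_segment P Q"
    using segment_eqI[OF b, of "closed_segment P Q" x y] R_side_segment[OF s(1)] s(2) xy
    by (auto simp: boundary_segments_def)
  then show ?thesis using s by blast
qed

lemma boundary_segmentE:
  assumes b: "b \<in> boundary_segments R T"
  obtains P Q where "(P, Q) \<in> ccw_sides R" "b = closed_segment P Q"
proof -
  obtain x y where xy: "x \<noteq> y" "b = closed_segment x y" "b \<in> segments T"
    using b segmentE by (metis (no_types, lifting) boundary_segments_def mem_Collect_eq)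
  obtain m where m: "m \<in> open_segment x y" using xy open_segment_eq_empty by blast
  then have "m \<in> frontier R" using b xy open_closed_segment by (auto simp: boundary_segments_def)
  then show ?thesis using boundary_if_meets[OF xy(3) _ m] xy that by auto
qed

lemma interior_segment_midpoint:
  assumes b: "b \<in> interior_segments R T" and m: "m \<in> open_segment x y" and xy: "x \<in> b" "y \<in> b"
  shows "m \<in> interior R"
proof (rule ccontr)
  have bT: "b \<in> segments T" using b by (simp add: interior_segments_def)
  obtain u v where uv: "b = closed_segment u v" using segmentE[OF bT] by blast
  have "m \<in> b" using m xy unfolding uv by (meson closed_segment_subset convex_closed_segment open_closed_segment subsetD)
  then have "m \<in> R" using segment_subset_R[OF bT] by blast
  moreover assume "m \<notin> interior R"
  ultimately have "m \<in> frontier R" using closure_subset by (auto simp: frontier_def)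
  then obtain P Q where "(P, Q) \<in> ccw_sides R" "b = closed_segment P Q"
    using boundary_if_meets[OF bT _ m xy] by blast
  then show False using R_side_segment b by (auto simp: interior_segments_def)
qed

text \<open>The midpoint lies in the interior of \<open>R\<close>, so \<open>R\<close> extends to
  both sides of it. This provides the probe direction for \<open>tile_along_segment\<close> on
  either side of the segment.\<close>

lemma interior_segment_side:
  assumes b: "b \<in> interior_segments R T" and xy: "x \<in> b" "y \<in> b" "x \<noteq> y"
  obtains r where "r > 0" "x + (1/2) *\<^sub>R (y - x) \<in> b" "x + (1/2) *\<^sub>R (y - x) + r *\<^sub>R n \<in> R"
proof -
  define m where "m = x + (1/2) *\<^sub>R (y - x)"
  have mo: "m \<in> open_segment x y" unfolding in_segment m_def
    using xy by (intro conjI exI[of _ "1/2"]) (simp_all add: point_eq_iff field_simps)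
  have mR: "m \<in> interior R" by (rule interior_segment_midpoint[OF b mo xy(1,2)])
  have "((\<lambda>r. m + r *\<^sub>R n) \<longlongrightarrow> m + 0 *\<^sub>R n) (at_right 0)" by (intro tendsto_intros)
  then have "\<forall>\<^sub>F r in at_right 0. m + r *\<^sub>R n \<in> interior R"
    using topological_tendstoD[of _ _ _ "interior R"] mR by fastforce
  then have "\<forall>\<^sub>F r in at_right 0. m + r *\<^sub>R n \<in> interior R \<and> 0 < r"
    using eventually_at_right_less[of 0] by eventually_elim auto
  then obtain r where r: "m + r *\<^sub>R n \<in> interior R" "0 < r"
    using eventually_happens'[OF trivial_limit_at_right_real] by blast
  obtain u v where uv: "b = closed_segment u v"
    using b segmentE by (metis Diff_iff interior_segments_def)
  have "m \<in> b"
    using mo xy unfolding uv by (meson closed_segment_subset convex_closed_segment open_closed_segment subsetD)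
  then show ?thesis using that[OF r(2)] r(1) interior_subset by (auto simp: m_def)
qed

text \<open>The tile is found by approaching \<open>c\<close> along points that are tangent to \<open>b\<close> in the
  direction \<open>d\<close> and lie on the side of \<open>n\<close>: some tile contains infinitely many of them.\<close>

lemma tile_along_segment:
  assumes b: "b \<in> segments T" and c: "c \<in> b" "c + d \<in> b" and n: "c + d + n \<in> R" "cross2 d n \<noteq> 0"
  obtains w p q \<delta> where "w \<in> T" "(p, q) \<in> ccw_sides w" "closed_segment p q \<subseteq> b"
    "0 < \<delta>" "c \<in> closed_segment p q" "c + \<delta> *\<^sub>R d \<in> closed_segment p q" "cross2 (q - p) n > 0"
proof -
  have d0: "d \<noteq> 0" using n(2) by (auto simp: cross2_linear)
  define h where "h k = 1 / real (Suc k)" for k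
  have h: "0 < h k" "h k \<le> 1" for k by (auto simp: h_def)
  \<comment> \<open>The step along \<open>d\<close> is of first order and the step along
    \<open>n\<close> of second order, so a side constraint active at \<open>c\<close> tests
    \<open>d\<close> before \<open>n\<close>.\<close>
  define x where "x k = c + h k *\<^sub>R d + (h k * h k) *\<^sub>R n" for k
  have cR: "c \<in> R" "c + d \<in> R" using c segment_subset_R[OF b] by blast+
  have xR: "x k \<in> R" for k
  proof -
    have "(1 - h k) *\<^sub>R (c + d) + h k *\<^sub>R (c + d + n) \<in> R"
      by (rule convexD[OF R.convex cR(2) n(1)]) (use h in \<open>auto simp: less_imp_le\<close>)
    then have "(1 - h k) *\<^sub>R c + h k *\<^sub>R ((1 - h k) *\<^sub>R (c + d) + h k *\<^sub>R (c + d + n)) \<in> R"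
      by (intro convexD[OF R.convex cR(1)]) (use h in \<open>auto simp: less_imp_le\<close>)
    moreover have "(1 - h k) *\<^sub>R c + h k *\<^sub>R ((1 - h k) *\<^sub>R (c + d) + h k *\<^sub>R (c + d + n)) = x k"
      by (simp add: x_def algebra_simps)
    ultimately show ?thesis by simp
  qed
  have "\<exists>w\<in>T. infinite {k. x k \<in> w}"
  proof (rule ccontr)
    assume "\<not> ?thesis"
    then have "finite (\<Union>w\<in>T. {k. x k \<in> w})" using finite_T by blast
    moreover have "(\<Union>w\<in>T. {k. x k \<in> w}) = UNIV" using xR Union_T by blast
    ultimately show False by simp
  qed
  then obtain w where w: "w \<in> T" and inf: "infinite {k. x k \<in> w}" by blast
  interpret w: polygon w by (rule tile[OF w])
  have freq: "\<exists>k. P k \<and> x k \<in> w" if "\<forall>\<^sub>F k in sequentially. P k" for P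
    using inf that unfolding infinite_nat_iff_unbounded_le eventually_sequentially by (metis mem_Collect_eq)
  have hlim: "h \<longlonglongrightarrow> 0" unfolding h_def using LIMSEQ_inverse_real_of_nat by (simp add: inverse_eq_divide)
  have "x \<longlonglongrightarrow> c + 0 *\<^sub>R d + (0 * 0) *\<^sub>R n" unfolding x_def[abs_def] by (intro tendsto_intros hlim)
  then have xlim: "x \<longlonglongrightarrow> c" by simp
  have cw: "c \<in> w"
  proof (rule ccontr)
    assume "c \<notin> w"
    then have "\<forall>\<^sub>F k in sequentially. x k \<in> - w"
      using topological_tendstoD[OF xlim, of "- w"] w.closed by (simp add: open_Compl)
    then show False using freq by blast
  qed
  have cross_x: "cross2 (q - p) (x k - p) = cross2 (q - p) (c - p) + h k * (cross2 (q - p) d + h k * cross2 (q - p) n)" for p q k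
    by (simp add: x_def cross2_def algebra_simps)
  have ev: "\<forall>\<^sub>F r in at_right 0. 0 \<le> cross2 (snd z - fst z) (c + r *\<^sub>R d - fst z)" if z: "z \<in> ccw_sides w" for z
  proof -
    obtain p q where pq: "z = (p, q)" by (cases z)
    have s: "(p, q) \<in> ccw_sides w" using z pq by simp
    show ?thesis
    proof (cases "cross2 (q - p) (c - p) = 0")
      case True
      \<comment> \<open>A negative leading term would expel all late points \<open>x k\<close> from
        \<open>w\<close>, although \<open>w\<close> contains infinitely many of them.\<close>
      have "cross2 (q - p) d \<ge> 0"
      proof (rule ccontr)
        assume "\<not> ?thesis"
        then have neg: "cross2 (q - p) d < 0" by simp
        have "(\<lambda>k. cross2 (q - p) d + h k * cross2 (q - p) n) \<longlonglongrightarrow> cross2 (q - p) d + 0 * cross2 (q - p) n"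
          by (intro tendsto_intros hlim)
        then have "\<forall>\<^sub>F k in sequentially. cross2 (q - p) d + h k * cross2 (q - p) n < 0"
          by (rule order_tendstoD(2)) (use neg in simp)
        then obtain k where k: "cross2 (q - p) d + h k * cross2 (q - p) n < 0" "x k \<in> w" using freq by blast
        then show False using w.side_ge[OF s k(2)] h(1)[of k] by (simp add: cross_x True zero_le_mult_iff)
      qed
      then show ?thesis using True
        by (intro eventually_mono[OF eventually_at_right_less[of 0]]) (simp add: pq cross2_linear)
    next
      case False
      then have pos: "cross2 (q - p) (c - p) > 0" using w.side_ge[OF s cw] by simp
      have "((\<lambda>r. cross2 (q - p) (c - p) + r * cross2 (q - p) d) \<longlongrightarrow> cross2 (q - p) (c - p) + 0 * cross2 (q - p) d) (at_right 0)"
        by (intro tendsto_intros)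
      then have "\<forall>\<^sub>F r in at_right 0. 0 < cross2 (q - p) (c - p) + r * cross2 (q - p) d"
        by (rule order_tendstoD(1)) (use pos in simp)
      then show ?thesis by (rule eventually_mono) (simp add: pq cross2_linear algebra_simps)
    qed
  qed
  have "\<forall>\<^sub>F r in at_right (0::real). c + r *\<^sub>R d \<in> w \<and> r < 1 \<and> 0 < r"
  proof -
    have "\<forall>\<^sub>F r in at_right 0. \<forall>z\<in>ccw_sides w. 0 \<le> cross2 (snd z - fst z) (c + r *\<^sub>R d - fst z)"
      using w.finite_sides ev by (simp add: eventually_ball_finite)
    moreover have "\<forall>\<^sub>F r in at_right (0::real). r \<in> {0<..<1}" by (rule eventually_at_right_real) simp
    ultimately show ?thesis by eventually_elim (auto simp: w.halfplanes)
  qed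
  then obtain \<delta> where \<delta>: "c + \<delta> *\<^sub>R d \<in> w" "\<delta> < 1" "0 < \<delta>"
    using eventually_happens'[OF trivial_limit_at_right_real] by blast
  have inb: "c + r *\<^sub>R d \<in> b" if "0 \<le> r" "r \<le> 1" for r
  proof -
    obtain u v where uv: "b = closed_segment u v" using segmentE[OF b] by blast
    have "(1 - r) *\<^sub>R c + r *\<^sub>R (c + d) \<in> b" unfolding uv
      by (rule convexD) (use c uv that in auto)
    then show ?thesis by (simp add: algebra_simps)
  qed
  define m where "m = c + (\<delta> / 2) *\<^sub>R d"
  have mo: "m \<in> open_segment c (c + \<delta> *\<^sub>R d)"
    unfolding in_segment m_def using \<delta> d0 by (auto simp: algebra_simps intro!: exI[of _ "1/2"])
  have "m \<in> skeleton T" using inb[of "\<delta> / 2"] \<delta> segment_skeleton[OF b] by (auto simp: m_def)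
  then have "m \<notin> interior w" using skeleton_interior[OF w] by blast
  moreover have "m \<in> w" using mo cw \<delta> w.convex by (meson closed_segment_subset open_closed_segment subsetD)
  ultimately have "m \<in> frontier w" using closure_subset by (auto simp: frontier_def)
  then obtain p q where s: "(p, q) \<in> ccw_sides w" "closed_segment c (c + \<delta> *\<^sub>R d) \<subseteq> closed_segment p q"
    using w.segment_in_side[OF _ mo cw \<delta>(1)] by blast
  obtain b' where b': "b' \<in> segments T" "closed_segment p q \<subseteq> b'" using tile_side_segment[OF w s(1)] .
  have on: "c \<in> closed_segment p q" "c + \<delta> *\<^sub>R d \<in> closed_segment p q" using s(2) by auto
  have "b' = b" using segment_eqI[OF b'(1) b, of c "c + \<delta> *\<^sub>R d"] on b' c(1) inb[of \<delta>] \<delta> d0 by auto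
  then have sub: "closed_segment p q \<subseteq> b" using b' by simp
  have zero: "cross2 (q - p) (z - p) = 0" if "z \<in> closed_segment p q" for z
    by (rule cross2_segment[OF that])
  have c0: "cross2 (q - p) (c - p) = 0" by (rule zero[OF on(1)])
  have "\<delta> * cross2 (q - p) d = 0" using zero[OF on(2)] c0 by (simp add: cross2_linear)
  then have d0': "cross2 (q - p) d = 0" using \<delta> by simp
  obtain k where k: "x k \<in> w" using freq[of "\<lambda>_. True"] by auto
  have "h k * (h k * cross2 (q - p) n) \<ge> 0" using w.side_ge[OF s(1) k] by (simp add: cross_x c0 d0')
  then have ge: "cross2 (q - p) n \<ge> 0" using h[of k] by (simp add: zero_le_mult_iff)
  have "cross2 (q - p) n \<noteq> 0"
  proof
    assume 0: "cross2 (q - p) n = 0"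
    have qp: "q - p \<noteq> 0" using w.side_neq[OF s(1)] by simp
    obtain i where "d = i *\<^sub>R (q - p)" using cross2_parallel[OF qp d0'] .
    then show False using n(2) 0 by (simp add: cross2_linear)
  qed
  then show ?thesis using that[OF w s(1) sub \<delta>(3) on] ge by simp
qed

text \<open>Both tiles lie to the left of their sides, and the sides overlap in the same direction;
  so near a common inner point the two interiors meet.\<close>

lemma tile_overlap:
  assumes w: "w \<in> T" "w' \<in> T" and s: "(p, q) \<in> ccw_sides w" "(p', q') \<in> ccw_sides w'"
    and x: "x \<in> closed_segment p q" "x \<in> closed_segment p' q'"
    and y: "y \<in> closed_segment p q" "y \<in> closed_segment p' q'" and xy: "x \<noteq> y"
    and dir: "(q - p) \<bullet> (q' - p') > 0"
  shows "w = w'"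
proof (rule ccontr)
  assume ne: "w \<noteq> w'"
  interpret w: polygon w by (rule tile[OF w(1)])
  interpret w': polygon w' by (rule tile[OF w(2)])
  obtain m where m: "m \<in> open_segment x y" using xy open_segment_eq_empty by blast
  have inn: "m \<in> open_segment a b" if "x \<in> closed_segment a b" "y \<in> closed_segment a b" for a b
  proof -
    have "m \<in> closed_segment a b" using m that by (meson closed_segment_subset convex_closed_segment open_closed_segment subsetD)
    moreover have "m \<noteq> a" "m \<noteq> b"
      using m that extreme_point_of_segment[of m a b] by (auto simp: extreme_point_of_def)
    ultimately show ?thesis by (simp add: open_segment_def)
  qed
  have zero: "cross2 (q - p) (z - p) = 0" if "z \<in> closed_segment p q" for z
    by (rule cross2_segment[OF that])
  obtain r where r: "y - x = r *\<^sub>R (q - p)"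
  proof -
    have "cross2 (q - p) (y - x) = 0" using zero[OF x(1)] zero[OF y(1)] by (simp add: cross2_linear)
    then show ?thesis using cross2_parallel[of "q - p"] w.side_neq[OF s(1)] that by auto
  qed
  obtain r' where r': "q' - p' = r' *\<^sub>R (y - x)"
  proof -
    have "cross2 (q' - p') (z - p') = 0" if "z \<in> closed_segment p' q'" for z
      by (rule cross2_segment[OF that])
    from this[OF x(2)] this[OF y(2)] have "cross2 (y - x) (q' - p') = 0" by (simp add: cross2_def algebra_simps)
    then show ?thesis using cross2_parallel[of "y - x"] xy that by auto
  qed
  define k where "k = r' * r"
  have qk: "q' - p' = k *\<^sub>R (q - p)" unfolding r' r k_def by simp
  then have "k * ((q - p) \<bullet> (q - p)) > 0" using dir by simp
  then have k: "k > 0" using inner_ge_zero[of "q - p"] by (metis mult_nonneg_nonneg mult_nonpos_nonneg not_less order_le_less)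
  define n where "n = perp (q - p)"
  have n: "cross2 (q - p) n > 0"
    unfolding n_def by (rule cross2_perp_pos) (use w.side_neq[OF s(1)] in simp)
  have "cross2 (q' - p') n > 0" using n k by (simp add: qk cross2_linear)
  then have "\<forall>\<^sub>F r in at_right 0. m + r *\<^sub>R n \<in> interior w \<and> m + r *\<^sub>R n \<in> interior w'"
    using eventually_conj[OF w.side_near[OF s(1) inn[OF x(1) y(1)] n] w'.side_near[OF s(2) inn[OF x(2) y(2)]]] by blast
  then obtain r where "m + r *\<^sub>R n \<in> interior w" "m + r *\<^sub>R n \<in> interior w'"
    using eventually_happens'[OF trivial_limit_at_right_real] by blast
  then show False using interior_disjoint[OF w ne] interior_subset by blast
qed

lemma nearer_point:
  fixes v x y :: point
  assumes "k > 0" "y - v = k *\<^sub>R (x - v)" "x \<noteq> v"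
  obtains z where "z \<noteq> v" "z \<in> closed_segment v x" "z \<in> closed_segment v y"
proof (cases "k \<le> 1")
  case True
  have "y = (1 - k) *\<^sub>R v + k *\<^sub>R x" using assms(2) by (simp add: algebra_simps)
  then have "y \<in> closed_segment v x" unfolding in_segment using assms(1) True by (intro exI[of _ k]) auto
  moreover have "y \<noteq> v" using assms by auto
  ultimately show ?thesis using that by auto
next
  case False
  have "(1 / k) *\<^sub>R (y - v) = x - v" using assms by simp
  then have "x = (1 - 1 / k) *\<^sub>R v + (1 / k) *\<^sub>R y" by (simp add: algebra_simps)
  then have "x \<in> closed_segment v y" unfolding in_segment using assms(1) False by (intro exI[of _ "1 / k"]) auto
  then show ?thesis using that assms by auto
qed

lemma tile_eq_out:
  assumes w: "w \<in> T" "w' \<in> T" and s: "(v, u) \<in> ccw_sides w" "(v, u') \<in> ccw_sides w'"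
    and k: "k > 0" "u' - v = k *\<^sub>R (u - v)"
  shows "w = w'"
proof -
  have uv: "u \<noteq> v" using polygon.side_neq[OF tile[OF w(1)] s(1)] by auto
  obtain z where z: "z \<noteq> v" "z \<in> closed_segment v u" "z \<in> closed_segment v u'" using nearer_point[OF k uv] .
  show ?thesis by (rule tile_overlap[OF w s, of v z]) (use z k uv in auto)
qed

lemma tile_eq_in:
  assumes w: "w \<in> T" "w' \<in> T" and s: "(u, v) \<in> ccw_sides w" "(u', v) \<in> ccw_sides w'"
    and k: "k > 0" "u' - v = k *\<^sub>R (u - v)"
  shows "w = w'"
proof -
  have uv: "u \<noteq> v" using polygon.side_neq[OF tile[OF w(1)] s(1)] by auto
  obtain z where z: "z \<noteq> v" "z \<in> closed_segment v u" "z \<in> closed_segment v u'" using nearer_point[OF k uv] .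
  have "v - u' = k *\<^sub>R (v - u)" using k(2) by (simp add: algebra_simps)
  then have "(v - u) \<bullet> (v - u') > 0" using k uv by simp
  then show ?thesis by (intro tile_overlap[OF w s, of v z]) (use z closed_segment_commute in auto)
qed

end

section \<open>The faces of the graph\<close>

lemma segment_coord:
  fixes e v :: point
  assumes "v + \<tau> *\<^sub>R e \<in> closed_segment (v + r *\<^sub>R e) (v + s *\<^sub>R e)" "e \<noteq> 0" "r < s"
  shows "r \<le> \<tau> \<and> \<tau> \<le> s"
proof -
  obtain u where u: "0 \<le> u" "u \<le> 1" and eq: "v + \<tau> *\<^sub>R e = (1 - u) *\<^sub>R (v + r *\<^sub>R e) + u *\<^sub>R (v + s *\<^sub>R e)"
    using assms(1) by (auto simp: in_segment)
  have "(\<tau> - ((1 - u) * r + u * s)) *\<^sub>R e = 0" using eq by (simp add: algebra_simps)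
  then have "\<tau> - ((1 - u) * r + u * s) = 0" using assms(2) unfolding scaleR_eq_0_iff by simp
  then have \<tau>: "\<tau> = r + u * (s - r)" by (simp add: algebra_simps)
  have "0 \<le> u * (s - r)" "u * (s - r) \<le> s - r" using u assms(3) by (auto simp: mult_le_cancel_right1)
  then show ?thesis using \<tau> by linarith
qed

lemma extreme_point_mono: "v extreme_point_of S \<Longrightarrow> S' \<subseteq> S \<Longrightarrow> v \<in> S' \<Longrightarrow> v extreme_point_of S'"
  by (auto simp: extreme_point_of_def)

lemma inj_on_finite_returns:
  assumes "finite S" "f ` S \<subseteq> S" "inj_on f S" "x \<in> S"
  obtains n where "n > 0" "(f ^^ n) x = x"
proof -
  have in_S: "(f ^^ n) x \<in> S" for n using assms(2,4) by (induction n) auto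
  have "finite (range (\<lambda>n. (f ^^ n) x))" by (rule finite_subset[OF _ assms(1)]) (use in_S in auto)
  then have "\<not> inj (\<lambda>n. (f ^^ n) x)" using finite_imageD by blast
  then obtain a b where ab: "a < b" "(f ^^ a) x = (f ^^ b) x"
    unfolding inj_def by (metis linorder_neqE_nat)
  have "(f ^^ (b - a)) x = x" if "(f ^^ a) x = (f ^^ b) x" "a \<le> b" for a b
    using that
  proof (induction a arbitrary: b)
    case (Suc a)
    then obtain b' where b': "b = Suc b'" by (cases b) auto
    have "(f ^^ a) x = (f ^^ b') x"
      using Suc.prems assms(3) in_S[of a] in_S[of b'] by (auto simp: b' inj_on_def)
    then show ?case using Suc.IH[of b'] Suc.prems b' by simp
  qed simp
  then show ?thesis using that[of "b - a"] ab by simp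
qed

context tiling
begin

section \<open>Adjacency and the segments at a vertex of a tile\<close>

lemma side_unique:
  assumes w: "w \<in> T" and b: "b \<in> segments T"
    and s: "(p, q) \<in> ccw_sides w" "closed_segment p q \<subseteq> b"
    and s': "(p', q') \<in> ccw_sides w" "closed_segment p' q' \<subseteq> b"
  shows "(p, q) = (p', q')"
proof -
  interpret w: polygon w by (rule tile[OF w])
  obtain x y where xy: "b = closed_segment x y" using segmentE[OF b] by blast
  have on: "z \<in> closed_segment p q" if z: "z \<in> closed_segment p' q'" for z
  proof -
    obtain r where "z = p + r *\<^sub>R (q - p)"
      by (rule line_param[of p x y q z]) (use s s' z xy w.side_neq[OF s(1)] in auto)
    then have "cross2 (q - p) (z - p) = 0" by (simp add: cross2_linear)
    then show ?thesis using w.side_line[OF s(1)] w.side_subset[OF s'(1)] z by blast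
  qed
  show ?thesis
    by (rule w.side_eqI[OF s(1) s'(1), of p' q']) (use on w.side_neq[OF s'(1)] in auto)
qed

lemma side_eq:
  assumes "w \<in> T" "b \<in> segments T" "(p, q) \<in> ccw_sides w" "closed_segment p q \<subseteq> b"
  shows "side w b = (p, q)"
  unfolding side_def
proof (rule the_equality)
  fix s assume "s \<in> ccw_sides w \<and> closed_segment (fst s) (snd s) \<subseteq> b"
  then show "s = (p, q)" using side_unique[OF assms(1,2), of "fst s" "snd s" p q] assms by auto
qed (use assms in auto)

lemma adjacentI:
  assumes "w \<in> T" "b \<in> segments T" "(p, q) \<in> ccw_sides w" "closed_segment p q \<subseteq> b"
  shows "adjacent T w b"
  using assms unfolding adjacent_def ccw_sides_def by blast

lemma adjacentE:
  assumes "adjacent T w b"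
  obtains p q where "w \<in> T" "b \<in> segments T" "(p, q) \<in> ccw_sides w" "closed_segment p q \<subseteq> b" "side w b = (p, q)"
proof -
  obtain e where e: "w \<in> T" "b \<in> segments T" "e edge_of w" "e \<subseteq> b" using assms by (auto simp: adjacent_def)
  obtain p q where pq: "(p, q) \<in> ccw_sides w" "e = closed_segment p q"
    using polygon.edge_is_side[OF tile[OF e(1)] e(3)] by blast
  then show ?thesis using that[OF e(1,2) pq(1)] side_eq[OF e(1,2) pq(1)] e(4) by auto
qed

lemma adjacent_sndE:
  assumes "adjacent T w b" "snd (side w b) = v"
  obtains p where "w \<in> T" "b \<in> segments T" "(p, v) \<in> ccw_sides w" "closed_segment p v \<subseteq> b" "side w b = (p, v)"
proof -
  obtain p q where pq: "w \<in> T" "b \<in> segments T" "(p, q) \<in> ccw_sides w" "closed_segment p q \<subseteq> b" "side w b = (p, q)"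
    using adjacentE[OF assms(1)] .
  then have "q = v" using assms(2) by simp
  then show ?thesis using that pq by blast
qed

lemma incoming_eq:
  assumes w: "w \<in> T" and b: "b \<in> segments T" and s: "(p, v) \<in> ccw_sides w" "closed_segment p v \<subseteq> b"
  shows "incoming_segment T w v = b"
  unfolding incoming_segment_def
proof (rule the_equality)
  show "adjacent T w b \<and> snd (side w b) = v" using adjacentI[OF w b s] side_eq[OF w b s] by simp
  fix b' assume b': "adjacent T w b' \<and> snd (side w b') = v"
  then obtain p' where p': "b' \<in> segments T" "(p', v) \<in> ccw_sides w" "closed_segment p' v \<subseteq> b'"
    by (auto elim!: adjacentE)
  then have "p' = p" using polygon.in_unique[OF tile[OF w]] s by blast
  then show "b' = b" using segment_eqI[OF p'(1) b, of p v] p' s polygon.side_neq[OF tile[OF w] s(1)] by auto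
qed

lemma outgoing_eq:
  assumes w: "w \<in> T" and b: "b \<in> segments T" and s: "(v, q) \<in> ccw_sides w" "closed_segment v q \<subseteq> b"
  shows "outgoing_segment T w v = b"
  unfolding outgoing_segment_def
proof (rule the_equality)
  show "adjacent T w b \<and> fst (side w b) = v" using adjacentI[OF w b s] side_eq[OF w b s] by simp
  fix b' assume b': "adjacent T w b' \<and> fst (side w b') = v"
  then obtain q' where q': "b' \<in> segments T" "(v, q') \<in> ccw_sides w" "closed_segment v q' \<subseteq> b'"
    by (auto elim!: adjacentE)
  then have "q' = q" using polygon.out_unique[OF tile[OF w]] s by blast
  then show "b' = b" using segment_eqI[OF q'(1) b, of v q] q' s polygon.side_neq[OF tile[OF w] s(1)] by auto
qed

lemma incoming:
  assumes w: "w \<in> T" and v: "v \<in> verts w"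
  shows "incoming_segment T w v \<in> segments T" "closed_segment (polygon.prv w v) v \<subseteq> incoming_segment T w v"
proof -
  have s: "(polygon.prv w v, v) \<in> ccw_sides w" by (rule polygon.prv_side[OF tile[OF w] v])
  obtain b where b: "b \<in> segments T" "closed_segment (polygon.prv w v) v \<subseteq> b" using tile_side_segment[OF w s] .
  then show "incoming_segment T w v \<in> segments T" "closed_segment (polygon.prv w v) v \<subseteq> incoming_segment T w v"
    using incoming_eq[OF w b(1) s b(2)] by auto
qed

lemma outgoing:
  assumes w: "w \<in> T" and v: "v \<in> verts w"
  shows "outgoing_segment T w v \<in> segments T" "closed_segment v (polygon.nxt w v) \<subseteq> outgoing_segment T w v"
proof -
  have s: "(v, polygon.nxt w v) \<in> ccw_sides w" by (rule polygon.nxt_side[OF tile[OF w] v])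
  obtain b where b: "b \<in> segments T" "closed_segment v (polygon.nxt w v) \<subseteq> b" using tile_side_segment[OF w s] .
  then show "outgoing_segment T w v \<in> segments T" "closed_segment v (polygon.nxt w v) \<subseteq> outgoing_segment T w v"
    using outgoing_eq[OF w b(1) s b(2)] by auto
qed

lemma incoming_neq_outgoing:
  assumes w: "w \<in> T" and v: "v \<in> verts w"
  shows "incoming_segment T w v \<noteq> outgoing_segment T w v"
proof
  assume eq: "incoming_segment T w v = outgoing_segment T w v"
  interpret w: polygon w by (rule tile[OF w])
  have "(w.prv v, v) = (v, w.nxt v)"
    by (rule side_unique[OF w incoming(1)[OF w v] w.prv_side[OF v] incoming(2)[OF w v] w.nxt_side[OF v]])
       (use outgoing(2)[OF w v] eq in simp)
  then show False using w.side_neq[OF w.prv_side[OF v]] by simp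
qed

section \<open>Corners of tiles and the orbits of face tracing\<close>

lemma boundary_extreme:
  assumes "b \<in> boundary_segments R T" "v extreme_point_of b"
  shows "v \<in> verts R"
proof -
  obtain P Q where "(P, Q) \<in> ccw_sides R" "b = closed_segment P Q" using boundary_segmentE[OF assms(1)] .
  then show ?thesis using assms(2) R.side_verts[of P Q] by (auto simp: extreme_point_of_segment)
qed

lemma corner_of_R:
  assumes "v \<in> verts R" "b \<in> segments T" "v \<in> b"
  shows "b \<in> boundary_segments R T" "v extreme_point_of b"
proof -
  show "b \<in> boundary_segments R T"
    using T assms by (auto simp: convex_tiling_def verts_def interior_segments_def)
  show "v extreme_point_of b"
    using extreme_point_mono[OF _ segment_subset_R[OF assms(2)] assms(3)] assms(1) by (simp add: verts_def)
qed

text \<open>A corner \<open>(w, v)\<close> stands for the angle of the graph at the white vertex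
  \<open>w\<close> between its edges to the two segments that meet at \<open>v\<close>. Corners of
  \<open>R\<close> are left out because the outer face passes there.\<close>

definition corners :: "(point set \<times> point) set" where
  "corners = {(w, v). w \<in> T \<and> v \<in> verts w \<and> v \<notin> verts R}"

lemma finite_corners: "finite corners"
proof -
  have "corners \<subseteq> Sigma T verts" by (auto simp: corners_def)
  moreover have "finite (Sigma T verts)" using finite_T polygon.finite_verts[OF tile] by blast
  ultimately show ?thesis by (rule finite_subset)
qed

lemma extreme_noncorner:
  assumes "b \<in> segments T" "v extreme_point_of b" "v \<notin> verts R"
  shows "b \<in> interior_segments R T"
  using assms boundary_extreme by (auto simp: interior_segments_def)

text \<open>The wrap-around clause for boundary segments would make \<open>v\<close> an end point of
  such a segment, hence a corner of \<open>R\<close>.\<close>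

lemma follows_iff:
  assumes c: "(w, v) \<in> corners"
  shows "follows_around R T (outgoing_segment T w v) w' w \<longleftrightarrow>
    adjacent T w' (outgoing_segment T w v) \<and> snd (side w' (outgoing_segment T w v)) = v \<and>
    (\<not> v extreme_point_of outgoing_segment T w v \<longrightarrow>
      (v - fst (side w' (outgoing_segment T w v))) \<bullet> (polygon.nxt w v - v) > 0)"
proof -
  have w: "w \<in> T" "v \<in> verts w" "v \<notin> verts R" using c by (auto simp: corners_def)
  define b where "b = outgoing_segment T w v"
  have b: "b \<in> segments T" "closed_segment v (polygon.nxt w v) \<subseteq> b" using outgoing[OF w(1,2)] by (auto simp: b_def)
  have s: "(v, polygon.nxt w v) \<in> ccw_sides w" by (rule polygon.nxt_side[OF tile[OF w(1)] w(2)])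
  have adj: "adjacent T w b" and side: "side w b = (v, polygon.nxt w v)"
    using adjacentI[OF w(1) b(1) s b(2)] side_eq[OF w(1) b(1) s b(2)] by auto
  have ext: "v extreme_point_of b \<Longrightarrow> b \<notin> boundary_segments R T" using boundary_extreme w(3) by blast
  obtain p q where pq: "side w' b = (p, q)" by (cases "side w' b")
  show ?thesis
    unfolding b_def[symmetric] follows_around_def side pq using adj ext by (auto simp: Let_def)
qed

text \<open>If the outgoing segment ends at \<open>v\<close>, the predecessor is the tile across it,
  met by probing on the right of the side. If it passes through, the predecessor is the tile on the
  same side of it just behind \<open>v\<close>, met by probing backwards on the left.\<close>

lemma predecessor_exists:
  assumes c: "(w, v) \<in> corners"
  shows "\<exists>w'. follows_around R T (outgoing_segment T w v) w' w"
proof -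
  have w: "w \<in> T" "v \<in> verts w" "v \<notin> verts R" using c by (auto simp: corners_def)
  interpret w: polygon w by (rule tile[OF w(1)])
  define b where "b = outgoing_segment T w v"
  define u where "u = w.nxt v"
  define e where "e = u - v"
  have s: "(v, u) \<in> ccw_sides w" using w.nxt_side[OF w(2)] by (simp add: u_def)
  have e0: "e \<noteq> 0" using w.side_neq[OF s] by (simp add: e_def)
  have b: "b \<in> segments T" "closed_segment v u \<subseteq> b" using outgoing[OF w(1,2)] by (auto simp: b_def u_def)
  have vb: "v \<in> b" "u \<in> b" using b(2) by auto
  obtain x y where xy: "b = closed_segment x y" using segmentE[OF b(1)] by blast
  show ?thesis
  proof (cases "v extreme_point_of b")
    case True
    have bi: "b \<in> interior_segments R T" by (rule extreme_noncorner[OF b(1) True w(3)])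
    obtain r where r: "r > 0" "v + (1/2) *\<^sub>R e \<in> b" "v + (1/2) *\<^sub>R e + r *\<^sub>R (- perp e) \<in> R"
      by (rule interior_segment_side[OF bi vb, where n = "- perp e", folded e_def]) (use e0 in \<open>auto simp: e_def\<close>)
    define n where "n = r *\<^sub>R (- perp e)"
    have en: "cross2 e n < 0" using cross2_perp_pos[OF e0] r by (simp add: n_def cross2_linear)
    obtain w' p q \<delta> where loc: "w' \<in> T" "(p, q) \<in> ccw_sides w'" "closed_segment p q \<subseteq> b"
        "0 < \<delta>" "v \<in> closed_segment p q" "v + \<delta> *\<^sub>R ((1/2) *\<^sub>R e) \<in> closed_segment p q" "cross2 (q - p) n > 0"
    proof (rule tile_along_segment[OF b(1) vb(1), of "(1/2) *\<^sub>R e" n])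
      show "v + (1/2) *\<^sub>R e \<in> b" by (rule r(2))
      show "v + (1/2) *\<^sub>R e + n \<in> R" using r(3) by (simp add: n_def)
      show "cross2 ((1/2) *\<^sub>R e) n \<noteq> 0" using en by (simp add: cross2_linear)
    qed
    have "v extreme_point_of closed_segment p q" by (rule extreme_point_mono[OF True loc(3,5)])
    then have "v = p \<or> v = q" by (simp add: extreme_point_of_segment)
    moreover have "v \<noteq> p"
    proof
      assume vp: "v = p"
      have "q \<in> b" "q \<noteq> v" using loc(3) polygon.side_neq[OF tile[OF loc(1)] loc(2)] vp by auto
      then obtain k where "k > 0" "q - v = k *\<^sub>R (u - v)"
        using segment_extreme_direction[of v x y u q] True vb e0 xy by (auto simp: e_def)
      then have "cross2 (q - p) n = k * cross2 e n" by (simp add: vp e_def cross2_linear)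
      then show False using loc(7) en \<open>k > 0\<close> by (simp add: zero_less_mult_iff)
    qed
    ultimately have "v = q" by blast
    then show ?thesis
      using follows_iff[OF c, of w'] adjacentI[OF loc(1) b(1) loc(2,3)] side_eq[OF loc(1) b(1) loc(2,3)] True
      by (auto simp: b_def)
  next
    case False
    obtain k where k: "k > 0" "v - k *\<^sub>R (u - v) \<in> b"
      using segment_extend[of v x y u] False vb e0 xy by (auto simp: e_def)
    obtain o' where o': "o' \<in> interior w" using w.interior_nonempty by blast
    define d where "d = (- k) *\<^sub>R e"
    define n where "n = o' - (v + d)"
    have en: "cross2 e n > 0" using w.side_interior[OF s o'] by (simp add: n_def d_def e_def cross2_linear)
    obtain w' p q \<delta> where loc: "w' \<in> T" "(p, q) \<in> ccw_sides w'" "closed_segment p q \<subseteq> b"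
        "0 < \<delta>" "v \<in> closed_segment p q" "v + \<delta> *\<^sub>R d \<in> closed_segment p q" "cross2 (q - p) n > 0"
    proof (rule tile_along_segment[OF b(1) vb(1), of d n])
      show "v + d \<in> b" using k by (simp add: d_def e_def)
      show "v + d + n \<in> R" using o' interior_subset tile_subset[OF w(1)] by (auto simp: n_def)
      show "cross2 d n \<noteq> 0" using en k by (simp add: d_def cross2_linear)
    qed
    have pqb: "p \<in> b" "q \<in> b" using loc(3) by auto
    obtain r where r: "p = v + r *\<^sub>R e" using line_param[of v x y u p] vb pqb e0 xy by (auto simp: e_def)
    obtain t where t: "q = v + t *\<^sub>R e" using line_param[of v x y u q] vb pqb e0 xy by (auto simp: e_def)
    have qp: "q - p = (t - r) *\<^sub>R e" unfolding r t by (simp add: algebra_simps)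
    then have rt: "r < t" using loc(7) en by (simp add: cross2_linear zero_less_mult_iff)
    have 0: "r \<le> 0 \<and> 0 \<le> t" using segment_coord[of v 0 e r t] loc(5) e0 rt by (simp add: r t)
    have "r \<le> - (\<delta> * k) \<and> - (\<delta> * k) \<le> t"
      using segment_coord[of v "- (\<delta> * k)" e r t] loc(6) e0 rt by (simp add: r t d_def)
    moreover have "\<delta> * k > 0" using loc(4) k(1) by simp
    ultimately have r0: "r < 0" by linarith
    \<comment> \<open>If the side of \<open>w'\<close> went on beyond \<open>v\<close>, it would
      overlap the side of \<open>w\<close> in the same direction, so the two tiles would
      coincide.\<close>
    have "t = 0"
    proof (rule ccontr)
      assume "t \<noteq> 0"
      then have t0: "t > 0" using 0 by simp
      have "q - v = t *\<^sub>R (u - v)" by (simp add: t e_def)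
      then obtain z where z: "z \<noteq> v" "z \<in> closed_segment v u" "z \<in> closed_segment v q"
        using nearer_point[of t q v u] t0 e0 by (auto simp: e_def)
      have zpq: "z \<in> closed_segment p q" using z(3) loc(5) by (meson closed_segment_subset convex_closed_segment ends_in_segment(2) subsetD)
      have "(u - v) \<bullet> (q - p) > 0" using e0 rt by (simp add: qp e_def[symmetric])
      then have "w = w'"
        by (intro tile_overlap[OF w(1) loc(1) s loc(2), of v z]) (use z zpq loc(5) in auto)
      then have "(p, q) = (v, u)" using side_unique[OF w(1) b(1) _ loc(3) s b(2)] loc(2) by simp
      then show False using r r0 e0 by simp
    qed
    then have qv: "q = v" by (simp add: t)
    have "(v - p) \<bullet> (u - v) = - r * (e \<bullet> e)" by (simp add: r e_def[symmetric])
    also have "\<dots> > 0" by (rule mult_pos_pos) (use r0 e0 in auto)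
    finally show ?thesis
      using follows_iff[OF c, of w'] adjacentI[OF loc(1) b(1) loc(2,3)] side_eq[OF loc(1) b(1) loc(2,3)] qv
      by (auto simp: b_def u_def)
  qed
qed

text \<open>Along a segment through \<open>v\<close> the direction is fixed by \<open>follows_around\<close>; along a segment
  ending at \<open>v\<close> there is only one direction.\<close>

lemma same_direction:
  assumes b: "b \<in> segments T" "v \<in> b" "x \<in> b" "y \<in> b" "z \<in> b" "x \<noteq> v" "y \<noteq> v" "z \<noteq> v"
    and dir: "\<not> v extreme_point_of b \<Longrightarrow> (v - x) \<bullet> (z - v) > 0 \<and> (v - y) \<bullet> (z - v) > 0"
  obtains k where "k > 0" "y - v = k *\<^sub>R (x - v)"
proof -
  obtain a c where ac: "b = closed_segment a c" using segmentE[OF b(1)] by blast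
  show ?thesis
  proof (cases "v extreme_point_of b")
    case True
    then show ?thesis using segment_extreme_direction[of v a c x y] b ac that by blast
  next
    case False
    obtain r where r: "x = v + r *\<^sub>R (z - v)" using line_param[of v a c z x] b ac by auto
    obtain t where t: "y = v + t *\<^sub>R (z - v)" using line_param[of v a c z y] b ac by auto
    have zz: "(z - v) \<bullet> (z - v) > 0" using b by simp
    have "- r * ((z - v) \<bullet> (z - v)) > 0" "- t * ((z - v) \<bullet> (z - v)) > 0"
      using dir[OF False] unfolding r t by simp_all
    then have rt: "r < 0" "t < 0" using zz by (simp_all add: zero_less_mult_iff mult_less_0_iff)
    have "y - v = (t / r) *\<^sub>R (x - v)" unfolding r t using rt by simp
    then show ?thesis using that[of "t / r"] rt by (simp add: divide_neg_neg)
  qed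
qed

lemma predecessor_unique:
  assumes c: "(w, v) \<in> corners"
    and f: "follows_around R T (outgoing_segment T w v) w1 w" "follows_around R T (outgoing_segment T w v) w2 w"
  shows "w1 = w2"
proof -
  have w: "w \<in> T" "v \<in> verts w" "v \<notin> verts R" using c by (auto simp: corners_def)
  define b where "b = outgoing_segment T w v"
  have b: "b \<in> segments T" "v \<in> b" "polygon.nxt w v \<in> b" using outgoing[OF w(1,2)] by (auto simp: b_def)
  have nv: "polygon.nxt w v \<noteq> v"
    using polygon.side_neq[OF tile[OF w(1)] polygon.nxt_side[OF tile[OF w(1)] w(2)]] by auto
  note f' = f[unfolded follows_iff[OF c], folded b_def]
  obtain p1 where p1: "w1 \<in> T" "(p1, v) \<in> ccw_sides w1" "closed_segment p1 v \<subseteq> b" "side w1 b = (p1, v)"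
    by (rule adjacent_sndE[of w1 b v]) (use f'(1) in auto)
  obtain p2 where p2: "w2 \<in> T" "(p2, v) \<in> ccw_sides w2" "closed_segment p2 v \<subseteq> b" "side w2 b = (p2, v)"
    by (rule adjacent_sndE[of w2 b v]) (use f'(2) in auto)
  have ne: "p1 \<noteq> v" "p2 \<noteq> v" using polygon.side_neq[OF tile] p1 p2 by blast+
  have pb: "p1 \<in> b" "p2 \<in> b" using p1 p2 by auto
  obtain k where "k > 0" "p2 - v = k *\<^sub>R (p1 - v)"
    by (rule same_direction[OF b(1,2) pb b(3) ne nv]) (use f' p1 p2 in auto)
  then show ?thesis using tile_eq_in[OF p1(1) p2(1) p1(2) p2(2)] by blast
qed

text \<open>Two steps of face tracing, seen at the junction: the point \<open>v\<close> stays fixed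
  and the tile changes to the one that enters \<open>v\<close> along the segment by which
  \<open>w\<close> leaves it.\<close>

definition turn :: "point set \<times> point \<Rightarrow> point set \<times> point" where
  "turn = (\<lambda>(w, v). (THE w'. follows_around R T (outgoing_segment T w v) w' w, v))"

lemma turn:
  assumes c: "(w, v) \<in> corners"
  obtains w' where "turn (w, v) = (w', v)" "follows_around R T (outgoing_segment T w v) w' w"
    "(w', v) \<in> corners" "incoming_segment T w' v = outgoing_segment T w v"
proof -
  have w: "w \<in> T" "v \<in> verts w" "v \<notin> verts R" using c by (auto simp: corners_def)
  define b where "b = outgoing_segment T w v"
  obtain w' where w': "follows_around R T b w' w" using predecessor_exists[OF c] by (auto simp: b_def)
  have "(THE w'. follows_around R T b w' w) = w'"
  proof (rule the_equality[of "\<lambda>w'. follows_around R T b w' w", OF w'])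
    fix w'' assume "follows_around R T b w'' w"
    from predecessor_unique[OF c this[unfolded b_def] w'[unfolded b_def]] show "w'' = w'" .
  qed
  then have tw: "turn (w, v) = (w', v)" by (simp add: turn_def b_def)
  have "adjacent T w' b" "snd (side w' b) = v" using w' follows_iff[OF c, of w', folded b_def] by blast+
  then obtain p where p: "w' \<in> T" "b \<in> segments T" "(p, v) \<in> ccw_sides w'" "closed_segment p v \<subseteq> b"
      "side w' b = (p, v)"
    by (rule adjacent_sndE)
  have "(w', v) \<in> corners" using p w polygon.side_verts[OF tile[OF p(1)] p(3)] by (auto simp: corners_def)
  moreover have "incoming_segment T w' v = b" by (rule incoming_eq[OF p(1-4)])
  ultimately show ?thesis using that tw w' by (auto simp: b_def)
qed

lemma turn_in_corners: "turn ` corners \<subseteq> corners"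
  using turn by (metis image_subsetI surj_pair)

text \<open>The mirror image of \<open>predecessor_unique\<close>: the incoming side of the common
  successor fixes the direction in which the original tiles leave \<open>v\<close>.\<close>

lemma inj_turn: "inj_on turn corners"
proof (rule inj_onI)
  fix c1 c2 assume c: "c1 \<in> corners" "c2 \<in> corners" "turn c1 = turn c2"
  obtain w1 v where c1: "c1 = (w1, v)" by (cases c1)
  obtain w2 where c2: "c2 = (w2, v)" using c c1 by (cases c2) (auto simp: turn_def)
  obtain w' where w': "turn (w1, v) = (w', v)" "follows_around R T (outgoing_segment T w1 v) w' w1"
    "(w', v) \<in> corners" "incoming_segment T w' v = outgoing_segment T w1 v" using turn c c1 by metis
  obtain w'' where w'': "turn (w2, v) = (w'', v)" "follows_around R T (outgoing_segment T w2 v) w'' w2"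
    "incoming_segment T w'' v = outgoing_segment T w2 v" using turn c c2 by metis
  have eq: "w'' = w'" using w'(1) w''(1) c c1 c2 by simp
  define b where "b = outgoing_segment T w1 v"
  have b2: "b = outgoing_segment T w2 v" using w'(4) w''(3) eq by (simp add: b_def)
  have w: "w1 \<in> T" "v \<in> verts w1" "w2 \<in> T" "v \<in> verts w2" using c c1 c2 by (auto simp: corners_def)
  have s: "(v, polygon.nxt w1 v) \<in> ccw_sides w1" "(v, polygon.nxt w2 v) \<in> ccw_sides w2"
    using polygon.nxt_side[OF tile] w by blast+
  have b: "b \<in> segments T" "v \<in> b" "polygon.nxt w1 v \<in> b" "polygon.nxt w2 v \<in> b"
    using outgoing[OF w(1,2)] outgoing[OF w(3,4)] b2 by (auto simp: b_def)
  have ne: "polygon.nxt w1 v \<noteq> v" "polygon.nxt w2 v \<noteq> v"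
    using polygon.side_neq[OF tile[OF w(1)] s(1)] polygon.side_neq[OF tile[OF w(3)] s(2)] by auto
  have c1': "(w1, v) \<in> corners" and c2': "(w2, v) \<in> corners" using c c1 c2 by auto
  note f1 = w'(2)[unfolded follows_iff[OF c1'], folded b_def]
  note f2 = w''(2)[unfolded follows_iff[OF c2'], folded b2, unfolded eq]
  obtain p where p: "w' \<in> T" "(p, v) \<in> ccw_sides w'" "closed_segment p v \<subseteq> b" "side w' b = (p, v)"
    by (rule adjacent_sndE[of w' b v]) (use f1 in auto)
  have pv: "p \<noteq> v" using polygon.side_neq[OF tile[OF p(1)] p(2)] .
  have pb: "p \<in> b" using p by auto
  obtain k where "k > 0" "polygon.nxt w2 v - v = k *\<^sub>R (polygon.nxt w1 v - v)"
  proof (rule same_direction[OF b(1,2,3,4) pb ne pv])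
    assume "\<not> v extreme_point_of b"
    then have "(v - p) \<bullet> (polygon.nxt w1 v - v) > 0" "(v - p) \<bullet> (polygon.nxt w2 v - v) > 0" using f1 f2 p by auto
    then show "(v - polygon.nxt w1 v) \<bullet> (p - v) > 0 \<and> (v - polygon.nxt w2 v) \<bullet> (p - v) > 0"
      by (simp add: inner_diff inner_commute algebra_simps)
  qed
  then show "c1 = c2" using tile_eq_out[OF w(1,3) s] c1 c2 by simp
qed

definition corner_dart :: "point set \<times> point \<Rightarrow> dart" where
  "corner_dart = (\<lambda>(w, v). From_white w (outgoing_segment T w v))"

lemma face_step_corner:
  assumes c: "(w, v) \<in> corners" and w': "turn (w, v) = (w', v)"
  shows "face_step R T (corner_dart (w, v)) = From_black (outgoing_segment T w v) w'"
    "face_step R T (From_black (outgoing_segment T w v) w') = corner_dart (w', v)"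
proof -
  obtain w'' where w'': "turn (w, v) = (w'', v)" "follows_around R T (outgoing_segment T w v) w'' w"
    using turn[OF c] by metis
  show "face_step R T (corner_dart (w, v)) = From_black (outgoing_segment T w v) w'"
    using w' by (simp add: corner_dart_def turn_def)
  have "snd (side w' (outgoing_segment T w v)) = v" using w'' w' follows_iff[OF c] by auto
  then show "face_step R T (From_black (outgoing_segment T w v) w') = corner_dart (w', v)"
    by (simp add: corner_dart_def outgoing_segment_def)
qed

lemma face_step_twice:
  assumes "c \<in> corners"
  shows "face_step R T (face_step R T (corner_dart c)) = corner_dart (turn c)"
proof -
  obtain w v where c: "c = (w, v)" by (cases c)
  obtain w' where w': "turn (w, v) = (w', v)" using turn assms c by metis
  show ?thesis using face_step_corner[OF _ w'] assms w' by (simp add: c)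
qed

lemma face_step_even:
  assumes "c \<in> corners"
  shows "(face_step R T ^^ (2 * n)) (corner_dart c) = corner_dart ((turn ^^ n) c)" "(turn ^^ n) c \<in> corners"
proof (induction n)
  case (Suc n)
  { case 1 then show ?case using face_step_twice[OF Suc(2)] Suc(1) by simp }
  { case 2 then show ?case using Suc(2) turn_in_corners by auto }
qed (use assms in auto)

lemma turn_snd: "snd (turn c) = snd c"
  by (simp add: turn_def split_def)

lemma corner_dart_inj:
  assumes "c \<in> corners" "c' \<in> corners" "corner_dart c = corner_dart c'" "snd c = snd c'"
  shows "c = c'"
  using assms by (cases c; cases c') (auto simp: corner_dart_def)

text \<open>The face through a corner dart is bounded, because an outer dart would put
  \<open>v\<close> at a corner of \<open>R\<close>. Degree 4 makes four face steps, that is two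
  turns, return to the same dart; since \<open>v\<close> never changes, the corner returns
  too.\<close>

lemma turn_turn:
  assumes deg: "\<forall>f\<in>bounded_faces R T. card f = 4" and c: "c \<in> corners"
  shows "turn (turn c) = c"
proof -
  define F where "F = face_step R T"
  define x where "x = corner_dart c"
  have tn: "(turn ^^ n) c \<in> corners" "snd ((turn ^^ n) c) = snd c" for n
    by (rule face_step_even(2)[OF c]) (induction n, auto simp: turn_snd)
  obtain n where n: "n > 0" "(turn ^^ n) c = c"
    using inj_on_finite_returns[OF finite_corners turn_in_corners inj_turn c] .
  have "(F ^^ (2 * n)) x = x" using face_step_even(1)[OF c, of n] n by (simp add: F_def x_def)
  \<comment> \<open>\<open>orbit\<close> contains positive iterates only, so periodicity must be
    known before the orbit length can be read as the period. It holds because \<open>turn\<close> is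
    injective on a finite set.\<close>
  then have self: "x \<in> orbit F x" unfolding orbit_altdef using n(1) by (metis (mono_tags, lifting) mem_Collect_eq mult_pos_pos zero_less_numeral)
  have "\<not> outer_dart R T d" if d_in: "d \<in> orbit F x" for d
  proof
    assume out: "outer_dart R T d"
    obtain m where m: "d = (F ^^ m) x" using d_in unfolding orbit_altdef by blast
    show False
    proof (cases "even m")
      case True
      then obtain k where "m = 2 * k" by (elim evenE)
      then have d: "d = corner_dart ((turn ^^ k) c)" using m face_step_even(1)[OF c, of k] by (simp add: F_def x_def)
      obtain w v where wv: "(turn ^^ k) c = (w, v)" by (cases "(turn ^^ k) c")
      have wv': "(w, v) \<in> corners" using tn(1)[of k] wv by simp
      then have w: "w \<in> T" "v \<in> verts w" "v \<notin> verts R" by (auto simp: corners_def)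
      have b: "outgoing_segment T w v \<in> boundary_segments R T"
        "fst (side w (outgoing_segment T w v)) extreme_point_of outgoing_segment T w v"
        using out d wv by (auto simp: outer_dart_def corner_dart_def)
      have "side w (outgoing_segment T w v) = (v, polygon.nxt w v)"
        using side_eq[OF w(1) outgoing(1)[OF w(1,2)] polygon.nxt_side[OF tile[OF w(1)] w(2)] outgoing(2)[OF w(1,2)]] .
      then show False using boundary_extreme[OF b(1)] b(2) w(3) by simp
    next
      case False
      then obtain k where "m = Suc (2 * k)" by (elim oddE) simp
      then have d: "d = F (corner_dart ((turn ^^ k) c))" using m face_step_even(1)[OF c, of k] by (simp add: F_def x_def)
      obtain w v where wv: "(turn ^^ k) c = (w, v)" by (cases "(turn ^^ k) c")
      then show False using out d by (simp add: F_def corner_dart_def outer_dart_def)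
    qed
  qed
  moreover have "x \<in> darts T"
  proof -
    obtain w v where wv: "c = (w, v)" by (cases c)
    then have w: "w \<in> T" "v \<in> verts w" using c by (auto simp: corners_def)
    show ?thesis
      using adjacentI[OF w(1) outgoing(1)[OF w] polygon.nxt_side[OF tile[OF w(1)] w(2)] outgoing(2)[OF w]]
      by (auto simp: x_def wv corner_dart_def darts_def)
  qed
  ultimately have "orbit F x \<in> bounded_faces R T" by (auto simp: bounded_faces_def faces_def F_def)
  then have card4: "card (orbit F x) = 4" using deg by blast
  have "card (orbit F x) = funpow_dist1 F x x"
    unfolding orbit_conv_funpow_dist1[OF self] by (subst card_image[OF inj_on_funpow_dist1[OF self]]) simp
  then have "(F ^^ 4) x = x" using funpow_dist1_prop[OF self] card4 by simp
  then have "corner_dart ((turn ^^ 2) c) = corner_dart c"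
    using face_step_even(1)[OF c, of 2] by (simp add: F_def x_def)
  then have "(turn ^^ 2) c = c" using corner_dart_inj[OF tn(1)[of 2] c] tn(2)[of 2] by blast
  then show ?thesis by (simp add: numeral_2_eq_2)
qed

end

section \<open>Junctions\<close>

lemma parallel_cong:
  assumes "polygon t" "\<And>v. v \<in> verts t \<Longrightarrow> P v = P' v"
  shows "parallel t P \<longleftrightarrow> parallel t P'"
proof -
  interpret polygon t by fact
  have "P p = P' p \<and> P q = P' q" if "(p, q) \<in> ccw_sides t" for p q
    using side_verts[OF that] assms(2) by blast
  then show ?thesis unfolding parallel_def by (auto split: prod.splits)
qed

lemma (in generic_polygon) mform_cong:
  assumes "\<And>v. v \<in> verts t \<Longrightarrow> P v = P' v" "\<And>v. v \<in> verts t \<Longrightarrow> Q v = Q' v"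
  shows "mform P Q = mform P' Q'"
  unfolding mform_def using assms by (simp cong: sum.cong)

locale quad_tiling = tiling +
  fixes \<nu> :: "point set \<Rightarrow> point" and e :: real
  assumes normals: "unit_normals T \<nu>"
    and degree: "\<forall>f\<in>bounded_faces R T. card f = 4"
    and generic_T: "w \<in> T \<Longrightarrow> (p, q) \<in> ccw_sides w \<Longrightarrow> fx e (q - p) \<noteq> 0"
    and generic_R: "(p, q) \<in> ccw_sides R \<Longrightarrow> fx e (q - p) \<noteq> 0"

sublocale quad_tiling \<subseteq> R: generic_polygon R e
  by unfold_locales (rule generic_R)

context quad_tiling
begin

lemma gtile: "w \<in> T \<Longrightarrow> generic_polygon w e"
  using tile generic_T by (simp add: generic_polygon_def generic_polygon_axioms_def)

abbreviation "vm w \<equiv> generic_polygon.vmin w e"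
abbreviation "B \<equiv> interior_segments R T"
abbreviation "inc w v \<equiv> incoming_segment T w v"
abbreviation "out w v \<equiv> outgoing_segment T w v"

lemma through_iff:
  assumes "b \<in> segments T" "v \<in> b"
  shows "v \<in> rel_interior b \<longleftrightarrow> \<not> v extreme_point_of b"
proof -
  obtain x y where "x \<noteq> y" "b = closed_segment x y" using segmentE[OF assms(1)] .
  then show ?thesis using assms(2)
    by (simp add: rel_interior_closed_segment extreme_point_of_segment open_segment_def)
qed

lemma through_unique:
  assumes c: "(w, v) \<in> corners" and b: "b \<in> segments T" "b' \<in> segments T" "v \<in> b" "v \<in> b'"
    and "\<not> v extreme_point_of b" "\<not> v extreme_point_of b'"
  shows "b = b'"
proof -
  have "T_junction T v" using T c by (auto simp: convex_tiling_def corners_def verts_def)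
  then show ?thesis using through_iff assms unfolding T_junction_def by blast
qed

text \<open>Exactly one of the two segments at a corner ends there, because the tile across it has the
  same two segments and is convex too.\<close>

lemma junction:
  assumes c: "(w, v) \<in> corners"
  obtains w' m n where "turn (w, v) = (w', v)" "(w', v) \<in> corners"
    "inc w' v = out w v" "out w' v = inc w v"
    "polygon.prv w' v - v = m *\<^sub>R (polygon.nxt w v - v)"
    "polygon.nxt w' v - v = n *\<^sub>R (polygon.prv w v - v)"
    "n > 0 \<and> m < 0 \<and> v extreme_point_of inc w v \<and> \<not> v extreme_point_of out w v \<or>
     n < 0 \<and> m > 0 \<and> \<not> v extreme_point_of inc w v \<and> v extreme_point_of out w v"
proof -
  obtain w' where w': "turn (w, v) = (w', v)" "(w', v) \<in> corners" "inc w' v = out w v"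
    using turn[OF c] by metis
  obtain w'' where w'': "turn (w', v) = (w'', v)" "inc w'' v = out w' v"
    using turn[OF w'(2)] by metis
  have "w'' = w" using turn_turn[OF degree c] w'(1) w''(1) by simp
  then have out': "out w' v = inc w v" using w'' by simp
  have w: "w \<in> T" "v \<in> verts w" and ww: "w' \<in> T" "v \<in> verts w'" using c w'(2) by (auto simp: corners_def)
  interpret w: polygon w by (rule tile[OF w(1)])
  interpret w': polygon w' by (rule tile[OF ww(1)])
  define a where "a = w.prv v - v"
  define k where "k = w.nxt v - v"
  define a' where "a' = w'.prv v - v"
  define k' where "k' = w'.nxt v - v"
  have turn1: "cross2 k a > 0"
    using w.side_turn[OF w.prv_side[OF w(2)] w.nxt_side[OF w(2)]] by (simp add: a_def k_def cross2_def algebra_simps)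
  have turn2: "cross2 k' a' > 0"
    using w'.side_turn[OF w'.prv_side[OF ww(2)] w'.nxt_side[OF ww(2)]] by (simp add: a'_def k'_def cross2_def algebra_simps)
  have b1: "inc w v \<in> segments T" "w.prv v \<in> inc w v" "v \<in> inc w v" "w'.nxt v \<in> inc w v"
    using incoming[OF w] outgoing[OF ww] out' by auto
  have b2: "out w v \<in> segments T" "w.nxt v \<in> out w v" "v \<in> out w v" "w'.prv v \<in> out w v"
    using outgoing[OF w] incoming[OF ww] w'(3) by auto
  obtain x1 y1 where "x1 \<noteq> y1" and s1: "inc w v = closed_segment x1 y1" using segmentE[OF b1(1)] .
  obtain x2 y2 where "x2 \<noteq> y2" and s2: "out w v = closed_segment x2 y2" using segmentE[OF b2(1)] .
  have nz: "a \<noteq> 0" "k \<noteq> 0" "a' \<noteq> 0" "k' \<noteq> 0" using turn1 turn2 by (auto simp: cross2_linear)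
  obtain m where m: "w'.prv v = v + m *\<^sub>R (w.nxt v - v)"
    by (rule line_param[of v x2 y2 "w.nxt v" "w'.prv v"]) (use b2 s2 nz in \<open>auto simp: k_def\<close>)
  obtain n where n: "w'.nxt v = v + n *\<^sub>R (w.prv v - v)"
    by (rule line_param[of v x1 y1 "w.prv v" "w'.nxt v"]) (use b1 s1 nz in \<open>auto simp: a_def\<close>)
  have am: "a' = m *\<^sub>R k" and kn: "k' = n *\<^sub>R a" using m n by (simp_all add: a'_def k'_def a_def k_def)
  \<comment> \<open>Both tiles turn left at \<open>v\<close> with the roles of the two directions
    exchanged, which costs a sign. So exactly one direction is reversed by the partner tile, and the
    segment in that direction continues beyond \<open>v\<close>.\<close>
  have "cross2 k' a' = - (n * m) * cross2 k a" using cross2_swap[of a k] by (simp add: am kn cross2_linear)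
  then have nm: "n * m < 0" using turn1 turn2 by (metis mult_less_0_iff neg_0_less_iff_less zero_less_mult_pos2 mult_pos_pos)
  have e1: "n > 0" if ext: "v extreme_point_of inc w v"
  proof -
    obtain r where "r > 0" "w'.nxt v - v = r *\<^sub>R (w.prv v - v)"
      by (rule segment_extreme_direction[of v x1 y1 "w.prv v" "w'.nxt v"])
         (use ext b1 s1 nz in \<open>auto simp: a_def k'_def\<close>)
    then have "(r - n) *\<^sub>R a = 0" using kn by (simp add: k'_def a_def scaleR_left_diff_distrib)
    then show ?thesis using nz \<open>r > 0\<close> by simp
  qed
  have e2: "m > 0" if ext: "v extreme_point_of out w v"
  proof -
    obtain r where "r > 0" "w'.prv v - v = r *\<^sub>R (w.nxt v - v)"
      by (rule segment_extreme_direction[of v x2 y2 "w.nxt v" "w'.prv v"])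
         (use ext b2 s2 nz in \<open>auto simp: k_def a'_def\<close>)
    then have "(r - m) *\<^sub>R k = 0" using am by (simp add: a'_def k_def scaleR_left_diff_distrib)
    then show ?thesis using nz \<open>r > 0\<close> by simp
  qed
  have "v extreme_point_of inc w v \<or> v extreme_point_of out w v"
    using through_unique[OF c b1(1) b2(1) b1(3) b2(3)] incoming_neq_outgoing[OF w] by blast
  then have "n > 0 \<and> m < 0 \<and> v extreme_point_of inc w v \<and> \<not> v extreme_point_of out w v \<or>
     n < 0 \<and> m > 0 \<and> \<not> v extreme_point_of inc w v \<and> v extreme_point_of out w v"
    using e1 e2 nm by (auto simp: mult_less_0_iff)
  then show ?thesis using that[OF w'(1,2,3) out', of m n] m n by simp
qed

section \<open>Leftmost vertices and the dimension count\<close>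

lemma vmin_local:
  assumes "w \<in> T"
  shows "vm w \<in> verts w" "fx e (polygon.prv w (vm w) - vm w) > 0" "fx e (polygon.nxt w (vm w) - vm w) > 0"
  using generic_polygon.vmin(1) generic_polygon.vmin_local gtile[OF assms] by blast+

text \<open>At its leftmost vertex both sides of a tile go to the right. The partner at that
  junction reverses one of them and so reaches further left; the descent stops at a tile whose
  leftmost vertex is a corner of \<open>R\<close>.\<close>

lemma tile_induct [consumes 1, case_names base step]:
  assumes w: "w \<in> T"
    and base: "\<And>w. w \<in> T \<Longrightarrow> vm w \<in> verts R \<Longrightarrow> P w"
    and step: "\<And>w w'. w \<in> T \<Longrightarrow> w' \<in> T \<Longrightarrow> vm w \<in> verts w' \<Longrightarrow> inc w' (vm w) = out w (vm w) \<Longrightarrow>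
      out w' (vm w) = inc w (vm w) \<Longrightarrow> P w' \<Longrightarrow> P w"
  shows "P w"
  using w
proof (induction "card {w' \<in> T. fx e (vm w') < fx e (vm w)}" arbitrary: w rule: less_induct)
  case less
  show ?case
  proof (cases "vm w \<in> verts R")
    case True
    then show ?thesis using base less.prems by blast
  next
    case False
    define v where "v = vm w"
    have c: "(w, v) \<in> corners" using False vmin_local[OF less.prems] less.prems by (simp add: corners_def v_def)
    obtain w' m n where w': "(w', v) \<in> corners" "inc w' v = out w v" "out w' v = inc w v"
      "polygon.prv w' v - v = m *\<^sub>R (polygon.nxt w v - v)" "polygon.nxt w' v - v = n *\<^sub>R (polygon.prv w v - v)"
      "m < 0 \<or> n < 0"
      using junction[OF c] by metis
    have w'T: "w' \<in> T" "v \<in> verts w'" using w'(1) by (auto simp: corners_def)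
    interpret w': generic_polygon w' e by (rule gtile[OF w'T(1)])
    have "fx e (w'.prv v - v) = m * fx e (polygon.nxt w v - v)" "fx e (w'.nxt v - v) = n * fx e (polygon.prv w v - v)"
      using w'(4,5) by (simp_all add: fx_scaleR)
    then have "fx e (w'.prv v - v) < 0 \<or> fx e (w'.nxt v - v) < 0"
      using w'(6) vmin_local[OF less.prems] by (auto simp: v_def mult_neg_pos)
    then have lt: "fx e w'.vmin < fx e v"
      using w'.vmin(2)[OF w'.prv_verts[OF w'T(2)]] w'.vmin(2)[OF w'.nxt_verts[OF w'T(2)]] by (auto simp: fx_diff)
    have "card {k \<in> T. fx e (vm k) < fx e w'.vmin} < card {k \<in> T. fx e (vm k) < fx e (vm w)}"
      by (rule psubset_card_mono) (use finite_T lt w'T in \<open>auto simp: v_def\<close>)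
    then have "P w'" using less.hyps w'T by blast
    then show ?thesis using step[OF less.prems w'T(1)] w'T w' by (simp add: v_def)
  qed
qed

text \<open>By \<open>junction\<close>, if the first segment does not end at the leftmost vertex then the second one does.\<close>

definition first_segment :: "point set \<Rightarrow> point set" where
  "first_segment w = (if vm w extreme_point_of inc w (vm w) then inc w (vm w) else out w (vm w))"

lemma first_segment:
  assumes w: "w \<in> T" and v: "vm w \<notin> verts R"
  shows "first_segment w \<in> B" "vm w extreme_point_of first_segment w"
    "\<exists>z\<in>first_segment w. fx e (z - vm w) > 0"
proof -
  have c: "(w, vm w) \<in> corners" using w v vmin_local[OF w] by (simp add: corners_def)
  show ext: "vm w extreme_point_of first_segment w"
    unfolding first_segment_def using junction[OF c] by metis
  have "first_segment w \<in> segments T"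
    using incoming(1) outgoing(1) w vmin_local[OF w] by (simp add: first_segment_def)
  then show "first_segment w \<in> B" using extreme_noncorner ext v by blast
  show "\<exists>z\<in>first_segment w. fx e (z - vm w) > 0"
    using vmin_local[OF w] incoming(2)[OF w vmin_local(1)[OF w]] outgoing(2)[OF w vmin_local(1)[OF w]]
    unfolding first_segment_def by (meson ends_in_segment subsetD)
qed

text \<open>The segment starts at \<open>vm w\<close> and goes right, so its left end recovers the
  vertex. Two tiles using it in the same role coincide by direction. In opposite roles they would
  also share the through segment, again to the right of the vertex, and would turn in opposite
  senses.\<close>

lemma first_segment_inj:
  assumes w: "w1 \<in> T" "w2 \<in> T" and vR: "vm w1 \<notin> verts R" "vm w2 \<notin> verts R"
    and eq: "first_segment w1 = first_segment w2"
  shows "w1 = w2"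
proof -
  define v where "v = vm w1"
  define b where "b = first_segment w1"
  note f1 = first_segment[OF w(1) vR(1), folded b_def v_def]
  note f2 = first_segment[OF w(2) vR(2), folded eq, folded b_def]
  obtain x y where xy: "b = closed_segment x y"
    using f1(1) segmentE by (metis Diff_iff interior_segments_def)
  have v2: "vm w2 = v"
  proof (rule ccontr)
    assume ne: "vm w2 \<noteq> v"
    obtain z1 where z1: "z1 \<in> b" "fx e (z1 - v) > 0" using f1(3) by blast
    obtain z2 where z2: "z2 \<in> b" "fx e (z2 - vm w2) > 0" using f2(3) by blast
    have vb: "v \<in> b" "vm w2 \<in> b" using f1(2) f2(2) by (auto simp: extreme_point_of_def)
    obtain k where "k > 0" "vm w2 - v = k *\<^sub>R (z1 - v)"
      by (rule segment_extreme_direction[of v x y z1 "vm w2"])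
         (use f1(2) z1 vb ne xy in \<open>auto simp: fx_linear\<close>)
    then have "fx e (vm w2 - v) > 0" using z1(2) by (simp add: fx_scaleR)
    moreover obtain k' where "k' > 0" "v - vm w2 = k' *\<^sub>R (z2 - vm w2)"
      by (rule segment_extreme_direction[of "vm w2" x y z2 v])
         (use f2(2) z2 vb ne xy in \<open>auto simp: fx_linear\<close>)
    then have "fx e (v - vm w2) > 0" using z2(2) by (simp add: fx_scaleR)
    ultimately show False by (simp add: fx_diff)
  qed
  have c1: "(w1, v) \<in> corners" and c2: "(w2, v) \<in> corners"
    using w vR vmin_local(1)[OF w(1)] vmin_local(1)[OF w(2)] unfolding corners_def v2 by (simp_all add: v_def[symmetric] v2)
  have vv: "v \<in> verts w1" "v \<in> verts w2" using c1 c2 by (auto simp: corners_def)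
  interpret w1: generic_polygon w1 e by (rule gtile[OF w(1)])
  interpret w2: generic_polygon w2 e by (rule gtile[OF w(2)])
  define a1 where "a1 = w1.prv v - v"
  define k1 where "k1 = w1.nxt v - v"
  define a2 where "a2 = w2.prv v - v"
  define k2 where "k2 = w2.nxt v - v"
  have fpos: "fx e a1 > 0" "fx e k1 > 0" "fx e a2 > 0" "fx e k2 > 0"
    using vmin_local[OF w(1)] vmin_local[OF w(2)] v2 by (simp_all add: v_def a1_def k1_def a2_def k2_def)
  have t1: "cross2 k1 a1 > 0"
    using w1.side_turn[OF w1.prv_side[OF vv(1)] w1.nxt_side[OF vv(1)]] by (simp add: a1_def k1_def cross2_def algebra_simps)
  have t2: "cross2 k2 a2 > 0"
    using w2.side_turn[OF w2.prv_side[OF vv(2)] w2.nxt_side[OF vv(2)]] by (simp add: a2_def k2_def cross2_def algebra_simps)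
  have ins: "inc w1 v \<in> segments T" "out w1 v \<in> segments T" "inc w2 v \<in> segments T" "out w2 v \<in> segments T"
    "v \<in> inc w1 v" "v \<in> out w1 v" "v \<in> inc w2 v" "v \<in> out w2 v"
    "w1.prv v \<in> inc w1 v" "w1.nxt v \<in> out w1 v" "w2.prv v \<in> inc w2 v" "w2.nxt v \<in> out w2 v"
    using incoming[OF w(1) vv(1)] outgoing[OF w(1) vv(1)] incoming[OF w(2) vv(2)] outgoing[OF w(2) vv(2)] by auto
  have same: "\<exists>k>0. s - v = k *\<^sub>R (r - v)" if c: "s \<in> c" "r \<in> c" "v \<in> c" "c \<in> segments T" and f: "fx e (s - v) > 0" "fx e (r - v) > 0" for s r c
  proof -
    obtain p q where pq: "c = closed_segment p q" using segmentE[OF c(4)] by blast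
    have "r \<noteq> v" using f(2) by (auto simp: fx_linear)
    then obtain k where k: "s = v + k *\<^sub>R (r - v)" using line_param[of v p q r s] c(1-3) unfolding pq by metis
    then have "fx e (s - v) = k * fx e (r - v)" by (simp add: fx_scaleR)
    then have "k > 0" using f by (simp add: zero_less_mult_iff)
    then show ?thesis using k by auto
  qed
  have e1: "(b = inc w1 v \<and> \<not> v extreme_point_of out w1 v) \<or> (b = out w1 v \<and> \<not> v extreme_point_of inc w1 v)"
    unfolding b_def first_segment_def v_def[symmetric] by (rule junction[OF c1]) auto
  have e2: "(b = inc w2 v \<and> \<not> v extreme_point_of out w2 v) \<or> (b = out w2 v \<and> \<not> v extreme_point_of inc w2 v)"
    unfolding b_def eq unfolding first_segment_def v2 by (rule junction[OF c2]) auto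
  have cross_False: False if "k2 = l *\<^sub>R a1" "a2 = m *\<^sub>R k1" "l > 0" "m > 0" for l m
  proof -
    have "cross2 k2 a2 = - ((l * m) * cross2 k1 a1)" using cross2_swap[of a1 k1] by (simp add: that cross2_linear)
    moreover have "(l * m) * cross2 k1 a1 > 0" using that t1 by simp
    ultimately show False using t2 by linarith
  qed
  from e1 e2 show ?thesis
  proof (elim disjE conjE)
    assume "b = inc w1 v" "b = inc w2 v"
    then obtain k where "k > 0" "w2.prv v - v = k *\<^sub>R (w1.prv v - v)"
      using same[of "w2.prv v" b "w1.prv v"] ins fpos by (auto simp: a1_def a2_def)
    then show ?thesis using tile_eq_in[OF w w1.prv_side[OF vv(1)] w2.prv_side[OF vv(2)]] by blast
  next
    assume "b = out w1 v" "b = out w2 v"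
    then obtain k where "k > 0" "w2.nxt v - v = k *\<^sub>R (w1.nxt v - v)"
      using same[of "w2.nxt v" b "w1.nxt v"] ins fpos by (auto simp: k1_def k2_def)
    then show ?thesis using tile_eq_out[OF w w1.nxt_side[OF vv(1)] w2.nxt_side[OF vv(2)]] by blast
  next
    assume b: "b = inc w1 v" "b = out w2 v" and ne: "\<not> v extreme_point_of out w1 v" "\<not> v extreme_point_of inc w2 v"
    have thr: "out w1 v = inc w2 v" using through_unique[OF c1 ins(2,3,6,7) ne] .
    obtain l where l: "l > 0" "w2.nxt v - v = l *\<^sub>R (w1.prv v - v)"
      using same[of "w2.nxt v" b "w1.prv v"] ins fpos b by (auto simp: a1_def k2_def)
    obtain m where m: "m > 0" "w2.prv v - v = m *\<^sub>R (w1.nxt v - v)"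
      using same[of "w2.prv v" "inc w2 v" "w1.nxt v"] ins fpos thr by (auto simp: k1_def a2_def)
    show ?thesis using cross_False[of l m] l m by (simp add: a1_def a2_def k1_def k2_def)
  next
    assume b: "b = out w1 v" "b = inc w2 v" and ne: "\<not> v extreme_point_of inc w1 v" "\<not> v extreme_point_of out w2 v"
    have thr: "inc w1 v = out w2 v" using through_unique[OF c1 ins(1,4,5,8) ne] .
    obtain l where l: "l > 0" "w2.nxt v - v = l *\<^sub>R (w1.prv v - v)"
      using same[of "w2.nxt v" "inc w1 v" "w1.prv v"] ins fpos thr by (auto simp: a1_def k2_def)
    obtain m where m: "m > 0" "w2.prv v - v = m *\<^sub>R (w1.nxt v - v)"
      using same[of "w2.prv v" b "w1.nxt v"] ins fpos b by (auto simp: k1_def a2_def)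
    show ?thesis using cross_False[of l m] l m by (simp add: a1_def a2_def k1_def k2_def)
  qed
qed

text \<open>The tile and \<open>R\<close> both lie on the left of the common line.\<close>

lemma tile_side_on_R:
  assumes w: "w \<in> T" and s: "(p, q) \<in> ccw_sides w" and S: "(P, Q) \<in> ccw_sides R"
    and sub: "closed_segment p q \<subseteq> closed_segment P Q"
  obtains k where "k > 0" "q - p = k *\<^sub>R (Q - P)"
proof -
  interpret w: polygon w by (rule tile[OF w])
  obtain o' where o': "o' \<in> interior w" using w.interior_nonempty by blast
  then have oR: "o' \<in> interior R" using interior_mono[OF tile_subset[OF w]] by blast
  have PQ: "Q - P \<noteq> 0" using R.side_neq[OF S] by simp
  have z: "cross2 (Q - P) (p - P) = 0" "cross2 (Q - P) (q - P) = 0" using sub cross2_segment by blast+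
  then have "cross2 (Q - P) (q - p) = 0" by (simp add: cross2_linear)
  then obtain k where k: "q - p = k *\<^sub>R (Q - P)" using cross2_parallel[OF PQ] by blast
  have "0 < k * cross2 (Q - P) (o' - p)" using w.side_interior[OF s o'] unfolding k cross2_scaleR_left .
  moreover have "cross2 (Q - P) (o' - p) = cross2 (Q - P) (o' - P)" using z by (simp add: cross2_linear)
  moreover have "cross2 (Q - P) (o' - P) > 0" by (rule R.side_interior[OF S oR])
  ultimately have "k > 0" by (simp add: zero_less_mult_iff)
  then show ?thesis using k that by blast
qed

text \<open>No interior segment reaches a corner of \<open>R\<close>, so the sides of a tile at such
  a corner run along the sides of \<open>R\<close> there.\<close>

lemma corner_tile_sides:
  assumes w: "w \<in> T" and v: "v \<in> verts w" "v \<in> verts R"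
  obtains k l where "k > 0" "l > 0" "polygon.nxt w v - v = k *\<^sub>R (R.nxt v - v)" "v - polygon.prv w v = l *\<^sub>R (v - R.prv v)"
proof -
  interpret w: polygon w by (rule tile[OF w])
  have bo: "out w v \<in> boundary_segments R T" "v extreme_point_of out w v"
    using corner_of_R[OF v(2) outgoing(1)[OF w v(1)]] outgoing(2)[OF w v(1)] by auto
  have bi: "inc w v \<in> boundary_segments R T" "v extreme_point_of inc w v"
    using corner_of_R[OF v(2) incoming(1)[OF w v(1)]] incoming(2)[OF w v(1)] by auto
  obtain P Q where PQ: "(P, Q) \<in> ccw_sides R" "out w v = closed_segment P Q" using boundary_segmentE[OF bo(1)] .
  obtain k where k: "k > 0" "w.nxt v - v = k *\<^sub>R (Q - P)"
    by (rule tile_side_on_R[OF w w.nxt_side[OF v(1)] PQ(1)]) (use outgoing(2)[OF w v(1)] PQ in auto)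
  have "v \<noteq> Q"
  proof
    assume vQ: "v = Q"
    have "w.nxt v \<in> closed_segment P Q" using outgoing(2)[OF w v(1)] PQ by auto
    then obtain u where u: "u \<le> 1" "w.nxt v = (1 - u) *\<^sub>R P + u *\<^sub>R Q" by (auto simp: in_segment)
    have "w.nxt v - v = - (1 - u) *\<^sub>R (Q - P)" unfolding u(2) by (simp add: vQ algebra_simps)
    then have "(k + (1 - u)) *\<^sub>R (Q - P) = 0" using k by (simp add: algebra_simps)
    then show False using k(1) u(1) R.side_neq[OF PQ(1)] by simp
  qed
  then have "v = P" using bo(2) PQ(2) by (simp add: extreme_point_of_segment)
  then have Q: "Q = R.nxt v" "P = v" using R.nxt_eq[OF PQ(1)] by auto
  obtain P' Q' where PQ': "(P', Q') \<in> ccw_sides R" "inc w v = closed_segment P' Q'" using boundary_segmentE[OF bi(1)] .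
  obtain l where l: "l > 0" "v - w.prv v = l *\<^sub>R (Q' - P')"
    by (rule tile_side_on_R[OF w w.prv_side[OF v(1)] PQ'(1)]) (use incoming(2)[OF w v(1)] PQ' in auto)
  have "v \<noteq> P'"
  proof
    assume vP: "v = P'"
    have "w.prv v \<in> closed_segment P' Q'" using incoming(2)[OF w v(1)] PQ' by auto
    then obtain u where u: "0 \<le> u" "w.prv v = (1 - u) *\<^sub>R P' + u *\<^sub>R Q'" by (auto simp: in_segment)
    have "v - w.prv v = - u *\<^sub>R (Q' - P')" unfolding u(2) by (simp add: vP algebra_simps)
    then have "(l + u) *\<^sub>R (Q' - P') = 0" using l by (simp add: algebra_simps)
    then show False using l(1) u(1) R.side_neq[OF PQ'(1)] by simp
  qed
  then have "v = Q'" using bi(2) PQ'(2) by (simp add: extreme_point_of_segment)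
  then have "P' = R.prv v" "Q' = v" using R.prv_eq[OF PQ'(1)] by auto
  then show ?thesis using that[OF k(1) l(1)] k l Q by simp
qed

text \<open>\<open>corner_tile_sides\<close> makes the leftmost vertex of the tile a local minimum
  of \<open>R\<close>, hence equal to \<open>R.vmin\<close>; the direction of the outgoing side then
  determines the tile.\<close>

lemma leftmost_tile_unique:
  assumes w: "w1 \<in> T" "w2 \<in> T" and v: "vm w1 \<in> verts R" "vm w2 \<in> verts R"
  shows "w1 = w2"
proof -
  have eq: "vm w = R.vmin" if w: "w \<in> T" "vm w \<in> verts R" for w
  proof -
    obtain k l where kl: "k > 0" "l > 0" "polygon.nxt w (vm w) - vm w = k *\<^sub>R (R.nxt (vm w) - vm w)"
      "vm w - polygon.prv w (vm w) = l *\<^sub>R (vm w - R.prv (vm w))"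
      using corner_tile_sides[OF w(1) vmin_local(1)[OF w(1)] w(2)] .
    have "fx e (polygon.nxt w (vm w) - vm w) = k * fx e (R.nxt (vm w) - vm w)" unfolding kl(3) fx_scaleR ..
    then have 1: "fx e (R.nxt (vm w) - vm w) > 0" using vmin_local[OF w(1)] kl(1) by (simp add: zero_less_mult_iff)
    have "fx e (vm w - polygon.prv w (vm w)) = l * fx e (vm w - R.prv (vm w))" unfolding kl(4) fx_scaleR ..
    then have "fx e (polygon.prv w (vm w) - vm w) = l * fx e (R.prv (vm w) - vm w)" by (simp add: fx_diff algebra_simps)
    then have 2: "fx e (R.prv (vm w) - vm w) > 0" using vmin_local[OF w(1)] kl(2) by (simp add: zero_less_mult_iff)
    show ?thesis by (rule R.vmin_unique[OF w(2) 2 1])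
  qed
  define v where "v = R.vmin"
  have vw: "v \<in> verts w1" "v \<in> verts w2" "v \<in> verts R"
    using eq[OF w(1) v(1)] eq[OF w(2) v(2)] vmin_local(1)[OF w(1)] vmin_local(1)[OF w(2)] v
    unfolding v_def by simp_all
  obtain k1 where k1: "k1 > 0" "polygon.nxt w1 v - v = k1 *\<^sub>R (R.nxt v - v)"
    using corner_tile_sides[OF w(1) vw(1,3)] by metis
  obtain k2 where k2: "k2 > 0" "polygon.nxt w2 v - v = k2 *\<^sub>R (R.nxt v - v)"
    using corner_tile_sides[OF w(2) vw(2,3)] by metis
  have "polygon.nxt w2 v - v = (k2 / k1) *\<^sub>R (polygon.nxt w1 v - v)" unfolding k1(2) k2(2) using k1(1) by simp
  then show ?thesis
    using tile_eq_out[OF w polygon.nxt_side[OF tile[OF w(1)] vw(1)] polygon.nxt_side[OF tile[OF w(2)] vw(2)], of "k2 / k1"]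
      k1(1) k2(1) by simp
qed

lemma interior_segment_tile:
  assumes b: "b \<in> B"
  obtains w p q where "w \<in> T" "(p, q) \<in> ccw_sides w" "closed_segment p q \<subseteq> b"
proof -
  have bT: "b \<in> segments T" using b by (simp add: interior_segments_def)
  obtain x y where xy: "x \<noteq> y" "b = closed_segment x y" using segmentE[OF bT] .
  define d where "d = (1/2) *\<^sub>R (y - x)"
  have d0: "d \<noteq> 0" using xy by (simp add: d_def)
  obtain r where r: "r > 0" "x + d \<in> b" "x + d + r *\<^sub>R perp d \<in> R"
    by (rule interior_segment_side[OF b, of x y "perp d", folded d_def]) (use xy in auto)
  show ?thesis
  proof (rule tile_along_segment[OF bT, of x d "r *\<^sub>R perp d"])
    show "x \<in> b" using xy by simp
    show "x + d \<in> b" "x + d + r *\<^sub>R perp d \<in> R" by (rule r(2), rule r(3))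
    show "cross2 d (r *\<^sub>R perp d) \<noteq> 0" using cross2_perp_pos[OF d0] r(1) by (simp add: cross2_linear)
  qed (use that in blast)
qed

lemma interior_segment_outgoing:
  assumes b: "b \<in> B"
  obtains w v where "w \<in> T" "v \<in> verts w" "b = out w v"
proof -
  obtain w p q where w: "w \<in> T" "(p, q) \<in> ccw_sides w" "closed_segment p q \<subseteq> b" using interior_segment_tile[OF b] .
  have "out w p = b" using outgoing_eq[OF w(1) _ w(2,3)] b by (simp add: interior_segments_def)
  then show ?thesis using that[OF w(1) polygon.side_verts(1)[OF tile[OF w(1)] w(2)]] by simp
qed

lemma finite_B: "finite B"
proof (rule finite_subset)
  show "B \<subseteq> (\<lambda>(w, v). out w v) ` (Sigma T verts)"
  proof
    fix b assume "b \<in> B"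
    then obtain w v where "w \<in> T" "v \<in> verts w" "b = out w v" by (rule interior_segment_outgoing)
    then show "b \<in> (\<lambda>(w, v). out w v) ` (Sigma T verts)" by force
  qed
  show "finite ((\<lambda>(w, v). out w v) ` (Sigma T verts))"
    using finite_T polygon.finite_verts[OF tile] by blast
qed

lemma card_T_le: "card T \<le> card B + 1"
proof -
  define L where "L = {w \<in> T. vm w \<notin> verts R}"
  have "inj_on first_segment L" using first_segment_inj by (auto simp: inj_on_def L_def)
  moreover have "first_segment ` L \<subseteq> B" using first_segment(1) by (auto simp: L_def)
  ultimately have "card L \<le> card B" using card_inj_on_le finite_B by blast
  moreover have "card (T - L) \<le> 1"
    using leftmost_tile_unique finite_T by (auto simp: L_def card_le_Suc0_iff_eq)
  moreover have "card T = card L + card (T - L)"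
    using finite_T card_Diff_subset[of L T] card_mono[of T L] by (auto simp: L_def)
  ultimately show ?thesis by linarith
qed

section \<open>Homology tilings\<close>

text \<open>Cramer's rule for the intersection of the lines with normals \<open>\<nu> b\<close> and \<open>\<nu> b'\<close>.\<close>

definition isect :: "(point set \<Rightarrow> real) \<Rightarrow> point set \<Rightarrow> point set \<Rightarrow> point" where
  "isect j b b' = (1 / cross2 (\<nu> b) (\<nu> b')) *\<^sub>R (j b' *\<^sub>R perp (\<nu> b) - j b *\<^sub>R perp (\<nu> b'))"

lemma isect_on:
  assumes "cross2 (\<nu> b) (\<nu> b') \<noteq> 0"
  shows "\<nu> b \<bullet> isect j b b' = j b" "\<nu> b' \<bullet> isect j b b' = j b'"
proof -
  have "\<nu> b \<bullet> perp (\<nu> b') = - cross2 (\<nu> b) (\<nu> b')" "\<nu> b' \<bullet> perp (\<nu> b) = cross2 (\<nu> b) (\<nu> b')"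
    "\<nu> c \<bullet> perp (\<nu> c) = 0" for c
    by (simp_all add: perp_def cross2_def inner_vec_def sum_2)
  then show "\<nu> b \<bullet> isect j b b' = j b" "\<nu> b' \<bullet> isect j b b' = j b'"
    using assms by (simp_all add: isect_def inner_diff_right)
qed

lemma isect_unique:
  assumes D: "cross2 (\<nu> b) (\<nu> b') \<noteq> 0" and x: "\<nu> b \<bullet> x = j b" "\<nu> b' \<bullet> x = j b'"
  shows "x = isect j b b'"
proof -
  have "cross2 (\<nu> b) (\<nu> b') *\<^sub>R x = (\<nu> b' \<bullet> x) *\<^sub>R perp (\<nu> b) - (\<nu> b \<bullet> x) *\<^sub>R perp (\<nu> b')"
    by (simp add: point_eq_iff perp_def cross2_def inner_vec_def sum_2 algebra_simps)
  then have "(1 / cross2 (\<nu> b) (\<nu> b')) *\<^sub>R (cross2 (\<nu> b) (\<nu> b') *\<^sub>R x) = isect j b b'"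
    unfolding isect_def x by simp
  then show ?thesis using D by simp
qed

lemma isect_swap: "isect j b b' = isect j b' b"
proof -
  have "isect j b b' = (- (1 / cross2 (\<nu> b) (\<nu> b'))) *\<^sub>R (j b *\<^sub>R perp (\<nu> b') - j b' *\<^sub>R perp (\<nu> b))"
    unfolding isect_def scaleR_minus_left scaleR_minus_right[symmetric] by simp
  also have "- (1 / cross2 (\<nu> b) (\<nu> b')) = 1 / cross2 (\<nu> b') (\<nu> b)"
    using cross2_swap[of "\<nu> b"] by simp
  finally show ?thesis by (simp add: isect_def)
qed

lemma isect_linear:
  "isect (\<lambda>b. r * j b + s * k b) b b' = r *\<^sub>R isect j b b' + s *\<^sub>R isect k b b'"
  unfolding isect_def point_eq_iff by (simp add: algebra_simps add_divide_distrib diff_divide_distrib)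

section \<open>Areas as quadratic forms in the intercepts\<close>

lemma normal_unit: "b \<in> segments T \<Longrightarrow> norm (\<nu> b) = 1"
  and normal_orth: "b \<in> segments T \<Longrightarrow> x \<in> b \<Longrightarrow> y \<in> b \<Longrightarrow> \<nu> b \<bullet> (x - y) = 0"
  using normals by (auto simp: unit_normals_def)

lemma orth_normal:
  assumes b: "b \<in> segments T" and d: "\<nu> b \<bullet> d = 0"
  obtains k where "d = k *\<^sub>R perp (\<nu> b)"
proof -
  have "\<nu> b \<noteq> 0" using normal_unit[OF b] by auto
  then have "perp (\<nu> b) \<noteq> 0" by (auto simp: perp_def point_eq_iff)
  moreover have "cross2 (perp (\<nu> b)) d = 0" using d by (simp add: cross2_perp_left)
  ultimately show ?thesis using cross2_parallel that by metis
qed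

lemma segment_direction:
  assumes b: "b \<in> segments T" and xy: "x \<in> b" "y \<in> b" "x \<noteq> y"
  obtains k where "k \<noteq> 0" "y - x = k *\<^sub>R perp (\<nu> b)"
proof -
  obtain k where "y - x = k *\<^sub>R perp (\<nu> b)" using orth_normal[OF b normal_orth[OF b xy(2,1)]] .
  moreover have "k \<noteq> 0" using calculation xy(3) by (metis eq_iff_diff_eq_0 scaleR_zero_left)
  ultimately show ?thesis using that by blast
qed

lemma segment_slope:
  assumes "b \<in> segments T" "x \<in> b" "y \<in> b" "x \<noteq> y"
  shows "slope e (y - x) = slope e (perp (\<nu> b))"
proof -
  obtain k where "k \<noteq> 0" "y - x = k *\<^sub>R perp (\<nu> b)" using segment_direction[OF assms] .
  then show ?thesis by (simp add: slope_scaleR)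
qed

lemma normals_independent:
  assumes w: "w \<in> T" and v: "v \<in> verts w"
  shows "cross2 (\<nu> (inc w v)) (\<nu> (out w v)) \<noteq> 0"
proof
  assume 0: "cross2 (\<nu> (inc w v)) (\<nu> (out w v)) = 0"
  interpret w: polygon w by (rule tile[OF w])
  have p: "w.prv v \<in> inc w v" "v \<in> inc w v" "w.prv v \<noteq> v"
    using incoming(2)[OF w v] w.side_neq[OF w.prv_side[OF v]] by auto
  have n: "v \<in> out w v" "w.nxt v \<in> out w v" "v \<noteq> w.nxt v"
    using outgoing(2)[OF w v] w.side_neq[OF w.nxt_side[OF v]] by auto
  obtain k where k: "v - w.prv v = k *\<^sub>R perp (\<nu> (inc w v))" using segment_direction[OF incoming(1)[OF w v] p] .
  obtain l where l: "w.nxt v - v = l *\<^sub>R perp (\<nu> (out w v))" using segment_direction[OF outgoing(1)[OF w v] n] .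
  have "cross2 (v - w.prv v) (w.nxt v - v) = 0" unfolding k l by (simp add: cross2_linear cross2_perp_perp 0)
  then show False using w.side_turn[OF w.prv_side[OF v] w.nxt_side[OF v]] by simp
qed

text \<open>All lines may move here, which makes the path linear in \<open>j\<close>; the fixed
  lines of \<open>R\<close> return as the support condition on displacements.\<close>

definition path :: "(point set \<Rightarrow> real) \<Rightarrow> point set \<Rightarrow> point \<Rightarrow> point" where
  "path j w v = isect j (inc w v) (out w v)"

lemma path_linear:
  "path (\<lambda>b. r * j b + s * k b) w = (\<lambda>v. r *\<^sub>R path j w v + s *\<^sub>R path k w v)"
  by (rule ext) (simp add: path_def isect_linear)

lemma path_parallel:
  assumes w: "w \<in> T"
  shows "parallel w (path j w)"
  unfolding parallel_def
proof safe
  fix p q assume s: "(p, q) \<in> ccw_sides w"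
  interpret w: polygon w by (rule tile[OF w])
  note v = w.side_verts[OF s]
  define b where "b = out w p"
  have b: "b \<in> segments T" "closed_segment p q \<subseteq> b"
    using outgoing[OF w v(1)] w.nxt_eq[OF s] by (auto simp: b_def)
  have bq: "inc w q = b" by (rule incoming_eq[OF w b(1) s b(2)])
  have "\<nu> b \<bullet> path j w p = j b" "\<nu> b \<bullet> path j w q = j b"
    using isect_on(2)[OF normals_independent[OF w v(1)], of j] isect_on(1)[OF normals_independent[OF w v(2)], of j]
    by (simp_all add: path_def b_def[symmetric] bq)
  then have "\<nu> b \<bullet> (path j w q - path j w p) = 0" by (simp add: inner_diff_right)
  then obtain l where l: "path j w q - path j w p = l *\<^sub>R perp (\<nu> b)" by (rule orth_normal[OF b(1)])
  obtain k where k: "k \<noteq> 0" "q - p = k *\<^sub>R perp (\<nu> b)"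
    by (rule segment_direction[OF b(1), of p q]) (use b(2) w.side_neq[OF s] in auto)
  have "path j w q - path j w p = (l / k) *\<^sub>R (q - p)" unfolding l k(2) using k(1) by simp
  then show "\<exists>a. path j w q - path j w p = a *\<^sub>R (q - p)" by blast
qed

lemma intercept_eq:
  assumes b: "b \<in> segments T" and x: "x \<in> b"
  shows "intercept \<nu> b = \<nu> b \<bullet> x"
  unfolding intercept_def
proof (rule the_equality)
  show "\<forall>y\<in>b. \<nu> b \<bullet> y = \<nu> b \<bullet> x" using normal_orth[OF b _ x] by (simp add: inner_diff_right)
qed (use x in auto)

lemma path_intercept:
  assumes w: "w \<in> T" and v: "v \<in> verts w"
  shows "path (intercept \<nu>) w v = v"
proof -
  have "v \<in> inc w v" "v \<in> out w v" using incoming(2)[OF w v] outgoing(2)[OF w v] by auto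
  then have "v = isect (intercept \<nu>) (inc w v) (out w v)"
    using intercept_eq incoming(1)[OF w v] outgoing(1)[OF w v]
    by (intro isect_unique normals_independent[OF w v]) auto
  then show ?thesis by (simp add: path_def)
qed

definition bil :: "point set \<Rightarrow> (point set \<Rightarrow> real) \<Rightarrow> (point set \<Rightarrow> real) \<Rightarrow> real" where
  "bil w j k = generic_polygon.mform w e (path j w) (path k w)"

lemma bil_intercept:
  assumes w: "w \<in> T"
  shows "bil w (intercept \<nu>) k = generic_polygon.mform w e (\<lambda>v. v) (path k w)"
  unfolding bil_def by (rule generic_polygon.mform_cong[OF gtile[OF w]]) (simp_all add: path_intercept[OF w])

lemma bil_intercept_intercept:
  assumes w: "w \<in> T"
  shows "bil w (intercept \<nu>) (intercept \<nu>) = generic_polygon.mform w e (\<lambda>v. v) (\<lambda>v. v)"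
  unfolding bil_def by (rule generic_polygon.mform_cong[OF gtile[OF w]]) (simp_all add: path_intercept[OF w])

lemma corner_segments_boundary:
  assumes w: "w \<in> T" and v: "v \<in> verts w" "v \<in> verts R"
  shows "inc w v \<notin> B" "out w v \<notin> B"
  using corner_of_R(1)[OF v(2) incoming(1)[OF w v(1)]] corner_of_R(1)[OF v(2) outgoing(1)[OF w v(1)]]
    incoming(2)[OF w v(1)] outgoing(2)[OF w v(1)]
  by (auto simp: interior_segments_def)

text \<open>Each path is constant by rigidity of its tile. The constant is 0 for a tile at the
  leftmost corner of \<open>R\<close>, where both displacements vanish, and it spreads to the other
  tiles because partners at a junction share the intersection point. A line through 0 has intercept
  0.\<close>

lemma path_rigid:
  assumes supp: "\<And>b. b \<notin> B \<Longrightarrow> u b = 0"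
    and zero: "\<And>w. w \<in> T \<Longrightarrow> bil w (intercept \<nu>) u = 0 \<and> bil w u u = 0"
  shows "u = (\<lambda>b. 0)"
proof
  have const: "path u w v = path u w (vm w)" if w: "w \<in> T" "v \<in> verts w" for w v
    using generic_polygon.lorentzian_rigid[OF gtile[OF w(1)] path_parallel[OF w(1)] _ _ w(2), of u]
      zero[OF w(1)] bil_intercept[OF w(1), of u] by (simp add: bil_def)
  have "\<forall>v\<in>verts w. path u w v = 0" if "w \<in> T" for w
    using that
  proof (induction rule: tile_induct)
    case (base w)
    have "path u w (vm w) = 0"
      using corner_segments_boundary[OF base(1) vmin_local(1)[OF base(1)] base(2)] supp
      by (simp add: path_def isect_def)
    then show ?case using const[OF base(1)] by simp
  next
    case (step w w')
    have "path u w (vm w) = path u w' (vm w)"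
      using step by (simp add: path_def isect_swap[of u "inc w (vm w)"])
    then show ?case using const[OF step(1)] step by simp
  qed
  fix b show "u b = 0"
  proof (cases "b \<in> B")
    case True
    then obtain w v where w: "w \<in> T" "v \<in> verts w" "b = out w v" by (rule interior_segment_outgoing)
    then have "path u w v = 0" using \<open>\<And>w. w \<in> T \<Longrightarrow> \<forall>v\<in>verts w. path u w v = 0\<close> by blast
    then show ?thesis using isect_on(2)[OF normals_independent[OF w(1,2)], of u] w(3) by (simp add: path_def)
  qed (rule supp)
qed

text \<open>The contributions of two tiles that are adjacent along the segment ending at a junction
  cancel; those of the corners of \<open>R\<close> do not depend on the interior intercepts.\<close>

lemma path_total:
  assumes u: "\<And>b. b \<notin> B \<Longrightarrow> u b = 0"
  shows "(\<Sum>w\<in>T. bil w (\<lambda>b. intercept \<nu> b + u b) (\<lambda>b. intercept \<nu> b + u b)) =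
    (\<Sum>w\<in>T. bil w (intercept \<nu>) (intercept \<nu>))"
proof -
  define S where "S b = slope e (perp (\<nu> b))" for b
  define G where "G j = (\<lambda>(w, v). (S (inc w v) - S (out w v)) * (fx e (path j w v))\<^sup>2)" for j
  define D where "D = Sigma T verts - corners"
  have coef: "generic_polygon.coef w e v = S (inc w v) - S (out w v)" if w: "w \<in> T" and v: "v \<in> verts w" for w v
  proof -
    interpret w: generic_polygon w e by (rule gtile[OF w])
    have "slope e (v - w.prv v) = S (inc w v)" unfolding S_def
      by (rule segment_slope[OF incoming(1)[OF w v]]) (use incoming(2)[OF w v] w.side_neq[OF w.prv_side[OF v]] in auto)
    moreover have "slope e (w.nxt v - v) = S (out w v)" unfolding S_def
      by (rule segment_slope[OF outgoing(1)[OF w v]]) (use outgoing(2)[OF w v] w.side_neq[OF w.nxt_side[OF v]] in auto)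
    ultimately show ?thesis by (simp add: w.coef_def)
  qed
  have bilG: "bil w j j = (\<Sum>v\<in>verts w. G j (w, v)) / 2" if w: "w \<in> T" for w j
    unfolding bil_def generic_polygon.mform_def[OF gtile[OF w]] G_def
    by (rule arg_cong[of _ _ "\<lambda>x. x / 2"], rule sum.cong[OF refl]) (simp add: coef[OF w] power2_eq_square)
  have fin: "finite (Sigma T verts)" using finite_T polygon.finite_verts[OF tile] by blast
  have sub: "corners \<subseteq> Sigma T verts" by (auto simp: corners_def)
  have cancel: "sum (G j) corners = 0" for j
  proof -
    \<comment> \<open>Reindexing by \<open>turn\<close> negates the sum: the partner corner has the
      same intersection point and the opposite slope difference. This avoids choosing
      representatives of the pairs.\<close>
    have "bij_betw turn corners corners"
      unfolding bij_betw_def using inj_turn endo_inj_surj[OF finite_corners turn_in_corners inj_turn] by blast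
    then have "sum (G j) corners = (\<Sum>c\<in>corners. G j (turn c))"
      by (simp add: sum.reindex_bij_betw)
    also have "\<dots> = (\<Sum>c\<in>corners. - G j c)"
    proof (rule sum.cong[OF refl])
      fix c assume c: "c \<in> corners"
      obtain w v where wv: "c = (w, v)" by (cases c)
      obtain w' where w': "turn (w, v) = (w', v)" "inc w' v = out w v" "out w' v = inc w v"
        using junction c wv by metis
      then show "G j (turn c) = - G j c"
        by (simp add: wv G_def path_def isect_swap[of j "out w v"] algebra_simps)
    qed
    finally show ?thesis by (simp add: sum_negf)
  qed
  have half: "(\<Sum>w\<in>T. bil w j j) = sum (G j) D / 2" for j
  proof -
    have "(\<Sum>w\<in>T. bil w j j) = (\<Sum>w\<in>T. \<Sum>v\<in>verts w. G j (w, v)) / 2"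
      unfolding sum_divide_distrib by (rule sum.cong[OF refl]) (simp add: bilG sum_divide_distrib)
    also have "(\<Sum>w\<in>T. \<Sum>v\<in>verts w. G j (w, v)) = sum (G j) (Sigma T verts)"
      using finite_T polygon.finite_verts[OF tile] by (subst sum.Sigma) auto
    also have "\<dots> = sum (G j) D + sum (G j) corners"
      unfolding D_def by (rule sum.subset_diff[OF sub fin])
    finally show ?thesis by (simp add: cancel)
  qed
  have "sum (G (\<lambda>b. intercept \<nu> b + u b)) D = sum (G (intercept \<nu>)) D"
  proof (rule sum.cong[OF refl])
    fix c assume "c \<in> D"
    then obtain w v where c: "c = (w, v)" "w \<in> T" "v \<in> verts w" "v \<in> verts R" by (auto simp: D_def corners_def)
    have "path (\<lambda>b. intercept \<nu> b + u b) w v = path (intercept \<nu>) w v"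
      using u corner_segments_boundary[OF c(2-4)] by (simp add: path_def isect_def)
    then show "G (\<lambda>b. intercept \<nu> b + u b) c = G (intercept \<nu>) c" by (simp add: c G_def)
  qed
  then show ?thesis unfolding half by (rule arg_cong)
qed

lemma continuous_on_bil:
  assumes w: "w \<in> T"
  shows "continuous_on UNIV (\<lambda>u. bil w u u)"
proof -
  have fxp: "continuous_on UNIV (\<lambda>u. fx e (path u w v))" for v
  proof -
    have "fx e (path u w v) = 1 / cross2 (\<nu> (inc w v)) (\<nu> (out w v)) *
        (u (out w v) * fx e (perp (\<nu> (inc w v))) - u (inc w v) * fx e (perp (\<nu> (out w v))))" for u
      by (simp add: path_def isect_def fx_linear)
    moreover have "continuous_on UNIV (\<lambda>u. 1 / cross2 (\<nu> (inc w v)) (\<nu> (out w v)) *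
        (u (out w v) * fx e (perp (\<nu> (inc w v))) - u (inc w v) * fx e (perp (\<nu> (out w v)))))"
      by (intro continuous_on_mult continuous_on_diff continuous_on_const continuous_on_eval)
    ultimately show ?thesis by simp
  qed
  show ?thesis
    unfolding bil_def generic_polygon.mform_def[OF gtile[OF w]]
    by (intro continuous_on_divide continuous_on_sum continuous_on_mult continuous_on_const fxp) simp
qed

section \<open>The tiling as a Lorentzian family\<close>

lemma lorentz_family: "lorentz_family T B bil (intercept \<nu>)"
proof
  show "finite T" by (rule finite_T)
  show "finite B" by (rule finite_B)
  show "card T \<le> card B + 1" by (rule card_T_le)
  show "u = (\<lambda>b. 0)" if "\<And>b. b \<notin> B \<Longrightarrow> u b = 0"
    "\<And>w. w \<in> T \<Longrightarrow> bil w (intercept \<nu>) u = 0 \<and> bil w u u = 0" for u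
    using path_rigid that by blast
  show "(\<Sum>w\<in>T. bil w (\<lambda>b. intercept \<nu> b + u b) (\<lambda>b. intercept \<nu> b + u b)) =
    (\<Sum>w\<in>T. bil w (intercept \<nu>) (intercept \<nu>))" if "\<And>b. b \<notin> B \<Longrightarrow> u b = 0" for u
    using path_total that by blast
  fix w assume w: "w \<in> T"
  interpret w: generic_polygon w e by (rule gtile[OF w])
  show "bil w u v = bil w v u" for u v unfolding bil_def by (rule w.mform_sym)
  show "bil w (\<lambda>b. r * u b + s * v b) y = r * bil w u y + s * bil w v y" for r u s v y
    unfolding bil_def path_linear by (rule w.mform_lincomb)
  show "continuous_on UNIV (\<lambda>u. bil w u u)" by (rule continuous_on_bil[OF w])
  show "bil w (intercept \<nu>) (intercept \<nu>) > 0" unfolding bil_intercept_intercept[OF w] by (rule w.mform_id_id_pos)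
  show "bil w u u \<le> 0" if "bil w (intercept \<nu>) u = 0" for u
    using w.lorentzian(1)[OF path_parallel[OF w]] that unfolding bil_intercept[OF w] by (simp add: bil_def)
qed

lemma area_total: "(\<Sum>w\<in>T. bil w (intercept \<nu>) (intercept \<nu>)) = measure lebesgue R"
proof -
  have "measure lebesgue R = (\<Sum>w\<in>T. measure lebesgue w)"
    unfolding Union_T[symmetric]
  proof (rule measure_negligible_finite_Union[OF finite_T])
    show "w \<in> lmeasurable" if "w \<in> T" for w
      by (rule lmeasurable_compact[OF polygon.compact[OF tile[OF that]]])
    show "pairwise (\<lambda>w w'. negligible (w \<inter> w')) T"
    proof (rule pairwiseI)
      fix w w' assume w: "w \<in> T" "w' \<in> T" "w \<noteq> w'"
      have "w \<inter> w' \<subseteq> frontier w"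
        using interior_disjoint[OF w] closure_subset[of w] by (auto simp: frontier_def)
      then show "negligible (w \<inter> w')"
        using negligible_convex_frontier[OF polygon.convex[OF tile[OF w(1)]]] negligible_subset by blast
    qed
  qed
  also have "\<dots> = (\<Sum>w\<in>T. bil w (intercept \<nu>) (intercept \<nu>))"
  proof (rule sum.cong[OF refl])
    fix w assume w: "w \<in> T"
    interpret w: generic_polygon w e by (rule gtile[OF w])
    show "measure lebesgue w = bil w (intercept \<nu>) (intercept \<nu>)"
      unfolding bil_intercept_intercept[OF w] w.measure_eq by (rule w.signed_area_eq[OF w.parallel_id])
  qed
  finally show ?thesis by simp
qed

lemma homology_tile_eq:
  assumes w: "w \<in> T" and v: "v \<in> verts w"
  shows "homology_tile R T \<nu> i w v = path (\<lambda>b. if b \<in> B then i b else intercept \<nu> b) w v"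
proof -
  define j where "j = (\<lambda>b. if b \<in> B then i b else intercept \<nu> b)"
  have "homology_line R T \<nu> i b = {x. \<nu> b \<bullet> x = j b}" for b
    by (simp add: homology_line_def j_def)
  then have "homology_line R T \<nu> i (inc w v) \<inter> homology_line R T \<nu> i (out w v) = {path j w v}"
    using isect_on[OF normals_independent[OF w v], of j] isect_unique[OF normals_independent[OF w v], of _ j]
    unfolding path_def by blast
  then show ?thesis by (simp add: homology_tile_def j_def)
qed

text \<open>Positivity of \<open>A w\<close> puts the path among the positive ones, where
  orientation is the sign of the pairing with the tile.\<close>

lemma homology_tile_iff:
  assumes w: "w \<in> T" and A: "A w > 0"
  defines "j \<equiv> \<lambda>i b. if b \<in> B then i b else intercept \<nu> b"
  shows "signed_area w (homology_tile R T \<nu> i w) = A w \<and>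
      tile_orientation w (homology_tile R T \<nu> i w) = tile_orientation w (\<lambda>v. v) \<longleftrightarrow>
    bil w (j i) (j i) = A w \<and> bil w (intercept \<nu>) (j i) > 0"
proof -
  interpret w: generic_polygon w e by (rule gtile[OF w])
  define P where "P = homology_tile R T \<nu> i w"
  have eq: "P v = path (j i) w v" if "v \<in> verts w" for v
    using homology_tile_eq[OF w that, of i] by (simp add: P_def j_def)
  have P: "parallel w P" using parallel_cong[OF tile[OF w], of P "path (j i) w"] eq path_parallel[OF w] by blast
  have 1: "bil w (j i) (j i) = w.mform P P" unfolding bil_def by (rule w.mform_cong) (simp_all add: eq)
  have 2: "bil w (intercept \<nu>) (j i) = w.mform (\<lambda>v. v) P"
    unfolding bil_intercept[OF w] by (rule w.mform_cong) (simp_all add: eq)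
  show ?thesis unfolding P_def[symmetric] 1 2 w.signed_area_eq[OF P] using w.tile_orientation_eq_iff[OF P] A by auto
qed

end

text \<open>A vector with nonzero ordinate excludes one value of \<open>e\<close>. For ordinate 0
  the listed value is the default 0 of division, and avoiding it does no harm.\<close>

lemma generic_direction:
  assumes "finite Z" "\<And>z. z \<in> Z \<Longrightarrow> z \<noteq> (0 :: point)"
  obtains e where "\<And>z. z \<in> Z \<Longrightarrow> fx e z \<noteq> 0"
proof -
  have "finite ((\<lambda>z. - (z $ 1 / z $ 2)) ` Z)" using assms(1) by blast
  then obtain e where e: "e \<notin> (\<lambda>z. - (z $ 1 / z $ 2)) ` Z" using ex_new_if_finite[OF infinite_UNIV_char_0] by blast
  have "fx e z \<noteq> 0" if z: "z \<in> Z" for z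
  proof
    assume 0: "fx e z = 0"
    then have "z $ 2 \<noteq> 0" using assms(2)[OF z] by (auto simp: fx_def point_eq_iff)
    then have "e = - (z $ 1 / z $ 2)" using 0 by (simp add: fx_def field_simps)
    then show False using e z by blast
  qed
  then show ?thesis using that by blast
qed

theorem theorem8:
  fixes R :: "point set" and T :: "point set set"
    and \<nu> :: "point set \<Rightarrow> point" and A :: "point set \<Rightarrow> real"
  assumes "convex_polygon R"
    and "convex_tiling R T"
    and "unit_normals T \<nu>"
    and "\<forall>f\<in>bounded_faces R T. card f = 4"
    and "\<forall>w\<in>T. A w > 0"
    and "(\<Sum>w\<in>T. A w) = measure lebesgue R"
  shows "\<exists>!i. i \<in> interior_segments R T \<rightarrow>\<^sub>E UNIV \<and>
           (\<forall>w\<in>T. signed_area w (homology_tile R T \<nu> i w) = A w \<and>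
                   tile_orientation w (homology_tile R T \<nu> i w) = tile_orientation w (\<lambda>v. v))"
proof -
  interpret tiling R T by unfold_locales (use assms in auto)
  define Z where "Z = (\<lambda>(p, q). q - p) ` (ccw_sides R \<union> (\<Union>w\<in>T. ccw_sides w))"
  have "finite Z" using finite_T polygon.finite_sides[OF tile] R.finite_sides by (simp add: Z_def)
  moreover have "z \<noteq> 0" if z: "z \<in> Z" for z
  proof -
    obtain p q where "z = q - p" "(p, q) \<in> ccw_sides R \<or> (\<exists>w\<in>T. (p, q) \<in> ccw_sides w)"
      using z by (auto simp: Z_def)
    then show ?thesis using R.side_neq polygon.side_neq[OF tile] by (metis eq_iff_diff_eq_0)
  qed
  ultimately obtain e where e: "\<And>z. z \<in> Z \<Longrightarrow> fx e z \<noteq> 0" using generic_direction[of Z] by blast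
  interpret quad_tiling R T \<nu> e
  proof
    show "fx e (q - p) \<noteq> 0" if "w \<in> T" "(p, q) \<in> ccw_sides w" for w p q
      by (rule e) (use that in \<open>force simp: Z_def\<close>)
    show "fx e (q - p) \<noteq> 0" if "(p, q) \<in> ccw_sides R" for p q
      by (rule e) (use that in \<open>force simp: Z_def\<close>)
  qed (use assms in auto)
  interpret L: lorentz_family T B bil "intercept \<nu>" by (rule lorentz_family)
  \<comment> \<open>\<open>i\<close> gives only the interior intercepts: \<open>j i\<close> adds the
    fixed boundary ones, and \<open>U i\<close> is the displacement from the given tiling.\<close>
  define j where "j i b = (if b \<in> B then i b else intercept \<nu> b)" for i b
  define U where "U i b = (if b \<in> B then i b - intercept \<nu> b else 0)" for i b
  have U: "L.supp (U i)" "(\<lambda>b. intercept \<nu> b + U i b) = j i" for i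
    by (auto simp: L.supp_def U_def j_def)
  have A: "A w > 0" if "w \<in> T" for w using assms that by blast
  have iff: "(\<forall>w\<in>T. signed_area w (homology_tile R T \<nu> i w) = A w \<and>
        tile_orientation w (homology_tile R T \<nu> i w) = tile_orientation w (\<lambda>v. v)) \<longleftrightarrow>
      (\<forall>w\<in>T. bil w (j i) (j i) = A w \<and> bil w (intercept \<nu>) (j i) > 0)" for i
    using homology_tile_iff[of _ A i] A unfolding j_def by blast
  obtain u where u: "L.supp u" "\<forall>w\<in>T. bil w (\<lambda>b. intercept \<nu> b + u b) (\<lambda>b. intercept \<nu> b + u b) = A w \<and>
     bil w (intercept \<nu>) (\<lambda>b. intercept \<nu> b + u b) > 0"
    using L.solution_exists[of A] A assms(6) area_total by auto
  define i0 where "i0 = restrict (\<lambda>b. intercept \<nu> b + u b) B"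
  have j0: "j i0 = (\<lambda>b. intercept \<nu> b + u b)"
    using u(1) by (auto simp: j_def i0_def L.supp_def fun_eq_iff)
  show ?thesis
  proof (rule ex1I[of _ i0])
    show "i0 \<in> B \<rightarrow>\<^sub>E UNIV \<and> (\<forall>w\<in>T. signed_area w (homology_tile R T \<nu> i0 w) = A w \<and>
        tile_orientation w (homology_tile R T \<nu> i0 w) = tile_orientation w (\<lambda>v. v))"
      unfolding iff j0 using u(2) by (simp add: i0_def)
    fix i assume "i \<in> B \<rightarrow>\<^sub>E UNIV \<and> (\<forall>w\<in>T. signed_area w (homology_tile R T \<nu> i w) = A w \<and>
        tile_orientation w (homology_tile R T \<nu> i w) = tile_orientation w (\<lambda>v. v))"
    then have i: "i \<in> B \<rightarrow>\<^sub>E UNIV" "\<forall>w\<in>T. bil w (j i) (j i) = A w \<and> bil w (intercept \<nu>) (j i) > 0"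
      unfolding iff by auto
    \<comment> \<open>Equal displacements give equal intercepts on \<open>B\<close>; outside
      \<open>B\<close> both functions are extensional.\<close>
    have "U i = u"
      by (rule L.solution_unique[of "U i" A u]) (use U u i A in auto)
    then have "i b = i0 b" for b
      using i(1) fun_cong[OF \<open>U i = u\<close>, of b]
      by (cases "b \<in> B") (auto simp: U_def i0_def PiE_def extensional_def algebra_simps)
    then show "i = i0" by blast
  qed
qed

end
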